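(* Let $\lambda\ge 0$, let $\mathbf{x}_1,\dots,\mathbf{x}_{N_r}\in\mathbb{R}^2$ be distinct points, let $f_1,\dots,f_N\in\mathbb{R}$, let $b_1,\dots,b_{N_b}:\mathbb{R}\to\mathbb{R}$ be given functions with $\|b_\nu\|_{L_2}=1$ (possibly with overlapping supports), and let $\varphi_{rn}\in\mathbb{R}$ for $r=1,\dots,N_r$, $n=1,\dots,N$. Let the estimates $\{\hat g_\nu\}_{\nu=1}^{N_b}$ be defined by $$\{\hat g_\nu\}_{\nu=1}^{N_b}:=\arg\min_{\{g_\nu\in\mathcal{S}\}}\ \frac{1}{N_rN}\sum_{r=1}^{N_r}\sum_{n=1}^{N}\Big(\varphi_{rn}-\sum_{\nu=1}^{N_b}g_\nu(\mathbf{x}_r)b_\nu(f_n)\Big)^2+\lambda\sum_{\nu=1}^{N_b}\int_{\mathbb{R}^2}\|\nabla^2 g_\nu(\mathbf{x})\|_F^2\,d\mathbf{x}.$$ Then the estimates $\{\hat g_\nu\}_{\nu=1}^{N_b}$ are thin-plate splines expressible in closed form as $$\hat g_\nu(\mathbf{x})=\sum_{r=1}^{N_r}\beta_{\nu r}K(\|\mathbf{x}-\mathbf{x}_r\|_2)+\boldsymbol{\alpha}_{\nu1}^{\prime}\mathbf{x}+\alpha_{\nu0},$$ where $K(\rho):=\rho^2\log(\rho)$, $\alpha_{\nu0}\in\mathbb{R}$, $\boldsymbol{\alpha}_{\nu1}\in\mathbb{R}^2$, and $\boldsymbol{\beta}_\nu:=[\beta_{\nu1},\dots,\beta_{\nu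 N_r}]^{\prime}$ is constrained to the linear subspace $$\mathcal{B}:=\Big\{\boldsymbol{\beta}\in\mathbb{R}^{N_r}:\ \sum_{r=1}^{N_r}\beta_r=0,\ \sum_{r=1}^{N_r}\beta_r\mathbf{x}_r=\mathbf{0}\in\mathbb{R}^2\Big\},\qquad \nu=1,\dots,N_b.$$
   Context: $\mathcal{S}$ is the (Sobolev) space of functions for which the penalty is well defined: all (continuous) functions $g:\mathbb{R}^2\to\mathbb{R}$ whose second-order distributional partial derivatives all belong to $L^2(\mathbb{R}^2)$. $\nabla^2 g$ denotes the Hessian of $g$ and $\|\cdot\|_F$ the Frobenius norm. Prime denotes transposition. $K(0):=0$ by continuity.
   Formalization: For λ = 0 minimizers are never all thin-plate splines (add a bump vanishing at every x_r), so the claim about every minimizer is stated for λ > 0 only; for all λ ≥ 0 it is stated that some minimizer has the given thin-plate-spline form. *)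

theory Defs
  imports "HOL-Analysis.Analysis"
begin

definition L2 :: "('a::euclidean_space \<Rightarrow> real) set" where
  "L2 = {f. f \<in> borel_measurable lebesgue \<and> integrable lebesgue (\<lambda>x. (f x)\<^sup>2)}"

definition L2_norm :: "('a::euclidean_space \<Rightarrow> real) \<Rightarrow> real" where
  "L2_norm f = sqrt (LINT x|lebesgue. (f x)\<^sup>2)"

definition partial :: "2 \<Rightarrow> (real^2 \<Rightarrow> real) \<Rightarrow> real^2 \<Rightarrow> real" where
  "partial i \<phi> x = frechet_derivative \<phi> (at x) (axis i 1)"

text \<open>Functions of class \<open>C\<^sup>k\<close>: a differentiable function whose first-order partial derivatives
  are all \<open>C\<^sup>k\<close> is \<open>C\<^sup>k\<^sup>+\<^sup>1\<close>.\<close>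

fun Ck :: "nat \<Rightarrow> (real^2 \<Rightarrow> real) \<Rightarrow> bool" where
  "Ck 0 \<phi> \<longleftrightarrow> continuous_on UNIV \<phi>"
| "Ck (Suc k) \<phi> \<longleftrightarrow> (\<forall>x. \<phi> differentiable (at x)) \<and> (\<forall>i. Ck k (partial i \<phi>))"

definition test_functions :: "(real^2 \<Rightarrow> real) set" where
  "test_functions = {\<phi>. (\<forall>k. Ck k \<phi>) \<and> compact (closure (support_on UNIV \<phi>))}"

text \<open>\<open>H\<close> is an \<open>L\<^sup>2\<close> representative of the distributional Hessian of \<open>g\<close>. Two integrations by parts
  leave no sign. This is meant for locally integrable \<open>g\<close>, in particular for continuous \<open>g\<close>.\<close>

definition has_L2_hessian :: "(real^2 \<Rightarrow> real) \<Rightarrow> (real^2 \<Rightarrow> real^2^2) \<Rightarrow> bool" where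
  "has_L2_hessian g H \<longleftrightarrow>
     (\<forall>i j. (\<lambda>x. H x $ i $ j) \<in> L2 \<and>
       (\<forall>\<phi>\<in>test_functions.
          (LINT x|lebesgue. g x * partial i (partial j \<phi>) x)
            = (LINT x|lebesgue. H x $ i $ j * \<phi> x)))"

definition Sob :: "(real^2 \<Rightarrow> real) set" where
  "Sob = {g. continuous_on UNIV g \<and> (\<exists>H. has_L2_hessian g H)}"

text \<open>The distributional Hessian is determined only almost everywhere; the penalty below does not
  depend on the representative chosen here.\<close>

definition hessian :: "(real^2 \<Rightarrow> real) \<Rightarrow> real^2 \<Rightarrow> real^2^2" where
  "hessian g = (SOME H. has_L2_hessian g H)"

text \<open>The norm of the type \<open>real^2^2\<close> is the square root of the sum of the squared entries, that is,
  the Frobenius norm.\<close>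

definition penalty :: "(real^2 \<Rightarrow> real) \<Rightarrow> real" where
  "penalty g = (LINT x|lebesgue. (norm (hessian g x))\<^sup>2)"

definition cost ::
  "real \<Rightarrow> nat \<Rightarrow> nat \<Rightarrow> nat \<Rightarrow> (nat \<Rightarrow> real^2) \<Rightarrow> (nat \<Rightarrow> real) \<Rightarrow> (nat \<Rightarrow> real \<Rightarrow> real)
    \<Rightarrow> (nat \<Rightarrow> nat \<Rightarrow> real) \<Rightarrow> (nat \<Rightarrow> real^2 \<Rightarrow> real) \<Rightarrow> real" where
  "cost lam Nr N Nb x f b \<phi> g =
     1 / (real Nr * real N) *
       (\<Sum>r=1..Nr. \<Sum>n=1..N. (\<phi> r n - (\<Sum>\<nu>=1..Nb. g \<nu> (x r) * b \<nu> (f n)))\<^sup>2)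
     + lam * (\<Sum>\<nu>=1..Nb. penalty (g \<nu>))"

text \<open>Only the components \<open>g 1, \<dots>, g Nb\<close> of the family \<open>g\<close> are meaningful. For
  \<open>lam = 0\<close> the cost only sees the values at the points \<open>x r\<close>, so it has minimizers that are not
  thin-plate splines.\<close>

definition is_estimate ::
  "real \<Rightarrow> nat \<Rightarrow> nat \<Rightarrow> nat \<Rightarrow> (nat \<Rightarrow> real^2) \<Rightarrow> (nat \<Rightarrow> real) \<Rightarrow> (nat \<Rightarrow> real \<Rightarrow> real)
    \<Rightarrow> (nat \<Rightarrow> nat \<Rightarrow> real) \<Rightarrow> (nat \<Rightarrow> real^2 \<Rightarrow> real) \<Rightarrow> bool" where
  "is_estimate lam Nr N Nb x f b \<phi> =
     is_arg_min (cost lam Nr N Nb x f b \<phi>) (\<lambda>g. \<forall>\<nu>\<in>{1..Nb}. g \<nu> \<in> Sob)"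

text \<open>Note that \<open>K 0 = 0\<close>, the continuous extension.\<close>

definition K :: "real \<Rightarrow> real" where
  "K \<rho> = \<rho>\<^sup>2 * ln \<rho>"

definition B_space :: "nat \<Rightarrow> (nat \<Rightarrow> real^2) \<Rightarrow> (nat \<Rightarrow> real) set" where
  "B_space Nr x = {\<beta>. (\<Sum>r=1..Nr. \<beta> r) = 0 \<and> (\<Sum>r=1..Nr. \<beta> r *\<^sub>R x r) = 0}"

definition thin_plate_spline :: "nat \<Rightarrow> (nat \<Rightarrow> real^2) \<Rightarrow> (real^2 \<Rightarrow> real) \<Rightarrow> bool" where
  "thin_plate_spline Nr x g \<longleftrightarrow>
     (\<exists>\<beta>\<in>B_space Nr x. \<exists>(\<alpha>1 :: real^2) (\<alpha>0 :: real).
        \<forall>y. g y = (\<Sum>r=1..Nr. \<beta> r * K (norm (y - x r))) + \<alpha>1 \<bullet> y + \<alpha>0)"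

end

theory Submission
  imports Defs
begin

text \<open>The key identity is that for a thin-plate spline \<open>s\<close> with coefficients \<open>\<beta>\<close> and every \<open>g\<close> in the
  Sobolev space, the \<open>L\<^sup>2\<close> inner product of the Hessians of \<open>s\<close> and \<open>g\<close> is a positive constant times
  \<open>\<Sum>r. \<beta> r * g (x r)\<close>, because \<open>s\<close> solves the biharmonic equation with point sources. To prove it, the
  kernel is smoothed at scale \<open>1 / R\<close> and the Hessian of \<open>s\<close> is cut off at radius \<open>R\<close>, which gives
  test functions. The difficulty is the boundary term at infinity, since nothing is known about the
  growth of \<open>g\<close>. That term is a source of size \<open>R\<^sup>-\<^sup>4\<close>, which is written as the double divergence of a
  field with small \<open>L\<^sup>2\<close> norm and so only meets the Hessian of \<open>g\<close>.

  The identity yields the rest: a function with vanishing Hessian satisfies all linear relations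
  that hold for affine functions, hence is affine; interpolation by splines is always possible at
  distinct points, by the Fredholm alternative; a function vanishing at the points \<open>x r\<close> is orthogonal
  to all splines. The normal equations of the problem restricted to splines are solvable, and their
  solution is a minimizer by orthogonality. Another minimizer differs from it by functions with zero
  penalty if \<open>lam > 0\<close>.\<close>

section \<open>Smooth functions on the plane\<close>

text \<open>No bound on \<open>g\<close> itself is available: only its Hessian is square integrable,
  so every term at infinity has to be turned back into a pairing with that Hessian. The moment
  conditions of \<open>B_space\<close> cancel the parts of the kernel that are constant or linear in
  the centre. The Hessian of a spline then decays like |y|^-2, which is square integrable outside a
  disc, and the gradient of its Laplacian like |y|^-3. Cut-off derivatives of size R^-2 and R^-1
  complete both to R^-4, and so does the bilaplacian away from the centres, which is of the order of
  the fourth power of the smoothing scale.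

  Within radius 2 R a source of size R^-4 is at most a constant times R^(-1/2) |y|^(-7/2). The half
  power is the margin: two integrations turn |y|^(-7/2) into |y|^(-3/2), which is square integrable
  at infinity, and R^(-1/2) tends to 0.

  Up to affine functions the identity makes splines reproducing kernels for point evaluations. It
  holds for coinciding points as well, so that functions with vanishing Hessian are seen to be
  affine without regularity theory.\<close>

definition smooth :: "(real^2 \<Rightarrow> real) \<Rightarrow> bool" where
  "smooth \<phi> \<longleftrightarrow> (\<forall>k. Ck k \<phi>)"

lemma partial_eq:
  assumes "(\<phi> has_derivative D) (at x)"
  shows "partial i \<phi> x = D (axis i 1)"
  using assms unfolding partial_def by (metis frechet_derivative_at)

lemma has_derivative_partial:
  assumes "\<phi> differentiable (at x)"
  shows "(\<phi> has_derivative (\<lambda>h. \<Sum>i\<in>UNIV. h $ i * partial i \<phi> x)) (at x)"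
proof -
  obtain D where D: "(\<phi> has_derivative D) (at x)"
    using assms by (auto simp: differentiable_def)
  then have lin: "linear D" by (rule has_derivative_linear)
  have "D h = (\<Sum>i\<in>UNIV. h $ i * partial i \<phi> x)" for h
  proof -
    have "D h = D (\<Sum>i\<in>UNIV. (h $ i) *\<^sub>R axis i 1)"
      using basis_expansion[of h] by (simp add: scalar_mult_eq_scaleR)
    also have "\<dots> = (\<Sum>i\<in>UNIV. (h $ i) * D (axis i 1))"
      using lin by (simp add: linear_sum linear_scale)
    finally show ?thesis by (simp add: partial_eq[OF D])
  qed
  then have "D = (\<lambda>h. \<Sum>i\<in>UNIV. h $ i * partial i \<phi> x)" by blast
  with D show ?thesis by simp
qed

text \<open>At successor levels \<open>Ck\<close> asks for differentiability; continuity is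
  recovered from it in the base case, which nests the classes.\<close>

lemma Ck_SucD: "Ck (Suc k) \<phi> \<Longrightarrow> Ck k \<phi>"
proof (induction k arbitrary: \<phi>)
  case 0
  then have "\<phi> differentiable_on UNIV" by (simp add: differentiable_on_def)
  then show ?case by (simp add: differentiable_imp_continuous_on)
qed auto

lemma smoothD:
  assumes "smooth \<phi>"
  shows "\<phi> differentiable (at x)" "smooth (partial i \<phi>)" "continuous_on UNIV \<phi>"
proof -
  have "Ck (Suc k) \<phi>" for k using assms smooth_def by blast
  then show "\<phi> differentiable (at x)" "smooth (partial i \<phi>)" by (auto simp: smooth_def)
  show "continuous_on UNIV \<phi>" using assms Ck.simps(1) smooth_def by blast
qed

lemma smooth_has_derivative:
  "smooth \<phi> \<Longrightarrow> (\<phi> has_derivative (\<lambda>h. \<Sum>i\<in>UNIV. h $ i * partial i \<phi> x)) (at x)"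
  by (simp add: has_derivative_partial smoothD)

lemma smooth_borel: "smooth \<phi> \<Longrightarrow> \<phi> \<in> borel_measurable borel"
  by (simp add: borel_measurable_continuous_onI smoothD)

lemma Ck_SucI:
  assumes "\<And>x. (\<phi> has_derivative D x) (at x)" "\<And>i. Ck k (\<lambda>x. D x (axis i 1))"
  shows "Ck (Suc k) \<phi>"
proof -
  have "partial i \<phi> = (\<lambda>x. D x (axis i 1))" for i
    using partial_eq[OF assms(1)] by blast
  then show ?thesis using assms by (auto simp: differentiable_def)
qed

lemma Ck_const: "Ck k (\<lambda>x. c)"
proof (induction k arbitrary: c)
  case (Suc k)
  show ?case by (rule Ck_SucI[where D="\<lambda>x h. 0"]) (use Suc in auto)
qed auto

lemma smooth_const: "smooth (\<lambda>x. c)"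
  by (simp add: smooth_def Ck_const)

lemma smooth_nth: "smooth (\<lambda>x. x $ i)"
  unfolding smooth_def
proof
  fix k show "Ck k (\<lambda>x. x $ i)"
  proof (cases k)
    case 0 then show ?thesis by (simp add: continuous_on_component)
  next
    case (Suc n)
    have "Ck (Suc n) (\<lambda>x. x $ i)"
      by (rule Ck_SucI[where D="\<lambda>x h. h $ i"])
         (auto intro!: derivative_eq_intros bounded_linear_imp_has_derivative bounded_linear_vec_nth
            simp: Ck_const)
    then show ?thesis using Suc by simp
  qed
qed

lemma partial_nth: "partial i (\<lambda>x. x $ j) x = (if i = j then 1 else 0)"
  using partial_eq[OF bounded_linear_imp_has_derivative[OF bounded_linear_vec_nth], of i j x]
  by (simp add: axis_def)

lemma partial_const: "partial i (\<lambda>x. c) x = 0"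
  using partial_eq[OF has_derivative_const] by metis

lemma partial_add:
  assumes "u differentiable (at x)" "v differentiable (at x)"
  shows "partial i (\<lambda>x. u x + v x) x = partial i u x + partial i v x"
proof -
  obtain D E where "(u has_derivative D) (at x)" "(v has_derivative E) (at x)"
    using assms by (auto simp: differentiable_def)
  then show ?thesis
    using partial_eq[OF has_derivative_add, of u D x v E i] by (simp add: partial_eq)
qed

lemma partial_mult:
  assumes "u differentiable (at x)" "v differentiable (at x)"
  shows "partial i (\<lambda>x. u x * v x) x = u x * partial i v x + partial i u x * v x"
proof -
  obtain D E where "(u has_derivative D) (at x)" "(v has_derivative E) (at x)"
    using assms by (auto simp: differentiable_def)
  then show ?thesis
    using partial_eq[OF has_derivative_mult, of u D x v E i] by (simp add: partial_eq)
qed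

lemma Ck_add: "Ck k u \<Longrightarrow> Ck k v \<Longrightarrow> Ck k (\<lambda>x. u x + v x)"
proof (induction k arbitrary: u v)
  case (Suc k)
  then have "partial i (\<lambda>x. u x + v x) = (\<lambda>x. partial i u x + partial i v x)" for i
    by (intro ext partial_add) auto
  with Suc show ?case by (auto intro: differentiable_add)
qed (auto intro: continuous_intros)

lemma Ck_mult: "Ck k u \<Longrightarrow> Ck k v \<Longrightarrow> Ck k (\<lambda>x. u x * v x)"
proof (induction k arbitrary: u v)
  case (Suc k)
  then have "partial i (\<lambda>x. u x * v x) = (\<lambda>x. u x * partial i v x + partial i u x * v x)" for i
    by (intro ext partial_mult) auto
  moreover have "Ck k (\<lambda>x. u x * partial i v x + partial i u x * v x)" for i
    using Suc Ck_SucD[OF Suc.prems(1)] Ck_SucD[OF Suc.prems(2)] by (intro Ck_add Suc.IH) auto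
  ultimately show ?case using Suc.prems by (auto intro: differentiable_mult)
qed (auto intro: continuous_intros)

lemma smooth_add: "smooth u \<Longrightarrow> smooth v \<Longrightarrow> smooth (\<lambda>x. u x + v x)"
  by (simp add: smooth_def Ck_add)

lemma smooth_mult: "smooth u \<Longrightarrow> smooth v \<Longrightarrow> smooth (\<lambda>x. u x * v x)"
  by (simp add: smooth_def Ck_mult)

lemma smooth_cmult: "smooth u \<Longrightarrow> smooth (\<lambda>x. c * u x)"
  by (simp add: smooth_mult smooth_const)

lemma smooth_minus: "smooth u \<Longrightarrow> smooth (\<lambda>x. - u x)"
  using smooth_cmult[of u "-1"] by simp

lemma smooth_diff: "smooth u \<Longrightarrow> smooth v \<Longrightarrow> smooth (\<lambda>x. u x - v x)"
  using smooth_add[OF _ smooth_minus, of u v] by simp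

lemma smooth_sum: "(\<And>r. r \<in> A \<Longrightarrow> smooth (u r)) \<Longrightarrow> smooth (\<lambda>x. \<Sum>r\<in>A. u r x)"
  by (induction A rule: infinite_finite_induct) (auto intro: smooth_const smooth_add)

lemma smooth_power: "smooth u \<Longrightarrow> smooth (\<lambda>x. u x ^ n)"
  by (induction n) (auto intro: smooth_const smooth_mult)

lemma partial_cmult:
  assumes "u differentiable (at x)"
  shows "partial i (\<lambda>x. c * u x) x = c * partial i u x"
  using partial_mult[OF differentiable_const assms, of i c] by (simp add: partial_const)

lemma partial_sum:
  assumes "\<And>r. r \<in> A \<Longrightarrow> u r differentiable (at x)"
  shows "partial i (\<lambda>x. \<Sum>r\<in>A. u r x) x = (\<Sum>r\<in>A. partial i (u r) x)"
proof -
  have "\<exists>D. \<forall>r\<in>A. (u r has_derivative D r) (at x)"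
    using assms unfolding differentiable_def by metis
  then obtain D where D: "\<And>r. r \<in> A \<Longrightarrow> (u r has_derivative D r) (at x)" by blast
  show ?thesis
    using partial_eq[OF has_derivative_sum[of A u D], OF D, of i] by (simp add: partial_eq[OF D])
qed

lemma differentiable_chain_real:
  fixes u :: "real^2 \<Rightarrow> real"
  assumes "(h has_real_derivative d) (at (u x))" "u differentiable (at x)"
  shows "(\<lambda>x. h (u x)) differentiable (at x)" "partial i (\<lambda>x. h (u x)) x = d * partial i u x"
proof -
  obtain D where D: "(u has_derivative D) (at x)"
    using assms by (auto simp: differentiable_def)
  have *: "((\<lambda>x. h (u x)) has_derivative (\<lambda>y. d * D y)) (at x)"
    using has_derivative_compose[OF D, of h "\<lambda>y. d * y"] assms(1)
    by (simp add: has_field_derivative_def)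
  then show "(\<lambda>x. h (u x)) differentiable (at x)" by (auto simp: differentiable_def)
  show "partial i (\<lambda>x. h (u x)) x = d * partial i u x"
    using partial_eq[OF *] partial_eq[OF D] by simp
qed

text \<open>The gradient of 1 / u is that of u times - (1 / u)^2, so the class \<open>Ck k\<close>
  of 1 / u itself yields the class \<open>Ck (Suc k)\<close>.\<close>

lemma smooth_inverse:
  assumes u: "smooth u" and nz: "\<And>x. u x \<noteq> 0"
  shows "smooth (\<lambda>x. inverse (u x))"
proof -
  have "Ck k (\<lambda>x. inverse (u x))" for k
  proof (induction k)
    case 0 then show ?case using smoothD(3)[OF u] nz by (auto intro!: continuous_intros)
  next
    case (Suc k)
    have d: "(\<lambda>x. inverse (u x)) differentiable (at x)"
       and p: "partial i (\<lambda>x. inverse (u x)) x = (-1 * (inverse (u x) * inverse (u x))) * partial i u x" for x i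
      using differentiable_chain_real(1)[OF DERIV_inverse[OF nz] smoothD(1)[OF u]]
        differentiable_chain_real(2)[OF DERIV_inverse[OF nz] smoothD(1)[OF u], of i]
      by (auto simp: power2_eq_square)
    have "Ck k (\<lambda>x. (-1 * (inverse (u x) * inverse (u x))) * partial i u x)" for i
      using Suc smoothD(2)[OF u] by (intro Ck_mult Ck_const) (auto simp: smooth_def)
    moreover have "partial i (\<lambda>x. inverse (u x)) = (\<lambda>x. (-1 * (inverse (u x) * inverse (u x))) * partial i u x)" for i
      using p by blast
    ultimately show ?case using d by simp
  qed
  then show ?thesis by (simp add: smooth_def)
qed

lemma smooth_divide:
  "smooth v \<Longrightarrow> smooth u \<Longrightarrow> (\<And>x. u x \<noteq> 0) \<Longrightarrow> smooth (\<lambda>x. v x / u x)"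
  by (simp add: divide_inverse smooth_mult smooth_inverse)

lemma smoothI:
  assumes "\<And>x. \<phi> differentiable (at x)" "\<And>i. smooth (partial i \<phi>)"
  shows "smooth \<phi>"
  unfolding smooth_def
proof
  fix k show "Ck k \<phi>" using assms by (intro Ck_SucD[of k]) (auto simp: smooth_def)
qed

lemma smooth_ln:
  assumes u: "smooth u" and pos: "\<And>x. u x > 0"
  shows "smooth (\<lambda>x. ln (u x))"
proof (rule smoothI)
  fix x
  show "(\<lambda>x. ln (u x)) differentiable (at x)"
    using differentiable_chain_real(1)[OF DERIV_ln_divide[OF pos] smoothD(1)[OF u]] .
next
  fix i
  have "partial i (\<lambda>x. ln (u x)) = (\<lambda>x. 1 / u x * partial i u x)"
    using differentiable_chain_real(2)[OF DERIV_ln_divide[OF pos] smoothD(1)[OF u]] by blast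
  moreover have "u x \<noteq> 0" for x using pos[of x] by simp
  ultimately show "smooth (partial i (\<lambda>x. ln (u x)))"
    by (simp add: smooth_mult smooth_divide smooth_const u smoothD(2))
qed

lemma partial_affine_arg:
  assumes "u differentiable (at (a *\<^sub>R x + c))"
  shows "(\<lambda>x. u (a *\<^sub>R x + c)) differentiable (at x)"
    "partial i (\<lambda>x. u (a *\<^sub>R x + c)) x = a * partial i u (a *\<^sub>R x + c)"
proof -
  obtain D where D: "(u has_derivative D) (at (a *\<^sub>R x + c))"
    using assms by (auto simp: differentiable_def)
  have "((\<lambda>x. a *\<^sub>R x + c) has_derivative (\<lambda>h. a *\<^sub>R h)) (at x)"
    by (auto intro!: derivative_eq_intros)
  from has_derivative_compose[OF this D]
  have *: "((\<lambda>x. u (a *\<^sub>R x + c)) has_derivative (\<lambda>h. D (a *\<^sub>R h))) (at x)" .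
  then show "(\<lambda>x. u (a *\<^sub>R x + c)) differentiable (at x)" by (auto simp: differentiable_def)
  show "partial i (\<lambda>x. u (a *\<^sub>R x + c)) x = a * partial i u (a *\<^sub>R x + c)"
    using partial_eq[OF *] partial_eq[OF D] has_derivative_linear[OF D] by (simp add: linear_scale)
qed

lemma smooth_affine_arg:
  assumes "smooth u"
  shows "smooth (\<lambda>x. u (a *\<^sub>R x + c))"
proof -
  have "Ck k u \<Longrightarrow> Ck k (\<lambda>x. u (a *\<^sub>R x + c))" for k u
  proof (induction k arbitrary: u)
    case 0
    then show ?case by (auto intro!: continuous_on_compose2[of UNIV u] continuous_intros)
  next
    case (Suc k)
    then have "partial i (\<lambda>x. u (a *\<^sub>R x + c)) = (\<lambda>x. a * partial i u (a *\<^sub>R x + c))" for i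
      by (intro ext partial_affine_arg) auto
    moreover have "Ck k (\<lambda>x. a * partial i u (a *\<^sub>R x + c))" for i
      using Suc by (intro Ck_mult Ck_const) auto
    ultimately show ?case using Suc.prems by (auto intro: partial_affine_arg)
  qed
  then show ?thesis using assms by (simp add: smooth_def)
qed

lemma smooth_shift: "smooth u \<Longrightarrow> smooth (\<lambda>x. u (x - c))"
  using smooth_affine_arg[of u 1 "-c"] by simp

lemma partial_shift: "smooth u \<Longrightarrow> partial i (\<lambda>x. u (x - c)) x = partial i u (x - c)"
  using partial_affine_arg(2)[of u 1 x "-c" i] by (simp add: smoothD)

text \<open>\<open>partial\<close> rests on a choice of derivative. The candidate derivatives of
  both functions at x are shown to be the same, and then so is the chosen one, whether or not a
  derivative exists.\<close>

lemma partial_open_cong: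
  assumes "open S" "x \<in> S" "\<And>y. y \<in> S \<Longrightarrow> u y = v y"
  shows "partial i u x = partial i v x"
proof -
  have "(u has_derivative D) (at x) \<longleftrightarrow> (v has_derivative D) (at x)" for D
    using has_derivative_transform_within_open[OF _ assms(1,2), of u D UNIV v]
      has_derivative_transform_within_open[OF _ assms(1,2), of v D UNIV u] assms(3) by auto
  then show ?thesis by (simp add: partial_def frechet_derivative_def)
qed

lemma partial2_mult:
  assumes u: "smooth u" and v: "smooth v"
  shows "partial i (partial j (\<lambda>x. u x * v x)) x =
    u x * partial i (partial j v) x + partial i u x * partial j v x
      + partial j u x * partial i v x + partial i (partial j u) x * v x"
proof -
  have "partial j (\<lambda>x. u x * v x) = (\<lambda>x. u x * partial j v x + partial j u x * v x)"
    using partial_mult u v smoothD(1) by blast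
  moreover have "(\<lambda>x. u x * partial j v x) differentiable (at x)" "(\<lambda>x. partial j u x * v x) differentiable (at x)"
    using u v by (auto intro!: smoothD(1) smooth_mult smoothD(2))
  ultimately show ?thesis
    using u v by (simp add: partial_add partial_mult smoothD)
qed

section \<open>Smooth dependence of integrals along rays\<close>

lemma ray_integral_has_derivative:
  fixes w :: "real \<Rightarrow> real"
  assumes w: "continuous_on UNIV w"
    and d: "\<And>x. E differentiable (at x)" and c: "\<And>i. continuous_on UNIV (partial i E)"
  shows "((\<lambda>y. integral {1..T} (\<lambda>t. w t * E (t *\<^sub>R y))) has_derivative
     (\<lambda>h. \<Sum>i\<in>UNIV. h $ i * integral {1..T} (\<lambda>t. (w t * t) * partial i E (t *\<^sub>R y)))) (at y)"
proof -
  have Ec: "continuous_on UNIV E"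
    using d differentiable_imp_continuous_on differentiable_on_def by blast
  \<comment> \<open>The Leibniz rule takes derivatives in the normed space of bounded linear maps:
    \<open>b i\<close> are the coordinate functionals there and \<open>fx\<close> is the gradient of
    the integrand.\<close>
  define b where "b i = Blinfun (\<lambda>h::real^2. h $ i)" for i :: 2
  have b: "blinfun_apply (b i) h = h $ i" for i h
    unfolding b_def by (simp add: bounded_linear_Blinfun_apply bounded_linear_vec_nth)
  define fx where "fx y t = (\<Sum>i\<in>UNIV. ((w t * t) * partial i E (t *\<^sub>R y)) *\<^sub>R b i)" for y t
  have int: "(\<lambda>t. w t * E (t *\<^sub>R y)) integrable_on cbox 1 T" for y
    by (intro integrable_continuous continuous_intros continuous_on_subset[OF w]
        continuous_on_compose2[OF Ec]) auto
  have intp: "(\<lambda>t. (w t * t) * partial i E (t *\<^sub>R y)) integrable_on cbox 1 T" for y i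
    by (intro integrable_continuous continuous_intros continuous_on_subset[OF w]
        continuous_on_compose2[OF c]) auto
  have cont: "continuous_on (UNIV \<times> cbox 1 T) (\<lambda>(y, t). fx y t)"
    unfolding fx_def split_def
    by (intro continuous_intros continuous_on_compose2[OF w]
        continuous_on_compose2[OF c]) auto
  have "((\<lambda>y. integral (cbox 1 T) (\<lambda>t. w t * E (t *\<^sub>R y))) has_derivative
          integral (cbox 1 T) (fx y)) (at y within UNIV)"
  proof (rule leibniz_rule[OF _ int cont])
    fix y :: "real^2" and t :: real assume "t \<in> cbox 1 T"
    have *: "((\<lambda>y. E (t *\<^sub>R y)) has_derivative (\<lambda>h. \<Sum>i\<in>UNIV. (t *\<^sub>R h) $ i * partial i E (t *\<^sub>R y))) (at y)"
      by (rule has_derivative_compose[OF _ has_derivative_partial[OF d], where f="\<lambda>y. t *\<^sub>R y"])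
         (auto intro!: derivative_eq_intros)
    show "((\<lambda>y. w t * E (t *\<^sub>R y)) has_derivative blinfun_apply (fx y t)) (at y within UNIV)"
      using has_derivative_mult_right[OF *, of "w t"]
      by (rule has_derivative_eq_rhs) (auto simp: fx_def fun_eq_iff blinfun.sum_left blinfun.scaleR_left b sum_distrib_left mult_ac)
  qed auto
  moreover have "blinfun_apply (integral (cbox 1 T) (fx y)) h =
     (\<Sum>i\<in>UNIV. h $ i * integral {1..T} (\<lambda>t. (w t * t) * partial i E (t *\<^sub>R y)))" for h
  proof -
    have "((\<lambda>t. fx y t) has_integral
       (\<Sum>i\<in>UNIV. integral (cbox 1 T) (\<lambda>t. (w t * t) * partial i E (t *\<^sub>R y)) *\<^sub>R b i)) (cbox 1 T)"
      unfolding fx_def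
      by (intro has_integral_sum has_integral_scaleR_left) (use intp in auto)
    then have "integral (cbox 1 T) (fx y) = (\<Sum>i\<in>UNIV. integral (cbox 1 T) (\<lambda>t. (w t * t) * partial i E (t *\<^sub>R y)) *\<^sub>R b i)"
      by (rule integral_unique)
    then show ?thesis by (simp add: blinfun.sum_left blinfun.scaleR_left b mult_ac)
  qed
  then have "blinfun_apply (integral (cbox 1 T) (fx y)) = (\<lambda>h.
     \<Sum>i\<in>UNIV. h $ i * integral {1..T} (\<lambda>t. (w t * t) * partial i E (t *\<^sub>R y)))"
    by blast
  ultimately show ?thesis by simp
qed

lemma partial_ray_integral:
  assumes "continuous_on UNIV w" "smooth E"
  shows "partial i (\<lambda>y. integral {1..T} (\<lambda>t. w t * E (t *\<^sub>R y))) y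
     = integral {1..T} (\<lambda>t. (w t * t) * partial i E (t *\<^sub>R y))"
proof -
  have "partial i (\<lambda>y. integral {1..T} (\<lambda>t. w t * E (t *\<^sub>R y))) y =
    (\<Sum>j\<in>UNIV. axis i 1 $ j * integral {1..T} (\<lambda>t. (w t * t) * partial j E (t *\<^sub>R y)))"
    using partial_eq[OF ray_integral_has_derivative[OF assms(1)]] assms(2) smoothD by blast
  also have "\<dots> = (\<Sum>j\<in>UNIV. if j = i then integral {1..T} (\<lambda>t. (w t * t) * partial j E (t *\<^sub>R y)) else 0)"
    by (rule sum.cong) (auto simp: axis_def)
  finally show ?thesis by simp
qed

text \<open>Ray integrals form a class closed under \<open>partial\<close>: a derivative of E costs
  one factor t in the weight. The induction on k therefore ranges over all continuous weights and
  all smooth functions.\<close>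

lemma smooth_ray_integral:
  fixes w :: "real \<Rightarrow> real"
  assumes "continuous_on UNIV w" "smooth E"
  shows "smooth (\<lambda>y. integral {1..T} (\<lambda>t. w t * E (t *\<^sub>R y)))"
proof -
  have "Ck k (\<lambda>y. integral {1..T} (\<lambda>t. w t * E (t *\<^sub>R y)))"
    if "continuous_on UNIV w" "smooth E" for k and w :: "real \<Rightarrow> real" and E using that
  proof (induction k arbitrary: w E)
    case (Suc k)
    have d: "(\<lambda>y. integral {1..T} (\<lambda>t. w t * E (t *\<^sub>R y))) differentiable (at y)" for y
      using ray_integral_has_derivative[OF Suc.prems(1) smoothD(1,3), OF Suc.prems(2) smoothD(2)]
        Suc.prems unfolding differentiable_def by blast
    have "Ck k (\<lambda>y. integral {1..T} (\<lambda>t. (w t * t) * partial i E (t *\<^sub>R y)))" for i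
      using Suc.prems by (intro Suc.IH continuous_intros smoothD(2)) auto
    moreover have "partial i (\<lambda>y. integral {1..T} (\<lambda>t. w t * E (t *\<^sub>R y)))
      = (\<lambda>y. integral {1..T} (\<lambda>t. (w t * t) * partial i E (t *\<^sub>R y)))" for i
      by (intro ext partial_ray_integral Suc.prems)
    ultimately show ?case using d by simp
  next
    case 0
    have "(\<lambda>y. integral {1..T} (\<lambda>t. w t * E (t *\<^sub>R y))) differentiable (at y)" for y
      using ray_integral_has_derivative[OF 0(1) smoothD(1,3), OF 0(2) smoothD(2)]
        0 unfolding differentiable_def by blast
    then show ?case using differentiable_imp_continuous_on differentiable_on_def Ck.simps(1) by blast
  qed
  then show ?thesis using assms by (simp add: smooth_def)
qed

section \<open>Bump functions and integration by parts\<close>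

text \<open>The function exp (- 1 / t), extended by 0, with a power of t in the denominator because
  differentiation produces such powers; the whole family is closed under it.\<close>

definition flat :: "nat \<Rightarrow> real \<Rightarrow> real" where
  "flat k t = (if t > 0 then exp (- 1 / t) / t ^ k else 0)"

lemma flat_pos [simp]: "t > 0 \<Longrightarrow> flat k t > 0"
  and flat_nonneg [simp]: "flat k t \<ge> 0"
  and flat_zero [simp]: "t \<le> 0 \<Longrightarrow> flat k t = 0"
  by (auto simp: flat_def)

text \<open>The substitution s = 1 / t turns the limit from the right into that of s^k / exp s at
  infinity.\<close>

lemma flat_tendsto_0: "(flat k \<longlongrightarrow> 0) (at 0)"
proof (rule filterlim_split_at)
  show "(flat k \<longlongrightarrow> 0) (at_left 0)"
    by (rule Lim_transform_eventually[OF tendsto_const])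
       (auto simp: eventually_at_left_field intro!: exI[of _ "-1"])
  have "((\<lambda>t::real. inverse t ^ k / exp (inverse t)) \<longlongrightarrow> 0) (at_right 0)"
    by (rule filterlim_compose[OF tendsto_power_div_exp_0 filterlim_inverse_at_top_right])
  then show "(flat k \<longlongrightarrow> 0) (at_right 0)"
  proof (rule Lim_transform_eventually)
    show "\<forall>\<^sub>F t in at_right 0. inverse t ^ k / exp (inverse t) = flat k t"
      by (auto simp: eventually_at_right_field flat_def exp_minus field_simps intro!: exI[of _ 1])
  qed
qed

lemma flat_has_derivative:
  "(flat k has_real_derivative (- real k * flat (k + 1) t + flat (k + 2) t)) (at t)"
proof -
  consider "t > 0" | "t < 0" | "t = 0" by linarith
  then show ?thesis
  proof cases
    case 1
    have "((\<lambda>t. exp (- 1 / t) * inverse (t ^ k)) has_real_derivative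
      (exp (- 1 / t) * (1 / t\<^sup>2) * inverse (t ^ k) + exp (- 1 / t) * (- (real k * t ^ (k - 1)) * inverse ((t ^ k)\<^sup>2)))) (at t)"
      using 1 by (auto intro!: derivative_eq_intros simp: power2_eq_square field_simps)
    also have "exp (- 1 / t) * (1 / t\<^sup>2) * inverse (t ^ k) + exp (- 1 / t) * (- (real k * t ^ (k - 1)) * inverse ((t ^ k)\<^sup>2))
       = - real k * flat (k + 1) t + flat (k + 2) t"
      using 1 by (cases k) (auto simp: flat_def field_simps power2_eq_square)
    finally show ?thesis
      by (rule DERIV_cong_ev[THEN iffD1, rotated -1])
         (use 1 in \<open>auto simp: flat_def divide_inverse eventually_nhds intro!: exI[of _ "{0<..}"]\<close>)
  next
    case 2
    have "((\<lambda>t. 0) has_real_derivative 0) (at t)" by simp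
    then show ?thesis
      by (rule DERIV_cong_ev[THEN iffD1, rotated -1])
         (use 2 in \<open>auto simp: flat_def eventually_nhds intro!: exI[of _ "{..<0}"]\<close>)
  next
    \<comment> \<open>The difference quotient at 0 is again a member of the family, so the
      derivative there is the limit of \<open>flat (Suc k)\<close>.\<close>
    case 3
    have "(\<lambda>h. (flat k (0 + h) - flat k 0) / h) = flat (Suc k)"
      by (auto simp: flat_def fun_eq_iff field_simps)
    then show ?thesis using flat_tendsto_0[of "Suc k"] 3 unfolding DERIV_def by simp
  qed
qed

lemma smooth_flat:
  assumes u: "smooth u"
  shows "smooth (\<lambda>x. flat k (u x))"
proof -
  have d: "(\<lambda>x. flat k (u x)) differentiable (at x)" for x k
    using differentiable_chain_real(1)[OF flat_has_derivative smoothD(1)[OF u]] .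
  have p: "partial i (\<lambda>x. flat k (u x)) = (\<lambda>x. (- real k * flat (k + 1) (u x) + flat (k + 2) (u x)) * partial i u x)" for i k
    using differentiable_chain_real(2)[OF flat_has_derivative smoothD(1)[OF u]] by blast
  have "Ck n (\<lambda>x. flat k (u x))" for n k
  proof (induction n arbitrary: k)
    case 0
    then show ?case using d differentiable_imp_continuous_on differentiable_on_def Ck.simps(1) by blast
  next
    case (Suc n)
    have "Ck n (\<lambda>x. (- real k * flat (k + 1) (u x) + flat (k + 2) (u x)) * partial i u x)" for i
      by (intro Ck_mult Ck_add Ck_const Suc) (use smoothD(2)[OF u] in \<open>simp add: smooth_def\<close>)
    then show ?case using d p by simp
  qed
  then show ?thesis by (simp add: smooth_def)
qed

lemma smooth_inner_self: "smooth (\<lambda>x::real^2. x \<bullet> x)"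
  unfolding inner_vec_def by (auto intro!: smooth_sum smooth_mult smooth_nth)

text \<open>It is 1 on the unit disc and 0 outside the disc of radius 2; the numbers 1 and 4 are the
  squared radii. The conditions |x|^2 < 4 and |x|^2 > 1 together cover the plane, which keeps the
  denominator positive.\<close>

definition cutoff :: "real^2 \<Rightarrow> real" where
  "cutoff x = flat 0 (4 - x \<bullet> x) / (flat 0 (4 - x \<bullet> x) + flat 0 (x \<bullet> x - 1))"

lemma cutoff_denominator: "flat 0 (4 - x \<bullet> x) + flat 0 (x \<bullet> x - 1) > 0" for x :: "real^2"
proof (cases "x \<bullet> x < 4")
  case True then show ?thesis by (intro add_pos_nonneg) auto
next
  case False then show ?thesis by (intro add_nonneg_pos) auto
qed

lemma smooth_cutoff: "smooth cutoff"
proof -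
  have "flat 0 (4 - x \<bullet> x) + flat 0 (x \<bullet> x - 1) \<noteq> 0" for x :: "real^2"
    using cutoff_denominator[of x] by simp
  then have "smooth (\<lambda>x. flat 0 (4 - x \<bullet> x) / (flat 0 (4 - x \<bullet> x) + flat 0 (x \<bullet> x - 1)))"
    by (intro smooth_divide smooth_add smooth_flat smooth_diff smooth_const smooth_inner_self) auto
  then show ?thesis by (simp add: cutoff_def[abs_def])
qed

lemma cutoff_eq_1: "norm x \<le> 1 \<Longrightarrow> cutoff x = 1"
proof -
  assume "norm x \<le> 1"
  then have "x \<bullet> x \<le> 1" by (simp add: dot_square_norm power_le_one)
  then have "flat 0 (x \<bullet> x - 1) = 0" "flat 0 (4 - x \<bullet> x) > 0" by auto
  then show ?thesis by (simp add: cutoff_def)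
qed

lemma cutoff_eq_0: "norm x \<ge> 2 \<Longrightarrow> cutoff x = 0"
proof -
  assume "norm x \<ge> 2"
  then have "x \<bullet> x \<ge> 4" using power_mono[of 2 "norm x" 2] by (simp add: dot_square_norm)
  then show ?thesis by (simp add: cutoff_def)
qed

lemma cutoff_bounds: "0 \<le> cutoff x" "cutoff x \<le> 1"
  using cutoff_denominator[of x] by (auto simp: cutoff_def field_simps)

section \<open>Test functions\<close>

lemma test_functionsI:
  assumes "smooth \<phi>" "\<And>x. norm x > R \<Longrightarrow> \<phi> x = 0"
  shows "\<phi> \<in> test_functions"
proof -
  have "support_on UNIV \<phi> \<subseteq> cball 0 R"
    using assms(2) by (auto simp: support_on_def not_less[symmetric])
  then have "bounded (support_on UNIV \<phi>)" using bounded_cball bounded_subset by blast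
  then show ?thesis using assms(1) by (simp add: test_functions_def smooth_def)
qed

lemma test_functionsD:
  assumes "\<phi> \<in> test_functions"
  shows "smooth \<phi>" "\<exists>R>0. \<forall>x. norm x > R \<longrightarrow> \<phi> x = 0"
proof -
  show "smooth \<phi>" using assms by (simp add: test_functions_def smooth_def)
  have "bounded (support_on UNIV \<phi>)"
    using assms compact_imp_bounded bounded_subset closure_subset by (fastforce simp: test_functions_def)
  then obtain R where R: "R > 0" "\<And>x. x \<in> support_on UNIV \<phi> \<Longrightarrow> norm x \<le> R"
    by (auto simp: bounded_pos)
  then show "\<exists>R>0. \<forall>x. norm x > R \<longrightarrow> \<phi> x = 0"
    by (force simp: support_on_def)
qed

lemma partial_vanishes:
  assumes "\<And>x. norm x > R \<Longrightarrow> \<phi> x = 0" "norm x > R"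
  shows "partial i \<phi> x = 0"
proof -
  have "partial i \<phi> x = partial i (\<lambda>x. 0) x"
    by (rule partial_open_cong[of "{x. norm x > R}"]) (use assms in \<open>auto intro!: open_Collect_less continuous_intros\<close>)
  then show ?thesis by (simp add: partial_const)
qed

lemma test_partial: "\<phi> \<in> test_functions \<Longrightarrow> partial i \<phi> \<in> test_functions"
proof -
  assume p: "\<phi> \<in> test_functions"
  then obtain R where R: "\<And>x. norm x > R \<Longrightarrow> \<phi> x = 0" using test_functionsD(2)[OF p] by blast
  show ?thesis
    by (rule test_functionsI[of _ R]) (use R partial_vanishes smoothD(2)[OF test_functionsD(1)[OF p]] in blast)+
qed

lemma test_mult: "smooth u \<Longrightarrow> \<phi> \<in> test_functions \<Longrightarrow> (\<lambda>x. u x * \<phi> x) \<in> test_functions"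
proof -
  assume u: "smooth u" and "\<phi> \<in> test_functions"
  then obtain R where "smooth \<phi>" "\<forall>x. norm x > R \<longrightarrow> \<phi> x = 0" using test_functionsD by blast
  then show ?thesis using u by (intro test_functionsI[of _ R] smooth_mult) auto
qed

lemma test_mult': "\<phi> \<in> test_functions \<Longrightarrow> smooth u \<Longrightarrow> (\<lambda>x. \<phi> x * u x) \<in> test_functions"
  using test_mult[of u \<phi>] by (simp add: mult.commute)

lemma compact_support_bounded:
  fixes f :: "real^2 \<Rightarrow> real"
  assumes "continuous_on UNIV f" "\<And>x. norm x > R \<Longrightarrow> f x = 0"
  obtains M where "M \<ge> 0" "\<And>x. \<bar>f x\<bar> \<le> M"
proof -
  have "compact (f ` cball 0 R)"
    using assms(1) by (intro compact_continuous_image compact_cball) (auto intro: continuous_on_subset)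
  then have "\<exists>M>0. \<forall>y\<in>f ` cball 0 R. norm y \<le> M"
    by (simp only: compact_imp_bounded bounded_pos[symmetric])
  then obtain M where M: "M > 0" "\<And>y. y \<in> f ` cball 0 R \<Longrightarrow> norm y \<le> M" by blast
  have "\<bar>f x\<bar> \<le> M" for x
  proof (cases "norm x > R")
    case False
    then have "f x \<in> f ` cball 0 R" by auto
    from M(2)[OF this] show ?thesis by simp
  qed (use assms(2) M(1) in auto)
  with M(1) that show ?thesis by (meson less_imp_le)
qed

lemma test_bounded:
  assumes "\<phi> \<in> test_functions"
  obtains M where "M \<ge> 0" "\<And>x. \<bar>\<phi> x\<bar> \<le> M"
proof -
  obtain R where R: "\<And>x. norm x > R \<Longrightarrow> \<phi> x = 0" using test_functionsD(2)[OF assms] by blast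
  show ?thesis
    using compact_support_bounded[OF smoothD(3)[OF test_functionsD(1)[OF assms]], of R] R that by metis
qed

lemma compact_support_integrable:
  fixes f :: "real^2 \<Rightarrow> real"
  assumes "continuous_on UNIV f" "\<And>x. norm x > R \<Longrightarrow> f x = 0"
  shows "integrable lborel f"
proof -
  have "integrable lborel (\<lambda>x. indicator (cball 0 R) x *\<^sub>R f x)"
    using assms(1) by (intro borel_integrable_compact compact_cball) (auto intro: continuous_on_subset)
  moreover have "(\<lambda>x. indicator (cball 0 R) x *\<^sub>R f x) = f"
    using assms(2) by (force simp: fun_eq_iff indicator_def)
  ultimately show ?thesis by simp
qed

lemma cont_test_integrable:
  assumes "continuous_on UNIV g" "\<phi> \<in> test_functions"
  shows "integrable lborel (\<lambda>x. g x * \<phi> x)"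
proof -
  obtain R where "\<forall>x. norm x > R \<longrightarrow> \<phi> x = 0" using test_functionsD(2)[OF assms(2)] by blast
  then show ?thesis
    using assms smoothD(3)[OF test_functionsD(1)] by (intro compact_support_integrable[of _ R] continuous_intros) auto
qed

text \<open>The definitions integrate against the completed measure \<open>lebesgue\<close>, while
  translation and scaling are carried out in \<open>lborel\<close>. Borel functions have the same
  integrals for both.\<close>

lemma lebesgue_eq_lborel:
  fixes f :: "real^2 \<Rightarrow> real"
  assumes "f \<in> borel_measurable borel"
  shows "(LINT x|lebesgue. f x) = (LINT x|lborel. f x)" "integrable lebesgue f = integrable lborel f"
  using assms by (auto intro!: integral_completion simp: integrable_completion)

lemma lborel_translation:
  fixes f :: "real^2 \<Rightarrow> real"
  assumes "f \<in> borel_measurable borel"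
  shows "(LINT x|lborel. f (c + x)) = (LINT x|lborel. f x)"
    "integrable lborel (\<lambda>x. f (c + x)) = integrable lborel f"
proof -
  have "(LINT x|distr lborel borel ((+) c). f x) = (LINT x|lborel. f (c + x))"
    using assms by (intro integral_distr) auto
  then show "(LINT x|lborel. f (c + x)) = (LINT x|lborel. f x)" by (simp add: lborel_distr_plus)
  have "integrable (distr lborel borel ((+) c)) f = integrable lborel (\<lambda>x. f (c + x))"
    using assms by (intro integrable_distr_eq) auto
  then show "integrable lborel (\<lambda>x. f (c + x)) = integrable lborel f" by (simp add: lborel_distr_plus)
qed

lemma line_deriv:
  assumes "smooth u"
  shows "((\<lambda>t. u (x + t *\<^sub>R axis i 1)) has_real_derivative partial i u (x + t *\<^sub>R axis i 1)) (at t)"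
proof -
  have "((\<lambda>t. x + t *\<^sub>R axis i 1) has_derivative (\<lambda>h. h *\<^sub>R axis i 1)) (at t)"
    by (auto intro!: derivative_eq_intros)
  from has_derivative_compose[OF this smooth_has_derivative[OF assms]]
  have "((\<lambda>t. u (x + t *\<^sub>R axis i 1)) has_derivative
     (\<lambda>h. \<Sum>j\<in>UNIV. (h *\<^sub>R axis i 1) $ j * partial j u (x + t *\<^sub>R axis i 1))) (at t)" .
  moreover have "(\<Sum>j\<in>UNIV. (h *\<^sub>R axis i 1) $ j * partial j u y) = partial i u y * h" for h and y
  proof -
    have "(\<Sum>j\<in>UNIV. (h *\<^sub>R axis i 1) $ j * partial j u y) = (\<Sum>j\<in>UNIV. if j = i then partial i u y * h else 0)"
      by (rule sum.cong) (auto simp: axis_def)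
    then show ?thesis by simp
  qed
  ultimately show ?thesis by (simp add: has_field_derivative_def)
qed

text \<open>By translation invariance every difference quotient has integral 0, and dominated
  convergence passes to the derivative. This avoids iterated integrals.\<close>

lemma integral_partial_eq_0:
  assumes u: "u \<in> test_functions"
  shows "(LINT x|lborel. partial i u x) = 0"
proof -
  have su: "smooth u" using u test_functionsD by blast
  obtain R where R: "R > 0" "\<And>x. norm x > R \<Longrightarrow> u x = 0" using test_functionsD(2)[OF u] by blast
  obtain M where M: "M \<ge> 0" "\<And>x. \<bar>partial i u x\<bar> \<le> M" using test_bounded[OF test_partial[OF u]] by blast
  define h where "h n = inverse (real (Suc n))" for n
  have h: "0 < h n" "h n \<le> 1" for n by (auto simp: h_def field_simps)
  have h0: "h \<longlonglongrightarrow> 0" unfolding h_def by (rule LIMSEQ_inverse_real_of_nat)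
  define f where "f n x = (u (h n *\<^sub>R axis i 1 + x) - u x) / h n" for n x
  have meas: "u \<in> borel_measurable borel" using smooth_borel su by blast
  have "(LINT x|lborel. f n x) = 0" for n
  proof -
    have iu: "integrable lborel u" using compact_support_integrable R(2) smoothD(3)[OF su] by blast
    then have "integrable lborel (\<lambda>x. u (h n *\<^sub>R axis i 1 + x))" using lborel_translation(2)[OF meas] by blast
    with iu have "(LINT x|lborel. u (h n *\<^sub>R axis i 1 + x) - u x) = 0"
      using lborel_translation(1)[OF meas] by simp
    then show ?thesis unfolding f_def by simp
  qed
  \<comment> \<open>The majorant is M on the disc of radius R + 1: the shifts \<open>h n\<close> are
    at most 1, and the mean value theorem bounds the quotients by M.\<close>
  moreover have "(\<lambda>n. LINT x|lborel. f n x) \<longlonglongrightarrow> (LINT x|lborel. partial i u x)"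
  proof (rule integral_dominated_convergence[where w="\<lambda>x. M * indicator (cball 0 (R + 1)) x"])
    show "partial i u \<in> borel_measurable lborel" using smooth_borel smoothD(2) su by simp
    show "f n \<in> borel_measurable lborel" for n unfolding f_def using meas by measurable
    show "integrable lborel (\<lambda>x::real^2. M * indicator (cball 0 (R + 1)) x)"
      using emeasure_bounded_finite[OF bounded_cball] by (intro integrable_mult_right integrable_real_indicator) auto
    show "AE x in lborel. (\<lambda>n. f n x) \<longlonglongrightarrow> partial i u x"
    proof (rule AE_I2)
      fix x
      have "((\<lambda>t. (u (x + (0 + t) *\<^sub>R axis i 1) - u (x + 0 *\<^sub>R axis i 1)) / t) \<longlongrightarrow> partial i u x) (at 0)"
        using line_deriv[OF su, of x i 0] unfolding DERIV_def by simp
      moreover have "filterlim h (at 0) sequentially"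
        using h0 h(1) by (auto simp: filterlim_at less_imp_neq[THEN not_sym])
      ultimately have "(\<lambda>n. (u (x + (0 + h n) *\<^sub>R axis i 1) - u (x + 0 *\<^sub>R axis i 1)) / h n) \<longlonglongrightarrow> partial i u x"
        by (rule filterlim_compose)
      then show "(\<lambda>n. f n x) \<longlonglongrightarrow> partial i u x" by (simp add: f_def add.commute)
    qed
    show "AE x in lborel. norm (f n x) \<le> M * indicator (cball 0 (R + 1)) x" for n
    proof (rule AE_I2)
      fix x
      show "norm (f n x) \<le> M * indicator (cball 0 (R + 1)) x"
      proof (cases "norm x \<le> R + 1")
        case True
        obtain z where "u (x + h n *\<^sub>R axis i 1) - u (x + 0 *\<^sub>R axis i 1) = (h n - 0) * partial i u (x + z *\<^sub>R axis i 1)"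
          using MVT2[of 0 "h n" "\<lambda>t. u (x + t *\<^sub>R axis i 1)" "\<lambda>t. partial i u (x + t *\<^sub>R axis i 1)"] h(1) line_deriv[OF su] by blast
        then have "f n x = partial i u (x + z *\<^sub>R axis i 1)" using h(1)[of n] by (simp add: f_def add.commute)
        with M(2) True show ?thesis by simp
      next
        case False
        have "norm (h n *\<^sub>R axis i (1::real) :: real^2) \<le> 1" using h[of n] by simp
        then have "norm (h n *\<^sub>R axis i 1 + x) > R" using False norm_diff_ineq[of x "h n *\<^sub>R axis i 1"] by (simp add: add.commute)
        with False R show ?thesis by (simp add: f_def)
      qed
    qed
  qed
  ultimately have "(\<lambda>n::nat. 0) \<longlonglongrightarrow> (LINT x|lborel. partial i u x)" by simp
  from LIMSEQ_unique[OF this tendsto_const] show ?thesis .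
qed

lemma integration_by_parts:
  assumes u: "smooth u" and p: "\<phi> \<in> test_functions"
  shows "(LINT x|lborel. u x * partial i \<phi> x) = - (LINT x|lborel. partial i u x * \<phi> x)"
proof -
  have "partial i (\<lambda>x. u x * \<phi> x) = (\<lambda>x. u x * partial i \<phi> x + partial i u x * \<phi> x)"
    using u test_functionsD(1)[OF p] by (intro ext partial_mult smoothD)
  then have "(LINT x|lborel. u x * partial i \<phi> x + partial i u x * \<phi> x) = 0"
    using integral_partial_eq_0[OF test_mult[OF u p], of i] by simp
  moreover have "integrable lborel (\<lambda>x. u x * partial i \<phi> x)" "integrable lborel (\<lambda>x. partial i u x * \<phi> x)"
    using u p by (auto intro!: cont_test_integrable test_partial smoothD(3) intro: smoothD(2))
  ultimately show ?thesis by simp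
qed

text \<open>The outermost derivative of \<phi> moves first, so the indices come out in reverse
  order. The symmetry of second derivatives is not invoked.\<close>

lemma integration_by_parts_2:
  assumes u: "smooth u" and p: "\<phi> \<in> test_functions"
  shows "(LINT x|lborel. u x * partial i (partial j \<phi>) x) = (LINT x|lborel. partial j (partial i u) x * \<phi> x)"
  using integration_by_parts[OF u test_partial[OF p], of i j]
    integration_by_parts[OF smoothD(2)[OF u, of i] p, of j] by simp

section \<open>Square integrability and the fundamental lemma\<close>

lemma L2_D: "f \<in> L2 \<Longrightarrow> f \<in> borel_measurable lebesgue" "f \<in> L2 \<Longrightarrow> integrable lebesgue (\<lambda>x. (f x)\<^sup>2)"
  by (auto simp: L2_def)

lemma abs_mult_le_squares: "\<bar>a * b\<bar> \<le> a\<^sup>2 + b\<^sup>2" for a b :: real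
proof -
  have "2 * (\<bar>a\<bar> * \<bar>b\<bar>) \<le> \<bar>a\<bar>\<^sup>2 + \<bar>b\<bar>\<^sup>2" using sum_squares_bound[of "\<bar>a\<bar>" "\<bar>b\<bar>"] by (simp add: mult_ac)
  moreover have "0 \<le> \<bar>a\<bar> * \<bar>b\<bar>" by simp
  ultimately show ?thesis unfolding abs_mult power2_abs by linarith
qed

lemma L2_mult_integrable:
  assumes "f \<in> L2" "g \<in> L2"
  shows "integrable lebesgue (\<lambda>x. f x * g x)"
proof (rule Bochner_Integration.integrable_bound)
  show "integrable lebesgue (\<lambda>x. (f x)\<^sup>2 + (g x)\<^sup>2)" 
    by (intro Bochner_Integration.integrable_add L2_D(2) assms)
  show "(\<lambda>x. f x * g x) \<in> borel_measurable lebesgue"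
    using assms[THEN L2_D(1)] by (rule borel_measurable_times)
  show "AE x in lebesgue. norm (f x * g x) \<le> norm ((f x)\<^sup>2 + (g x)\<^sup>2)"
    by (rule AE_I2) (use abs_mult_le_squares in auto)
qed

lemma L2_add:
  assumes "f \<in> L2" "g \<in> L2"
  shows "(\<lambda>x. f x + g x) \<in> L2"
proof -
  have "integrable lebesgue (\<lambda>x. (f x)\<^sup>2 + (g x)\<^sup>2 + 2 * (f x * g x))"
    by (intro Bochner_Integration.integrable_add Bochner_Integration.integrable_mult_right L2_D(2) L2_mult_integrable assms)
  then show ?thesis
    using assms[THEN L2_D(1)] by (auto simp: L2_def power2_sum mult.assoc intro!: borel_measurable_add)
qed

lemma L2_cmult: "f \<in> L2 \<Longrightarrow> (\<lambda>x. c * f x) \<in> L2"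
  by (auto simp: L2_def power_mult_distrib intro!: borel_measurable_times)

lemma L2_zero: "(\<lambda>x. 0) \<in> L2"
  by (simp add: L2_def)

lemma L2_sum: "(\<And>r. r \<in> A \<Longrightarrow> f r \<in> L2) \<Longrightarrow> (\<lambda>x. \<Sum>r\<in>A. f r x) \<in> L2"
  by (induction A rule: infinite_finite_induct) (auto simp: L2_zero L2_add)

lemma L2_diff:
  assumes "f \<in> L2" "g \<in> L2"
  shows "(\<lambda>x. f x - g x) \<in> L2"
  using L2_add[OF assms(1) L2_cmult[OF assms(2), of "-1"]] by simp

lemma L2_borelI:
  fixes f :: "real^2 \<Rightarrow> real"
  assumes "f \<in> borel_measurable borel" "integrable lborel (\<lambda>x. (f x)\<^sup>2)"
  shows "f \<in> L2"
proof -
  have "(\<lambda>x. (f x)\<^sup>2) \<in> borel_measurable borel" using assms(1) by measurable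
  with assms show ?thesis
    by (auto simp: L2_def lebesgue_eq_lborel intro: measurable_completion)
qed

lemma L2_bound:
  assumes "g \<in> L2" "f \<in> borel_measurable lebesgue" "AE x in lebesgue. \<bar>f x\<bar> \<le> \<bar>g x\<bar>"
  shows "f \<in> L2"
proof -
  have "integrable lebesgue (\<lambda>x. (f x)\<^sup>2)"
  proof (rule Bochner_Integration.integrable_bound[OF L2_D(2)[OF assms(1)]])
    show "(\<lambda>x. (f x)\<^sup>2) \<in> borel_measurable lebesgue" using assms(2) by measurable
    show "AE x in lebesgue. norm ((f x)\<^sup>2) \<le> norm ((g x)\<^sup>2)"
      using assms(3) by eventually_elim (simp add: abs_le_square_iff)
  qed
  with assms(2) show ?thesis by (simp add: L2_def)
qed

lemma test_L2:
  assumes "\<phi> \<in> test_functions"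
  shows "\<phi> \<in> L2"
  using assms smooth_borel test_functionsD(1) cont_test_integrable[OF smoothD(3), of \<phi> \<phi>]
  by (intro L2_borelI) (auto simp: power2_eq_square)

text \<open>This takes the place of polar coordinates: f is dominated by the sum over n of
  \<open>c n\<close> on \<open>A n\<close>, whose integral is at most a convergent series. Discs
  with dyadic radii are the intended sets.\<close>

lemma integrable_by_cover:
  fixes f :: "real^2 \<Rightarrow> real"
  assumes meas: "f \<in> borel_measurable borel" and nonneg: "\<And>x. f x \<ge> 0"
    and A: "\<And>n::nat. A n \<in> sets borel" "\<And>n. emeasure lborel (A n) \<le> ennreal (m n)"
    and c: "\<And>n. c n \<ge> 0" "\<And>n. m n \<ge> 0"
    and cover: "\<And>x. f x \<noteq> 0 \<Longrightarrow> \<exists>n. x \<in> A n \<and> f x \<le> c n"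
    and sm: "summable (\<lambda>n. c n * m n)"
  shows "integrable lborel f"
proof -
  have "ennreal (f x) \<le> (\<Sum>n. ennreal (c n) * indicator (A n) x)" for x
  proof (cases "f x = 0")
    case False
    then obtain n where n: "x \<in> A n" "f x \<le> c n" using cover by blast
    define g where "g k = ennreal (c k) * indicator (A k) x" for k
    have "ennreal (f x) \<le> g n" using n by (simp add: g_def ennreal_leI)
    also have "\<dots> \<le> (\<Sum>k. g k)"
      using sum_le_suminf[OF summableI, of "{n}" g] by simp
    finally show ?thesis by (simp add: g_def)
  qed simp
  then have "(\<integral>\<^sup>+x. ennreal (f x) \<partial>lborel) \<le> (\<integral>\<^sup>+x. (\<Sum>n. ennreal (c n) * indicator (A n) x) \<partial>lborel)"
    by (intro nn_integral_mono) auto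
  also have "\<dots> = (\<Sum>n. \<integral>\<^sup>+x. ennreal (c n) * indicator (A n) x \<partial>lborel)"
    using A(1) by (intro nn_integral_suminf) auto
  also have "\<dots> = (\<Sum>n. ennreal (c n) * emeasure lborel (A n))"
    using A(1) by (simp add: nn_integral_cmult_indicator)
  also have "\<dots> \<le> (\<Sum>n. ennreal (c n * m n))"
    using A(2) c by (intro suminf_le) (auto simp: ennreal_mult intro: mult_left_mono)
  also have "\<dots> < \<infinity>"
    by (subst suminf_ennreal2[OF _ sm]) (use c in auto)
  finally show ?thesis using meas nonneg by (intro integrableI_bounded) (auto simp: abs_of_nonneg)
qed

lemma ex_dyadic:
  fixes r :: real
  assumes "r \<ge> 1"
  shows "\<exists>n. 2 ^ n \<le> r \<and> r < 2 ^ Suc n"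
proof -
  obtain N where "r < 2 ^ N" using real_arch_pow[of 2 r] by auto
  then have "r < 2 ^ Suc N" using assms by simp
  then have ex: "\<exists>n. r < 2 ^ Suc n" by blast
  define n where "n = (LEAST n. r < 2 ^ Suc n)"
  have "r < 2 ^ Suc n" unfolding n_def using ex by (rule LeastI_ex)
  moreover have "2 ^ n \<le> r"
  proof (cases n)
    case (Suc k)
    then have "\<not> r < 2 ^ Suc k" using not_less_Least[of k "\<lambda>n. r < 2 ^ Suc n"] n_def by auto
    with Suc show ?thesis by simp
  qed (use assms in simp)
  ultimately show ?thesis by blast
qed

lemma emeasure_cball_plane: "r \<ge> 0 \<Longrightarrow> emeasure lborel (cball (c::real^2) r) = ennreal (unit_ball_vol 2 * r\<^sup>2)"
  using emeasure_cball[of r c] by simp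

text \<open>The model of a tail that is integrable in the plane.\<close>

definition tail3 :: "real^2 \<Rightarrow> real" where
  "tail3 y = (if norm y \<ge> 1 then 1 / norm y ^ 3 else 0)"

text \<open>The model of an integrable singularity in the plane, with value 0 at the origin because
  \<open>1 / 0 = 0\<close>.\<close>

definition head1 :: "real^2 \<Rightarrow> real" where
  "head1 y = (if norm y < 1 then 1 / norm y else 0)"

lemma tail3_borel [measurable]: "tail3 \<in> borel_measurable borel"
  unfolding tail3_def[abs_def] by measurable

lemma head1_borel [measurable]: "head1 \<in> borel_measurable borel"
  unfolding head1_def[abs_def] by measurable

lemma integrable_tail3: "integrable lborel tail3"
proof (rule integrable_by_cover)
  show "tail3 \<in> borel_measurable borel" by measurable
  show "tail3 x \<ge> 0" for x by (simp add: tail3_def)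
  show "cball (0::real^2) (2 ^ Suc n) \<in> sets borel" for n by simp
  show "emeasure lborel (cball (0::real^2) (2 ^ Suc n)) \<le> ennreal (unit_ball_vol 2 * (2 ^ Suc n)\<^sup>2)" for n
    by (subst emeasure_cball_plane) auto
  show "0 \<le> 1 / ((2::real) ^ n) ^ 3" for n :: nat by simp
  show "0 \<le> unit_ball_vol 2 * (2 ^ Suc n)\<^sup>2" for n by simp
  show "\<exists>n. x \<in> cball 0 (2 ^ Suc n) \<and> tail3 x \<le> 1 / (2 ^ n) ^ 3" if "tail3 x \<noteq> 0" for x
  proof -
    have "norm x \<ge> 1" using that by (simp add: tail3_def split: if_splits)
    then obtain n where n: "2 ^ n \<le> norm x" "norm x < 2 ^ Suc n" using ex_dyadic by blast
    have "1 / norm x ^ 3 \<le> 1 / (2 ^ n) ^ 3"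
      using n \<open>norm x \<ge> 1\<close> by (intro divide_left_mono power_mono mult_pos_pos zero_less_power) auto
    then show ?thesis using n by (intro exI[of _ n]) (auto simp: tail3_def)
  qed
  \<comment> \<open>The bound 8^-n meets an area proportional to 4^n, which leaves a geometric
    series of ratio 1/2.\<close>
  have "1 / (2 ^ n) ^ 3 * (unit_ball_vol 2 * (2 ^ Suc n)\<^sup>2) = 4 * unit_ball_vol 2 * (1 / 2) ^ n" for n
    by (simp add: power2_eq_square power3_eq_cube power_one_over field_simps)
  then show "summable (\<lambda>n. 1 / (2 ^ n) ^ 3 * (unit_ball_vol 2 * (2 ^ Suc n)\<^sup>2))"
    by (simp only:) (intro summable_mult summable_geometric, simp)
qed

lemma integrable_head1: "integrable lborel head1"
proof (rule integrable_by_cover)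
  show "head1 \<in> borel_measurable borel" by measurable
  show "head1 x \<ge> 0" for x by (simp add: head1_def)
  show "cball (0::real^2) (1 / 2 ^ n) \<in> sets borel" for n by simp
  show "emeasure lborel (cball (0::real^2) (1 / 2 ^ n)) \<le> ennreal (unit_ball_vol 2 * (1 / 2 ^ n)\<^sup>2)" for n
    by (subst emeasure_cball_plane) auto
  show "0 \<le> (2::real) ^ Suc n" for n :: nat by simp
  show "0 \<le> unit_ball_vol 2 * (1 / 2 ^ n)\<^sup>2" for n by simp
  show "\<exists>n. x \<in> cball 0 (1 / 2 ^ n) \<and> head1 x \<le> 2 ^ Suc n" if "head1 x \<noteq> 0" for x
  proof -
    have x: "norm x < 1" "norm x > 0" using that by (auto simp: head1_def split: if_splits)
    then have "1 / norm x \<ge> 1" by simp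
    then obtain n where n: "2 ^ n \<le> 1 / norm x" "1 / norm x < 2 ^ Suc n" using ex_dyadic by blast
    have "norm x \<le> 1 / 2 ^ n" using n(1) x by (simp add: field_simps)
    then show ?thesis using n(2) x by (intro exI[of _ n]) (auto simp: head1_def)
  qed
  have "2 ^ Suc n * (unit_ball_vol 2 * (1 / 2 ^ n)\<^sup>2) = 2 * unit_ball_vol 2 * (1 / 2) ^ n" for n
    by (simp add: power2_eq_square power_one_over field_simps)
  then show "summable (\<lambda>n. 2 ^ Suc n * (unit_ball_vol 2 * (1 / 2 ^ n)\<^sup>2))"
    by (simp only:) (intro summable_mult summable_geometric, simp)
qed

text \<open>The square decays like |x|^-4 and stays below \<open>tail3\<close>. This is the decay
  rate of the Hessian of a spline.\<close>

lemma L2_tail: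
  assumes "\<rho> \<ge> 1"
  shows "(\<lambda>x::real^2. if norm x \<ge> \<rho> then 1 / (norm x)\<^sup>2 else 0) \<in> L2"
proof (rule L2_borelI)
  show "(\<lambda>x::real^2. if norm x \<ge> \<rho> then 1 / (norm x)\<^sup>2 else 0) \<in> borel_measurable borel" by measurable
  show "integrable lborel (\<lambda>x::real^2. (if norm x \<ge> \<rho> then 1 / (norm x)\<^sup>2 else 0)\<^sup>2)"
  proof (rule Bochner_Integration.integrable_bound[OF integrable_tail3])
    show "(\<lambda>x::real^2. (if norm x \<ge> \<rho> then 1 / (norm x)\<^sup>2 else 0)\<^sup>2) \<in> borel_measurable lborel" by measurable
    have "1 / ((norm x)\<^sup>2)\<^sup>2 \<le> 1 / norm x ^ 3" if "norm x \<ge> 1" for x :: "real^2"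
      using that power_increasing[of 3 4 "norm x"] by (intro divide_left_mono) (auto simp flip: power_mult)
    then show "AE x::real^2 in lborel. norm ((if norm x \<ge> \<rho> then 1 / (norm x)\<^sup>2 else 0)\<^sup>2) \<le> norm (tail3 x)"
      using assms by (intro AE_I2) (auto simp: tail3_def power_divide)
  qed
qed

lemma L2_indicator_cball: "(\<lambda>x::real^2. indicator (cball c r) x :: real) \<in> L2"
proof (rule L2_borelI)
  have "(\<lambda>x. (indicator (cball c r) x)\<^sup>2 :: real) = indicator (cball c r)"
    by (auto simp: fun_eq_iff indicator_def)
  then show "integrable lborel (\<lambda>x::real^2. (indicator (cball c r) x)\<^sup>2 :: real)"
    using emeasure_bounded_finite[OF bounded_cball, of c r] by (auto intro!: integrable_real_indicator)
  show "(\<lambda>x::real^2. indicator (cball c r) x :: real) \<in> borel_measurable borel"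
    by (rule borel_measurable_indicator) (rule borel_closed[OF closed_cball])
qed

text \<open>From ln s \<le> s - 1 at s = 1 / sqrt t. It puts the square of a logarithmic singularity
  below a multiple of \<open>head1\<close>.\<close>

lemma ln_square_bound:
  fixes t :: real
  assumes "0 < t" "t < 1"
  shows "(ln t)\<^sup>2 \<le> 4 / t"
proof -
  have "ln (1 / sqrt t) \<le> 1 / sqrt t - 1" using assms by (intro ln_le_minus_one) auto
  then have "- ln t \<le> 2 / sqrt t" using assms by (simp add: ln_div ln_sqrt)
  moreover have "0 \<le> - ln t" using assms by simp
  ultimately have "(- ln t)\<^sup>2 \<le> (2 / sqrt t)\<^sup>2" by (intro power_mono)
  then show ?thesis using assms by (simp add: power_divide)
qed

lemma L2_log:
  assumes "\<rho> \<ge> 0"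
  shows "(\<lambda>x::real^2. indicator (cball 0 \<rho>) x * \<bar>ln (norm (x - a))\<bar>) \<in> L2"
proof (rule L2_borelI)
  let ?f = "\<lambda>x::real^2. indicator (cball 0 \<rho>) x * \<bar>ln (norm (x - a))\<bar>"
  let ?M = "ln (1 + \<rho> + norm a)"
  have "(\<lambda>x. ln (norm (x - a))) \<in> borel_measurable borel" by (intro borel_measurable_ln) measurable
  moreover have "indicator (cball (0::real^2) \<rho>) \<in> borel_measurable borel"
    by (intro borel_measurable_indicator borel_closed closed_cball)
  ultimately show m: "?f \<in> borel_measurable borel" by (intro borel_measurable_times borel_measurable_abs)
  have "integrable lborel (\<lambda>x. head1 (- a + x))"
    using integrable_head1 lborel_translation(2)[OF head1_borel, of "- a"] by simp
  then have i: "integrable lborel (\<lambda>x. 4 * head1 (- a + x) + ?M\<^sup>2 * indicator (cball 0 \<rho>) x)"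
    using emeasure_bounded_finite[OF bounded_cball, of "0::real^2" \<rho>]
    by (intro Bochner_Integration.integrable_add Bochner_Integration.integrable_mult_right) (auto intro!: integrable_real_indicator)
  show "integrable lborel (\<lambda>x. (?f x)\<^sup>2)"
  proof (rule Bochner_Integration.integrable_bound[OF i])
    show "(\<lambda>x. (?f x)\<^sup>2) \<in> borel_measurable lborel" using m by measurable
    have "(?f x)\<^sup>2 \<le> 4 * head1 (- a + x) + ?M\<^sup>2 * indicator (cball 0 \<rho>) x" for x
    proof (cases "x \<in> cball 0 \<rho> \<and> x \<noteq> a")
      case True
      then have t: "norm (x - a) > 0" "norm (x - a) \<le> 1 + \<rho> + norm a"
        using norm_triangle_ineq4[of x a] by auto
      have *: "- a + x = x - a" by simp
      show ?thesis
      proof (cases "norm (x - a) < 1")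
        case lt: True
        then show ?thesis using True ln_square_bound[OF t(1) lt] by (simp add: head1_def * add_increasing2)
      next
        case False
        then have "0 \<le> ln (norm (x - a))" "ln (norm (x - a)) \<le> ?M" using t by auto
        then have "(ln (norm (x - a)))\<^sup>2 \<le> ?M\<^sup>2" by (rule power_mono[rotated])
        then show ?thesis using True False by (simp add: head1_def *)
      qed
    next
      \<comment> \<open>At x = a the left side is 0, since \<open>ln 0 = 0\<close>.\<close>
      case False
      then show ?thesis by (auto simp: head1_def)
    qed
    then show "AE x in lborel. norm ((?f x)\<^sup>2) \<le> norm (4 * head1 (- a + x) + ?M\<^sup>2 * indicator (cball 0 \<rho>) x)"
      by (intro AE_I2) (smt (verit) real_norm_def zero_le_power2)
  qed
qed

section \<open>The fundamental lemma of the calculus of variations\<close>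

definition box_bump :: "real^2 \<Rightarrow> real^2 \<Rightarrow> real^2 \<Rightarrow> real" where
  "box_bump a b x = (flat 0 (x $ 1 - a $ 1) * flat 0 (b $ 1 - x $ 1)) * (flat 0 (x $ 2 - a $ 2) * flat 0 (b $ 2 - x $ 2))"

lemma box_bump_pos: "x \<in> box a b \<Longrightarrow> box_bump a b x > 0"
  and box_bump_zero: "x \<notin> box a b \<Longrightarrow> box_bump a b x = 0"
  by (auto simp: box_bump_def mem_box_cart forall_2 not_less)

lemma smooth_box_bump: "smooth (box_bump a b)"
  unfolding box_bump_def[abs_def]
  by (intro smooth_mult smooth_flat smooth_diff smooth_nth smooth_const)

text \<open>With p the bump of the box, p / (p + e) lies between 0 and the indicator and tends to it
  as e tends to 0.\<close>

lemma box_indicator_approx: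
  "\<exists>\<phi>. (\<forall>n. \<phi> n \<in> test_functions \<and> (\<forall>x. \<bar>\<phi> n x\<bar> \<le> indicator (box a b) x)) \<and>
     (\<forall>x. (\<lambda>n::nat. \<phi> n x) \<longlonglongrightarrow> indicator (box a b) (x::real^2))"
proof -
  define e where "e n = inverse (real (Suc n))" for n
  have e: "e n > 0" for n by (simp add: e_def)
  have e0: "e \<longlonglongrightarrow> 0" unfolding e_def by (rule LIMSEQ_inverse_real_of_nat)
  define \<phi> where "\<phi> n x = box_bump a b x / (box_bump a b x + e n)" for n x
  have nn: "box_bump a b x \<ge> 0" for x using box_bump_pos[of x a b] box_bump_zero[of x a b] by (cases "x \<in> box a b") auto
  have p: "box_bump a b x + e n > 0" for x n using nn[of x] e[of n] by linarith
  obtain R where R: "\<And>x. x \<in> box a b \<Longrightarrow> norm x \<le> R"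
    using bounded_box[of a b] unfolding bounded_iff by blast
  have "\<phi> n \<in> test_functions" for n
  proof (rule test_functionsI)
    show "smooth (\<phi> n)" unfolding \<phi>_def[abs_def]
      by (intro smooth_divide smooth_add smooth_box_bump smooth_const) (use p in \<open>simp add: less_imp_neq[THEN not_sym]\<close>)
    show "\<phi> n x = 0" if "norm x > R" for x using R[of x] that box_bump_zero[of x a b] by (force simp: \<phi>_def)
  qed
  moreover have "\<bar>\<phi> n x\<bar> \<le> indicator (box a b) x" for n x
    using p[of x n] nn[of x] e[of n] box_bump_zero[of x a b] by (auto simp: \<phi>_def indicator_def field_simps)
  moreover have "(\<lambda>n. \<phi> n x) \<longlonglongrightarrow> indicator (box a b) x" for x
  proof (cases "x \<in> box a b")
    case True
    have "(\<lambda>n. \<phi> n x) \<longlonglongrightarrow> box_bump a b x / (box_bump a b x + 0)"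
      unfolding \<phi>_def using box_bump_pos[OF True] by (intro tendsto_intros e0) auto
    then show ?thesis using True box_bump_pos[OF True] by simp
  next
    case False then show ?thesis by (simp add: \<phi>_def box_bump_zero)
  qed
  ultimately show ?thesis by blast
qed

text \<open>Boxes generate the Borel sets and are closed under intersection, so Dynkin induction
  extends the vanishing of the integrals to all Borel sets, and a density is determined by these
  integrals. The complement step needs the integral over the whole plane, which is found beforehand
  by exhausting the plane with boxes.\<close>

lemma AE_0_if_box_integrals_0:
  fixes f :: "real^2 \<Rightarrow> real"
  assumes f: "integrable lborel f" and 0: "\<And>a b. (LINT x|lborel. indicator (box a b) x * f x) = 0"
  shows "AE x in lborel. f x = 0"
proof -
  have ind: "integrable lborel (\<lambda>x. indicator A x * f x)" if "A \<in> sets borel" for A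
    using integrable_real_mult_indicator[OF _ f, of A] that by (simp add: mult.commute)
  have "(LINT x|lborel. f x) = 0"
  proof -
    define B :: "nat \<Rightarrow> (real^2) set" where "B n = box (\<chi> i. - real n) (\<chi> i. real n)" for n
    have "(\<lambda>n. LINT x|lborel. indicator (B n) x * f x) \<longlonglongrightarrow> (LINT x|lborel. f x)"
    proof (rule integral_dominated_convergence[where w="\<lambda>x. norm (f x)"])
      show "AE x in lborel. (\<lambda>n. indicator (B n) x * f x) \<longlonglongrightarrow> f x"
      proof (rule AE_I2)
        fix x :: "real^2"
        have "\<forall>\<^sub>F n in sequentially. norm x < real n"
          using filterlim_real_sequentially unfolding filterlim_at_top_dense by blast
        then have "\<forall>\<^sub>F n in sequentially. f x = indicator (B n) x * f x"
        proof eventually_elim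
          case (elim n)
          have "- real n < x $ i \<and> x $ i < real n" for i using elim component_le_norm_cart[of x i] by linarith
          then have "x \<in> B n" by (simp add: B_def mem_box_cart)
          then show ?case by simp
        qed
        then show "(\<lambda>n. indicator (B n) x * f x) \<longlonglongrightarrow> f x"
          by (rule Lim_transform_eventually[OF tendsto_const])
      qed
      show "AE x in lborel. norm (indicator (B n) x * f x) \<le> norm (f x)" for n
        by (rule AE_I2) (auto simp: indicator_def)
      show "(\<lambda>x. indicator (B n) x * f x) \<in> borel_measurable lborel" for n
        using ind[of "B n"] by (auto simp: B_def)
    qed (use f in auto)
    moreover have "(LINT x|lborel. indicator (B n) x * f x) = 0" for n unfolding B_def by (rule 0)
    ultimately have "(\<lambda>n::nat. 0) \<longlonglongrightarrow> (LINT x|lborel. f x)" by simp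
    from LIMSEQ_unique[OF this tendsto_const] show ?thesis .
  qed
  note total = this
  have stable: "Int_stable (range (\<lambda>(a, b). box a b :: (real^2) set))"
    by (auto simp: Int_stable_def box_Int_box)
  have borel: "sets borel = sigma_sets UNIV (range (\<lambda>(a, b). box a b :: (real^2) set))"
    by (simp add: borel_eq_box)
  have all: "(LINT x|lborel. indicator A x * f x) = 0" if "A \<in> sets borel" for A
    using stable subset_UNIV[of "range (\<lambda>(a, b). box a b :: (real^2) set)", folded Pow_UNIV] that[unfolded borel]
  proof (induction A rule: sigma_sets_induct_disjoint)
    case (basic A) then show ?case using 0 by auto
  next
    case (compl A)
    then have A: "A \<in> sets borel" using borel by simp
    have "(LINT x|lborel. indicator (UNIV - A) x * f x) = (LINT x|lborel. f x - indicator A x * f x)"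
      by (rule Bochner_Integration.integral_cong) (auto simp: indicator_def)
    then show ?case using compl total f ind[OF A] by simp
  next
    case (union A)
    then have A: "A i \<in> sets borel" for i using borel by auto
    have "(LINT x:(\<Union>i. A i)|lborel. f x) = (\<Sum>i. LINT x:A i|lborel. f x)"
    proof (rule lebesgue_integral_countable_add)
      show "set_integrable lborel (\<Union>i. A i) f" using ind[of "\<Union>i. A i"] A by (auto simp: set_integrable_def)
    qed (use A union in \<open>auto simp: disjoint_family_on_def\<close>)
    then show ?case using union by (simp add: set_lebesgue_integral_def)
  qed simp
  have "AE x in lborel. f x = (\<lambda>x. 0) x"
    by (rule density_unique_real) (use f all in \<open>auto simp: set_lebesgue_integral_def\<close>)
  then show ?thesis by simp
qed

text \<open>A square integrable function need not be integrable over the plane, so D is restricted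
  to one box at a time. Boxes meet in boxes, hence the restriction again has integral 0 over every
  box.\<close>

lemma AE_0_if_test_integrals_0:
  assumes D: "D \<in> L2" and 0: "\<And>\<phi>. \<phi> \<in> test_functions \<Longrightarrow> (LINT x|lebesgue. D x * \<phi> x) = 0"
  shows "AE x in lebesgue. D x = 0"
proof -
  have loc: "integrable lebesgue (\<lambda>x. D x * indicator (cball 0 R) x)" for R
    using L2_mult_integrable[OF D L2_indicator_cball] .
  have box: "(LINT x|lebesgue. D x * indicator (box a b) x) = 0" for a b
  proof -
    obtain \<phi> where \<phi>: "\<And>n. \<phi> n \<in> test_functions" "\<And>n x. \<bar>\<phi> n x\<bar> \<le> indicator (box a b) x"
      "\<And>x. (\<lambda>n::nat. \<phi> n x) \<longlonglongrightarrow> indicator (box a b) x" using box_indicator_approx[of a b] by blast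
    obtain R where R: "\<And>x. x \<in> box a b \<Longrightarrow> norm x \<le> R"
      using bounded_box[of a b] unfolding bounded_iff by blast
    have "(\<lambda>n. LINT x|lebesgue. D x * \<phi> n x) \<longlonglongrightarrow> (LINT x|lebesgue. D x * indicator (box a b) x)"
    proof (rule integral_dominated_convergence[where w="\<lambda>x. norm (D x * indicator (cball 0 R) x)"])
      show "(\<lambda>x. D x * indicator (box a b) x) \<in> borel_measurable lebesgue"
        by (intro borel_measurable_times L2_D(1)[OF D] borel_measurable_indicator) auto
      show "(\<lambda>x. D x * \<phi> n x) \<in> borel_measurable lebesgue" for n
        using L2_D(1)[OF D] L2_D(1)[OF test_L2[OF \<phi>(1)]] by (intro borel_measurable_times)
      show "integrable lebesgue (\<lambda>x. norm (D x * indicator (cball 0 R) x))" using loc by (rule integrable_norm)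
      show "AE x in lebesgue. (\<lambda>n. D x * \<phi> n x) \<longlonglongrightarrow> D x * indicator (box a b) x"
        by (rule AE_I2) (intro tendsto_intros \<phi>(3))
      have "\<bar>\<phi> n x\<bar> \<le> indicator (cball 0 R) x" for n x
        using \<phi>(2)[of n x] R[of x] by (cases "x \<in> box a b") auto
      then show "AE x in lebesgue. norm (D x * \<phi> n x) \<le> norm (D x * indicator (cball 0 R) x)" for n
        by (intro AE_I2) (simp add: abs_mult mult_left_mono)
    qed
    then have "(\<lambda>n::nat. 0) \<longlonglongrightarrow> (LINT x|lebesgue. D x * indicator (box a b) x)" using 0 \<phi>(1) by simp
    from LIMSEQ_unique[OF this tendsto_const] show ?thesis .
  qed
  \<comment> \<open>A Borel representative, since the criterion for boxes is stated in
    \<open>lborel\<close>.\<close>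
  obtain D' where D': "D' \<in> borel_measurable borel" "AE x in lborel. D x = D' x"
    using completion_ex_borel_measurable_real[OF L2_D(1)[OF D]] by auto
  have D'2: "AE x in lebesgue. D x = D' x" using D'(2) by (rule AE_completion)
  have "AE x in lborel. indicator (box a b) x * D' x = 0" for a b
  proof (rule AE_0_if_box_integrals_0)
    obtain R where R: "\<And>x. x \<in> box a b \<Longrightarrow> norm x \<le> R"
      using bounded_box[of a b] unfolding bounded_iff by blast
    have m: "(\<lambda>x. indicator (box c d) x * (indicator (box a b) x * D' x)) \<in> borel_measurable borel" for c d
      using D'(1) by measurable
    have m1: "(\<lambda>x. indicator (box a b) x * D' x) \<in> borel_measurable borel" using D'(1) by measurable
    have "integrable lebesgue (\<lambda>x. indicator (box a b) x * D' x)"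
    proof (rule Bochner_Integration.integrable_bound[OF loc[of R]])
      show "(\<lambda>x. indicator (box a b) x * D' x) \<in> borel_measurable lebesgue"
        using m1 by (auto intro: measurable_completion)
      show "AE x in lebesgue. norm (indicator (box a b) x * D' x) \<le> norm (D x * indicator (cball 0 R) x)"
        using D'2 by eventually_elim (use R in \<open>auto simp: indicator_def\<close>)
    qed
    then show "integrable lborel (\<lambda>x. indicator (box a b) x * D' x)" using lebesgue_eq_lborel(2)[OF m1] by simp
    fix c d
    obtain e f where ef: "box a b \<inter> box c d = box e f" using box_Int_box[of a b c d] by blast
    have "(LINT x|lborel. indicator (box c d) x * (indicator (box a b) x * D' x)) =
      (LINT x|lebesgue. indicator (box c d) x * (indicator (box a b) x * D' x))"
      using lebesgue_eq_lborel(1)[OF m] by simp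
    also have "\<dots> = (LINT x|lebesgue. D x * indicator (box e f) x)"
    proof (rule integral_cong_AE)
      show "AE x in lebesgue. indicator (box c d) x * (indicator (box a b) x * D' x) = D x * indicator (box e f) x"
        using D'2 by eventually_elim (auto simp flip: ef simp: indicator_def)
      show "(\<lambda>x. D x * indicator (box e f) x) \<in> borel_measurable lebesgue"
        by (intro borel_measurable_times L2_D(1)[OF D] borel_measurable_indicator) auto
    qed (use m in \<open>auto intro: measurable_completion\<close>)
    finally show "(LINT x|lborel. indicator (box c d) x * (indicator (box a b) x * D' x)) = 0"
      using box by simp
  qed
  then have "AE x in lborel. \<forall>n. indicator (box (\<chi> i. - real n) (\<chi> i. real n)) x * D' x = 0"
    by (subst AE_all_countable) blast
  then have "AE x in lborel. D' x = 0"
  proof eventually_elim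
    case (elim x)
    obtain n :: nat where n: "norm x < real n" using reals_Archimedean2 by blast
    have "- real n < x $ i \<and> x $ i < real n" for i using n component_le_norm_cart[of x i] by linarith
    then have "x \<in> box (\<chi> i. - real n) (\<chi> i. real n)" by (simp add: mem_box_cart)
    then show ?case using elim[rule_format, of n] by simp
  qed
  then have "AE x in lebesgue. D' x = 0" by (rule AE_completion)
  with D'2 show ?thesis by eventually_elim simp
qed

section \<open>The regularized kernel and its decay\<close>

text \<open>\<open>ker0 e\<close> is a smooth regularization of \<open>K (norm z)\<close>, recovered at \<open>e = 0\<close>. The gradient of
  \<open>ker0 e\<close> is \<open>ker1 e\<close>, its Hessian \<open>ker2 e\<close>, the gradient of its Laplacian \<open>ker3 e\<close>, and its
  bilaplacian \<open>ker4 e\<close>. The last one is \<open>ker4 1\<close> rescaled to width \<open>e\<close>, an approximate identity.\<close>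

definition qreg :: "real \<Rightarrow> real^2 \<Rightarrow> real" where
  "qreg e z = z \<bullet> z + e\<^sup>2"

definition ker0 :: "real \<Rightarrow> real^2 \<Rightarrow> real" where
  "ker0 e z = qreg e z * ln (qreg e z) / 2"

definition ker1 :: "real \<Rightarrow> 2 \<Rightarrow> real^2 \<Rightarrow> real" where
  "ker1 e i z = z $ i * (ln (qreg e z) + 1)"

definition ker2 :: "real \<Rightarrow> 2 \<Rightarrow> 2 \<Rightarrow> real^2 \<Rightarrow> real" where
  "ker2 e i j z = (if i = j then ln (qreg e z) + 1 else 0) + 2 * (z $ i * z $ j) / qreg e z"

definition ker3 :: "real \<Rightarrow> 2 \<Rightarrow> real^2 \<Rightarrow> real" where
  "ker3 e j z = 4 * z $ j / qreg e z + 4 * e\<^sup>2 * z $ j / (qreg e z)\<^sup>2"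

definition ker4 :: "real \<Rightarrow> real^2 \<Rightarrow> real" where
  "ker4 e z = 16 * e ^ 4 / (qreg e z) ^ 3"

lemma qreg_pos: "e \<noteq> 0 \<Longrightarrow> qreg e z > 0"
  by (auto simp: qreg_def intro!: add_nonneg_pos)

lemma qreg_pos': "z \<noteq> 0 \<Longrightarrow> qreg e z > 0"
  by (auto simp: qreg_def intro!: add_pos_nonneg)

lemma smooth_qreg: "smooth (qreg e)"
  unfolding qreg_def[abs_def] by (intro smooth_add smooth_inner_self smooth_const)

lemma qreg_has_derivative: "(qreg e has_derivative (\<lambda>h. 2 * (z \<bullet> h))) (at z)"
  unfolding qreg_def[abs_def] by (auto intro!: derivative_eq_intros simp: inner_commute)

lemma nth_has_derivative: "((\<lambda>x. x $ i) has_derivative (\<lambda>h. h $ i)) (at x)"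
  by (intro bounded_linear_imp_has_derivative bounded_linear_vec_nth)

lemma axis_component: "axis i 1 $ j = (if i = j then 1 else (0::real))"
  by (simp add: axis_def)

lemma smooth_ker:
  assumes "e \<noteq> 0"
  shows "smooth (ker0 e)" "smooth (ker1 e i)" "smooth (ker2 e i j)" "smooth (ker3 e j)" "smooth (ker4 e)"
proof -
  have nz: "qreg e z \<noteq> 0" for z using qreg_pos[OF assms, of z] by simp
  show "smooth (ker0 e)" "smooth (ker1 e i)" "smooth (ker4 e)"
    unfolding ker0_def[abs_def] ker1_def[abs_def] ker4_def[abs_def]
    using nz by (auto intro!: smooth_divide smooth_add smooth_mult smooth_const smooth_nth smooth_ln
        smooth_qreg qreg_pos assms smooth_power)
  show "smooth (ker3 e j)"
    unfolding ker3_def[abs_def]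
    using nz by (auto intro!: smooth_divide smooth_add smooth_mult smooth_const smooth_nth smooth_ln
        smooth_qreg qreg_pos assms smooth_power)
  show "smooth (ker2 e i j)"
    unfolding ker2_def[abs_def]
    using nz by (cases "i = j") (auto intro!: smooth_divide smooth_add smooth_mult smooth_const smooth_nth smooth_ln
        smooth_qreg qreg_pos assms smooth_power)
qed

context
  fixes e :: real
  assumes e: "e \<noteq> 0"
begin

lemma qreg_nz: "qreg e z \<noteq> 0" using qreg_pos[OF e, of z] by simp

lemma partial_ker0: "partial i (ker0 e) z = ker1 e i z"
proof -
  have "(ker0 e has_derivative (\<lambda>h. (2 * (z \<bullet> h)) * (ln (qreg e z) + 1) / 2)) (at z)"
    unfolding ker0_def[abs_def]
    by (auto intro!: derivative_eq_intros qreg_has_derivative qreg_pos e simp: qreg_nz field_simps)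
  from partial_eq[OF this] show ?thesis by (simp add: ker1_def inner_axis)
qed

lemma partial_ker1: "partial i (ker1 e j) z = ker2 e i j z"
proof -
  have "(ker1 e j has_derivative (\<lambda>h. h $ j * (ln (qreg e z) + 1) + z $ j * (2 * (z \<bullet> h)) / qreg e z)) (at z)"
    unfolding ker1_def[abs_def]
    by (auto intro!: derivative_eq_intros qreg_has_derivative nth_has_derivative qreg_pos e simp: qreg_nz field_simps)
  from partial_eq[OF this] show ?thesis by (simp add: ker2_def inner_axis axis_component)
qed

lemma inner_qreg: "z \<bullet> z = qreg e z - e\<^sup>2" by (simp add: qreg_def)

lemma partial_ker2: "(\<Sum>i\<in>UNIV. partial i (ker2 e i j) z) = ker3 e j z"
proof -
  have "(ker2 e i j has_derivative (\<lambda>h. (if i = j then 2 * (z \<bullet> h) / qreg e z else 0)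
     + (2 * (h $ i * z $ j + z $ i * h $ j) / qreg e z - 2 * (z $ i * z $ j) * (2 * (z \<bullet> h)) / (qreg e z)\<^sup>2))) (at z)" for i
    unfolding ker2_def[abs_def]
    by (cases "i = j") (auto intro!: derivative_eq_intros qreg_has_derivative nth_has_derivative qreg_pos e
        simp: qreg_nz field_simps power2_eq_square)
  from partial_eq[OF this]
  have p: "partial i (ker2 e i j) z = (if i = j then 2 * z $ i / qreg e z else 0)
     + (2 * (z $ j + (if i = j then z $ i else 0)) / qreg e z - 4 * z $ j * (z $ i * z $ i) / (qreg e z)\<^sup>2)" for i
    by (simp add: inner_axis axis_component)
  \<comment> \<open>Here the dimension enters: the terms in z_j / q add up to 2 + 4 + 2. With |z|^2
    = q - e^2 the last term then takes away four of these eight.\<close>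
  have "(\<Sum>i\<in>UNIV. partial i (ker2 e i j) z) = 8 * z $ j / qreg e z - 4 * z $ j * (z \<bullet> z) / (qreg e z)\<^sup>2"
    unfolding p using exhaust_2[of j] by (auto simp: sum_2 inner_vec_def add_divide_distrib diff_divide_distrib algebra_simps)
  also have "\<dots> = ker3 e j z"
    unfolding inner_qreg ker3_def using qreg_nz by (simp add: field_simps power2_eq_square)
  finally show ?thesis .
qed

lemma partial_ker3: "(\<Sum>j\<in>UNIV. partial j (ker3 e j) z) = ker4 e z"
proof -
  have "(ker3 e j has_derivative (\<lambda>h. 4 * h $ j / qreg e z - 4 * z $ j * (2 * (z \<bullet> h)) / (qreg e z)\<^sup>2
     + (4 * e\<^sup>2 * h $ j / (qreg e z)\<^sup>2 - 4 * e\<^sup>2 * z $ j * 2 * (2 * (z \<bullet> h)) / (qreg e z) ^ 3))) (at z)" for j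
    unfolding ker3_def[abs_def]
    by (auto intro!: derivative_eq_intros qreg_has_derivative nth_has_derivative qreg_pos e
        simp: qreg_nz field_simps power2_eq_square power3_eq_cube)
  from partial_eq[OF this]
  have p: "partial j (ker3 e j) z = 4 / qreg e z - 8 * (z $ j * z $ j) / (qreg e z)\<^sup>2
     + (4 * e\<^sup>2 / (qreg e z)\<^sup>2 - 16 * e\<^sup>2 * (z $ j * z $ j) / (qreg e z) ^ 3)" for j
    by (simp add: inner_axis axis_component)
  have "(\<Sum>j\<in>UNIV. partial j (ker3 e j) z) = 8 / qreg e z - 8 * (z \<bullet> z) / (qreg e z)\<^sup>2
     + (8 * e\<^sup>2 / (qreg e z)\<^sup>2 - 16 * e\<^sup>2 * (z \<bullet> z) / (qreg e z) ^ 3)"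
    unfolding p by (simp add: sum_2 inner_vec_def add_divide_distrib diff_divide_distrib algebra_simps)
  \<comment> \<open>With |z|^2 = q - e^2 all terms in 1 / q and 1 / q^2 cancel and only a multiple
    of e^4 is left: the unsmoothed kernel is biharmonic off its centre.\<close>
  also have "\<dots> = ker4 e z"
    unfolding inner_qreg ker4_def using qreg_nz by (simp add: field_simps power2_eq_square power3_eq_cube power4_eq_xxxx)
  finally show ?thesis .
qed

end

lemma ker2_commute: "ker2 e i j = ker2 e j i"
  by (auto simp: ker2_def fun_eq_iff mult.commute)

lemma ker0_eq_K: "ker0 0 z = K (norm z)"
proof (cases "z = 0")
  case False
  then have "ln (z \<bullet> z) = 2 * ln (norm z)" by (simp add: dot_square_norm ln_realpow)
  then show ?thesis by (simp add: ker0_def K_def qreg_def dot_square_norm)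
qed (simp add: ker0_def K_def qreg_def)

section \<open>Expansion of kernel derivatives to first order in the centre\<close>

lemma frac_bound:
  fixes t :: real
  assumes "\<bar>t\<bar> \<le> N" "d \<le> D" "d > 0"
  shows "\<bar>t / D\<bar> \<le> N / d"
  using assms by (simp add: abs_divide frac_le)

text \<open>The geometric series after two terms, with its exact remainder; v will be the change of
  \<open>qreg\<close> when the centre moves from 0 to a.\<close>

lemma recip_expand:
  fixes Q v :: real
  assumes "Q > 0" "Q + v > 0"
  shows "1 / (Q + v) = 1 / Q - v / Q\<^sup>2 + v\<^sup>2 / (Q\<^sup>2 * (Q + v))"
proof -
  define w where "w = Q + v"
  have "Q \<noteq> 0" "w \<noteq> 0" using assms by (auto simp: w_def)
  then have "1 / w = 1 / Q - (w - Q) / Q\<^sup>2 + (w - Q)\<^sup>2 / (Q\<^sup>2 * w)"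
    by (simp add: divide_simps) (simp add: power2_eq_square algebra_simps)
  then show ?thesis by (simp add: w_def)
qed

text \<open>Here a is a centre and y a distant point. The factor 8 gives 3 A |y| \<le> (3/8) |y|^2,
  so that moving the centre takes away less than half of |y|^2; \<open>qreg_perturbed\<close> relies
  on this.\<close>

lemma perturbation_bounds:
  fixes a y :: "real^2"
  assumes a: "norm a \<le> A" and A: "A \<ge> 1" and y: "norm y \<ge> 8 * A"
  shows "\<bar>a \<bullet> y\<bar> \<le> A * norm y" "0 \<le> a \<bullet> a" "a \<bullet> a \<le> A\<^sup>2" "\<bar>a \<bullet> a - 2 * (a \<bullet> y)\<bar> \<le> 3 * A * norm y"
    "norm y > 0" "\<bar>y $ i\<bar> \<le> norm y" "\<bar>a $ i\<bar> \<le> A" "norm y \<ge> 8 * A"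
proof -
  show X: "norm y > 0" "norm y \<ge> 8 * A" using A y by linarith+
  have "\<bar>a \<bullet> y\<bar> \<le> norm a * norm y" by (rule Cauchy_Schwarz_ineq2)
  also have "\<dots> \<le> A * norm y" using a by (auto intro: mult_right_mono)
  finally show ay: "\<bar>a \<bullet> y\<bar> \<le> A * norm y" .
  show aa: "0 \<le> a \<bullet> a" "a \<bullet> a \<le> A\<^sup>2" using a by (auto simp: dot_square_norm intro: power_mono)
  have "A\<^sup>2 \<le> A * norm y" using X A by (simp add: power2_eq_square)
  then show "\<bar>a \<bullet> a - 2 * (a \<bullet> y)\<bar> \<le> 3 * A * norm y" using ay aa by linarith
  show "\<bar>y $ i\<bar> \<le> norm y" "\<bar>a $ i\<bar> \<le> A" using component_le_norm_cart[of y i] component_le_norm_cart[of a i] a by auto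
qed

lemma qreg_perturbed:
  fixes a y :: "real^2"
  assumes a: "norm a \<le> A" and A: "A \<ge> 1" and y: "norm y \<ge> 8 * A"
  shows "qreg e (y - a) = qreg e y + (a \<bullet> a - 2 * (a \<bullet> y))" "qreg e y \<ge> (norm y)\<^sup>2"
    "qreg e y + (a \<bullet> a - 2 * (a \<bullet> y)) \<ge> (norm y)\<^sup>2 / 2"
proof -
  note s = perturbation_bounds[OF assms]
  show "qreg e (y - a) = qreg e y + (a \<bullet> a - 2 * (a \<bullet> y))" by (simp add: qreg_def inner_diff inner_commute)
  show Q: "qreg e y \<ge> (norm y)\<^sup>2" by (simp add: qreg_def dot_square_norm)
  have "3 * A * norm y \<le> (norm y)\<^sup>2 / 2" using mult_right_mono[OF s(8), of "norm y"] s(5) A by (simp add: power2_eq_square)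
  then show "qreg e y + (a \<bullet> a - 2 * (a \<bullet> y)) \<ge> (norm y)\<^sup>2 / 2" using s(4) Q by linarith
qed

text \<open>ln (Q + v) = ln Q + ln (1 + v / Q) with |v / Q| \<le> 3/8, where ln (1 + u) differs from
  u by at most 2 u^2; this gives 18 A^2 / |y|^2. The part of v / Q that is quadratic in a
  contributes one more.\<close>

lemma ln_expansion:
  fixes a y :: "real^2"
  assumes "norm a \<le> A" "A \<ge> 1" "norm y \<ge> 8 * A"
  shows "\<bar>ln (qreg e (y - a)) - (ln (qreg e y) - 2 * (a \<bullet> y) / qreg e y)\<bar> \<le> 19 * A\<^sup>2 / (norm y)\<^sup>2"
proof -
  define X where "X = norm y"
  define Q where "Q = qreg e y"
  define v where "v = a \<bullet> a - 2 * (a \<bullet> y)"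
  note s1 = perturbation_bounds[OF assms, folded X_def v_def]
    and s2 = qreg_perturbed[OF assms, of e, folded X_def Q_def v_def]
  note s = s2(1) s1(1-4) s2(2,3) s1(5-8)
  have Q: "Q > 0" using s(6,8) zero_less_power[OF s(8), of 2] by linarith
  have "\<bar>v / Q\<bar> \<le> 3 * A * X / X\<^sup>2" using s by (intro frac_bound) auto
  also have "\<dots> = 3 * A / X" using s(8) by (simp add: power2_eq_square)
  finally have u: "\<bar>v / Q\<bar> \<le> 3 * A / X" .
  also have "\<dots> \<le> 3 / 8" using s(8,11) by (simp add: field_simps)
  finally have u2: "\<bar>v / Q\<bar> \<le> 3 / 8" .
  have "\<bar>ln (1 + v / Q) - v / Q\<bar> \<le> 2 * (v / Q)\<^sup>2"
  proof (cases "v / Q \<ge> 0")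
    case True
    have "\<bar>ln (1 + v / Q) - v / Q\<bar> \<le> (v / Q)\<^sup>2" by (rule abs_ln_one_plus_x_minus_x_bound_nonneg) (use True u2 in linarith)+
    then show ?thesis using zero_le_power2[of "v / Q"] by linarith
  next
    case False
    then show ?thesis by (intro abs_ln_one_plus_x_minus_x_bound_nonpos) (use u2 in linarith)+
  qed
  also have "\<dots> \<le> 2 * (3 * A / X)\<^sup>2"
    using power_mono[OF u abs_ge_zero, of 2] unfolding power2_abs by simp
  finally have l: "\<bar>ln (1 + v / Q) - v / Q\<bar> \<le> 18 * A\<^sup>2 / X\<^sup>2" by (simp add: power_divide power_mult_distrib)
  have "ln (Q + v) = ln (Q * (1 + v / Q))" using Q by (simp add: distrib_left)
  also have "\<dots> = ln Q + ln (1 + v / Q)" using Q u2 by (intro ln_mult_pos) linarith+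
  finally have lnq: "ln (Q + v) = ln Q + ln (1 + v / Q)" .
  have aa: "\<bar>a \<bullet> a / Q\<bar> \<le> A\<^sup>2 / X\<^sup>2" using s by (intro frac_bound) auto
  have "v / Q = a \<bullet> a / Q - 2 * (a \<bullet> y) / Q" by (simp add: v_def diff_divide_distrib)
  then have "\<bar>ln (Q + v) - (ln Q - 2 * (a \<bullet> y) / Q)\<bar> \<le> 18 * A\<^sup>2 / X\<^sup>2 + A\<^sup>2 / X\<^sup>2"
    using l aa lnq by linarith
  then show ?thesis unfolding s(1) X_def[symmetric] Q_def[symmetric] by (simp add: add_divide_distrib[symmetric])
qed

text \<open>The numerator is sorted by degree in a into \<open>P\<close>, \<open>p1\<close> and
  \<open>p2\<close>, and the reciprocal is expanded by \<open>recip_expand\<close>. What is affine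
  in a is kept; the four remaining terms are at most 1, 1, 9 and 72 times A^2 / |y|^2.\<close>

lemma quadratic_expansion:
  fixes a y :: "real^2"
  assumes "norm a \<le> A" "A \<ge> 1" "norm y \<ge> 8 * A"
  shows "\<bar>(y - a) $ i * (y - a) $ j / qreg e (y - a) - (y $ i * y $ j / qreg e y +
      (2 * y $ i * y $ j * (a \<bullet> y) / (qreg e y)\<^sup>2 - (a $ i * y $ j + a $ j * y $ i) / qreg e y))\<bar> \<le> 100 * A\<^sup>2 / (norm y)\<^sup>2"
proof -
  define X where "X = norm y"
  define Q where "Q = qreg e y"
  define v where "v = a \<bullet> a - 2 * (a \<bullet> y)"
  note s1 = perturbation_bounds[OF assms, folded X_def v_def]
    and s2 = qreg_perturbed[OF assms, of e, folded X_def Q_def v_def]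
  note s = s2(1) s1(1-4) s2(2,3) s1(5-8)
  have X2: "X\<^sup>2 > 0" using s(8) by simp
  have Q: "Q > 0" "Q + v > 0" using s(6,7) X2 by linarith+
  have Q2: "Q\<^sup>2 \<ge> X ^ 4" using power_mono[OF s(6), of 2] by (simp flip: power_mult)
  have Q3: "Q\<^sup>2 * (Q + v) \<ge> X ^ 4 * (X\<^sup>2 / 2)" using Q2 s(7) s(8) Q by (intro mult_mono) auto
  define P where "P = y $ i * y $ j"
  define p1 where "p1 = - (a $ i * y $ j + a $ j * y $ i)"
  define p2 where "p2 = a $ i * a $ j"
  have AX: "A \<le> X" "0 \<le> A" using s(11) assms(2) by auto
  have AAX: "A\<^sup>2 \<le> A * X" using AX by (simp add: power2_eq_square mult_left_mono)
  have P: "\<bar>P\<bar> \<le> X * X" unfolding P_def abs_mult using s(8) by (intro mult_mono s(9)) auto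
  have p2: "\<bar>p2\<bar> \<le> A * A" unfolding p2_def abs_mult using AX by (intro mult_mono s(10)) auto
  have "\<bar>a $ i * y $ j\<bar> \<le> A * X" "\<bar>a $ j * y $ i\<bar> \<le> A * X"
    unfolding abs_mult using AX by (intro mult_mono s(9,10); simp)+
  then have p1: "\<bar>p1\<bar> \<le> 2 * (A * X)" unfolding p1_def by linarith
  have p12: "\<bar>p1 + p2\<bar> \<le> 3 * (A * X)" using p1 p2 AAX unfolding power2_eq_square by linarith
  have "A * X \<le> X * X" using AX by (intro mult_right_mono) auto
  then have p: "\<bar>P + p1 + p2\<bar> \<le> 4 * (X * X)" using P p12 by linarith
  have num: "(y - a) $ i * (y - a) $ j = P + p1 + p2" by (simp add: P_def p1_def p2_def algebra_simps)
  have eq: "(P + p1 + p2) / (Q + v) - (P / Q + (2 * P * (a \<bullet> y) / Q\<^sup>2 + p1 / Q)) =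
    p2 / Q - P * (a \<bullet> a) / Q\<^sup>2 - (p1 + p2) * v / Q\<^sup>2 + (P + p1 + p2) * v\<^sup>2 / (Q\<^sup>2 * (Q + v))"
  proof -
    have "(P + p1 + p2) / (Q + v) = (P + p1 + p2) * (1 / Q - v / Q\<^sup>2 + v\<^sup>2 / (Q\<^sup>2 * (Q + v)))"
      by (subst recip_expand[OF Q, symmetric]) simp
    then show ?thesis by (simp add: v_def algebra_simps add_divide_distrib diff_divide_distrib)
  qed
  have t1: "\<bar>p2 / Q\<bar> \<le> A\<^sup>2 / X\<^sup>2" using p2 s X2 by (intro frac_bound) (auto simp: power2_eq_square)
  have "\<bar>P * (a \<bullet> a) / Q\<^sup>2\<bar> \<le> X * X * A\<^sup>2 / X ^ 4"
    unfolding abs_mult using P s Q2 by (intro frac_bound) (auto simp: abs_mult intro!: mult_mono)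
  then have t2: "\<bar>P * (a \<bullet> a) / Q\<^sup>2\<bar> \<le> A\<^sup>2 / X\<^sup>2" using s(8) by (simp add: field_simps power2_eq_square power4_eq_xxxx)
  have "\<bar>(p1 + p2) * v\<bar> \<le> 3 * (A * X) * (3 * A * X)"
    unfolding abs_mult using p12 s(5) by (intro mult_mono order_trans[OF abs_ge_zero p12]) auto
  then have "\<bar>(p1 + p2) * v / Q\<^sup>2\<bar> \<le> 3 * (A * X) * (3 * A * X) / X ^ 4"
    using s(8) Q2 by (intro frac_bound) auto
  then have t3: "\<bar>(p1 + p2) * v / Q\<^sup>2\<bar> \<le> 9 * A\<^sup>2 / X\<^sup>2" using s(8) by (simp add: field_simps power2_eq_square power4_eq_xxxx)
  have v2: "v\<^sup>2 \<le> (3 * A * X)\<^sup>2" using power_mono[OF s(5) abs_ge_zero, of 2] by simp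
  have "\<bar>(P + p1 + p2) * v\<^sup>2 / (Q\<^sup>2 * (Q + v))\<bar> \<le> 4 * (X * X) * (3 * A * X)\<^sup>2 / (X ^ 4 * (X\<^sup>2 / 2))"
    using p v2 s(8) Q3 by (intro frac_bound) (auto simp: abs_mult intro!: mult_mono)
  then have t4: "\<bar>(P + p1 + p2) * v\<^sup>2 / (Q\<^sup>2 * (Q + v))\<bar> \<le> 72 * A\<^sup>2 / X\<^sup>2"
    using s(8) by (simp add: field_simps power2_eq_square power4_eq_xxxx)
  have "\<bar>(P + p1 + p2) / (Q + v) - (P / Q + (2 * P * (a \<bullet> y) / Q\<^sup>2 + p1 / Q))\<bar>
    \<le> A\<^sup>2 / X\<^sup>2 + A\<^sup>2 / X\<^sup>2 + 9 * A\<^sup>2 / X\<^sup>2 + 72 * A\<^sup>2 / X\<^sup>2"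
    unfolding eq using t1 t2 t3 t4 by linarith
  also have "\<dots> \<le> 100 * A\<^sup>2 / X\<^sup>2" by (simp add: add_divide_distrib[symmetric] divide_right_mono)
  moreover have "2 * y $ i * y $ j * (a \<bullet> y) / Q\<^sup>2 - (a $ i * y $ j + a $ j * y $ i) / Q = 2 * P * (a \<bullet> y) / Q\<^sup>2 + p1 / Q"
    by (simp only: p1_def minus_divide_left[symmetric] P_def mult.assoc diff_conv_add_uminus)
  ultimately show ?thesis
    unfolding s(1) X_def[symmetric] Q_def[symmetric] num by (simp add: P_def)
qed

text \<open>As for the quadratic terms, one power of |y| better: the errors are at most 1, 3 and 36
  times A^2 / |y|^3. The quotient in the second claim has the order |y|^-3 already without any
  cancellation.\<close>

lemma linear_expansion:
  fixes a y :: "real^2"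
  assumes "norm a \<le> A" "A \<ge> 1" "norm y \<ge> 8 * A"
  shows "\<bar>(y - a) $ j / qreg e (y - a) - (y $ j / qreg e y +
      (2 * y $ j * (a \<bullet> y) / (qreg e y)\<^sup>2 - a $ j / qreg e y))\<bar> \<le> 100 * A\<^sup>2 / norm y ^ 3"
    and "\<bar>(y - a) $ j / (qreg e (y - a))\<^sup>2\<bar> \<le> 8 / norm y ^ 3"
proof -
  define X where "X = norm y"
  define Q where "Q = qreg e y"
  define v where "v = a \<bullet> a - 2 * (a \<bullet> y)"
  note s1 = perturbation_bounds[OF assms, folded X_def v_def]
    and s2 = qreg_perturbed[OF assms, of e, folded X_def Q_def v_def]
  note s = s2(1) s1(1-4) s2(2,3) s1(5-8)
  have X2: "X\<^sup>2 > 0" using s(8) by simp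
  have Q: "Q > 0" "Q + v > 0" using s(6,7) X2 by linarith+
  have Q2: "Q\<^sup>2 \<ge> X ^ 4" using power_mono[OF s(6), of 2] by (simp flip: power_mult)
  have Q3: "Q\<^sup>2 * (Q + v) \<ge> X ^ 4 * (X\<^sup>2 / 2)" using Q2 s(7) s(8) Q by (intro mult_mono) auto
  have AX: "A \<le> X" "0 \<le> A" using s(11) assms(2) by auto
  have p: "\<bar>(y - a) $ j\<bar> \<le> 2 * X" unfolding vector_minus_component using s(9,10)[of j] AX by linarith
  have eq: "(y - a) $ j / (Q + v) - (y $ j / Q + (2 * y $ j * (a \<bullet> y) / Q\<^sup>2 - a $ j / Q)) =
     - (y $ j * (a \<bullet> a) / Q\<^sup>2) + a $ j * v / Q\<^sup>2 + (y - a) $ j * v\<^sup>2 / (Q\<^sup>2 * (Q + v))"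
  proof -
    have "(y - a) $ j / (Q + v) = (y $ j - a $ j) * (1 / Q - v / Q\<^sup>2 + v\<^sup>2 / (Q\<^sup>2 * (Q + v)))"
      by (subst recip_expand[OF Q, symmetric]) simp
    then show ?thesis by (simp add: v_def algebra_simps add_divide_distrib diff_divide_distrib)
  qed
  have "\<bar>y $ j * (a \<bullet> a) / Q\<^sup>2\<bar> \<le> X * A\<^sup>2 / X ^ 4"
    using s Q2 by (intro frac_bound) (auto simp: abs_mult intro!: mult_mono)
  then have t1: "\<bar>y $ j * (a \<bullet> a) / Q\<^sup>2\<bar> \<le> A\<^sup>2 / X ^ 3" using s(8) by (simp add: field_simps power2_eq_square power3_eq_cube power4_eq_xxxx)
  have "\<bar>a $ j * v / Q\<^sup>2\<bar> \<le> A * (3 * A * X) / X ^ 4"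
    using s Q2 AX by (intro frac_bound) (auto simp: abs_mult intro!: mult_mono)
  then have t2: "\<bar>a $ j * v / Q\<^sup>2\<bar> \<le> 3 * A\<^sup>2 / X ^ 3" using s(8) by (simp add: field_simps power2_eq_square power3_eq_cube power4_eq_xxxx)
  have v2: "v\<^sup>2 \<le> (3 * A * X)\<^sup>2" using power_mono[OF s(5) abs_ge_zero, of 2] by simp
  have "\<bar>(y - a) $ j * v\<^sup>2 / (Q\<^sup>2 * (Q + v))\<bar> \<le> 2 * X * (3 * A * X)\<^sup>2 / (X ^ 4 * (X\<^sup>2 / 2))"
    using p v2 s(8) Q3 by (intro frac_bound) (auto simp: abs_mult simp del: vector_minus_component intro!: mult_mono)
  then have t3: "\<bar>(y - a) $ j * v\<^sup>2 / (Q\<^sup>2 * (Q + v))\<bar> \<le> 36 * A\<^sup>2 / X ^ 3"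
    using s(8) by (simp add: field_simps power2_eq_square power3_eq_cube power4_eq_xxxx)
  have "\<bar>(y - a) $ j / (Q + v) - (y $ j / Q + (2 * y $ j * (a \<bullet> y) / Q\<^sup>2 - a $ j / Q))\<bar>
    \<le> A\<^sup>2 / X ^ 3 + 3 * A\<^sup>2 / X ^ 3 + 36 * A\<^sup>2 / X ^ 3"
    unfolding eq using t1 t2 t3 by linarith
  also have "\<dots> \<le> 100 * A\<^sup>2 / X ^ 3" using s(8) by (simp add: add_divide_distrib[symmetric] divide_right_mono)
  finally show "\<bar>(y - a) $ j / qreg e (y - a) - (y $ j / qreg e y +
      (2 * y $ j * (a \<bullet> y) / (qreg e y)\<^sup>2 - a $ j / qreg e y))\<bar> \<le> 100 * A\<^sup>2 / norm y ^ 3"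
    unfolding s(1) X_def[symmetric] Q_def[symmetric] .
  have "(Q + v)\<^sup>2 \<ge> (X\<^sup>2 / 2)\<^sup>2" using s(7) X2 by (intro power_mono) auto
  then have "\<bar>(y - a) $ j / (Q + v)\<^sup>2\<bar> \<le> 2 * X / (X\<^sup>2 / 2)\<^sup>2"
    using p X2 by (intro frac_bound) auto
  then show "\<bar>(y - a) $ j / (qreg e (y - a))\<^sup>2\<bar> \<le> 8 / norm y ^ 3"
    unfolding s(1) X_def[symmetric] using s(8) by (simp add: field_simps power2_eq_square power3_eq_cube)
qed

text \<open>The moment conditions defining \<open>B_space\<close> annihilate every term that is affine in the centre.\<close>

lemma affine_cancellation:
  fixes x :: "nat \<Rightarrow> real^2"
  assumes b: "\<beta> \<in> B_space n x" and L: "linear L"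
    and T: "\<And>r. r \<in> {1..n} \<Longrightarrow> \<bar>T r - (c + L (x r))\<bar> \<le> \<epsilon>"
  shows "\<bar>\<Sum>r=1..n. \<beta> r * T r\<bar> \<le> (\<Sum>r=1..n. \<bar>\<beta> r\<bar>) * \<epsilon>"
proof -
  have "(\<Sum>r=1..n. \<beta> r * (c + L (x r))) = c * (\<Sum>r=1..n. \<beta> r) + L (\<Sum>r=1..n. \<beta> r *\<^sub>R x r)"
    using L by (simp add: linear_sum linear_scale distrib_left sum.distrib sum_distrib_left mult.commute)
  also have "\<dots> = 0" using b L by (simp add: B_space_def linear_0)
  finally have "(\<Sum>r=1..n. \<beta> r * T r) = (\<Sum>r=1..n. \<beta> r * (T r - (c + L (x r))))"
    by (simp add: right_diff_distrib sum_subtractf)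
  also have "\<bar>\<dots>\<bar> \<le> (\<Sum>r=1..n. \<bar>\<beta> r\<bar> * \<epsilon>)"
    by (rule order_trans[OF sum_abs]) (auto intro!: sum_mono mult_left_mono T simp: abs_mult)
  finally show ?thesis by (simp add: sum_distrib_right)
qed

text \<open>\<open>tps2\<close>, \<open>tps3\<close> and \<open>tps4\<close> are the Hessian of the
  smoothed spline, the gradient of its Laplacian and its bilaplacian; the affine part leaves no
  trace in them.\<close>

definition tps2 :: "nat \<Rightarrow> (nat \<Rightarrow> real^2) \<Rightarrow> (nat \<Rightarrow> real) \<Rightarrow> real \<Rightarrow> 2 \<Rightarrow> 2 \<Rightarrow> real^2 \<Rightarrow> real" where
  "tps2 n x \<beta> e i j y = (\<Sum>r=1..n. \<beta> r * ker2 e i j (y - x r))"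

definition tps3 :: "nat \<Rightarrow> (nat \<Rightarrow> real^2) \<Rightarrow> (nat \<Rightarrow> real) \<Rightarrow> real \<Rightarrow> 2 \<Rightarrow> real^2 \<Rightarrow> real" where
  "tps3 n x \<beta> e j y = (\<Sum>r=1..n. \<beta> r * ker3 e j (y - x r))"

definition tps4 :: "nat \<Rightarrow> (nat \<Rightarrow> real^2) \<Rightarrow> (nat \<Rightarrow> real) \<Rightarrow> real \<Rightarrow> real^2 \<Rightarrow> real" where
  "tps4 n x \<beta> e y = (\<Sum>r=1..n. \<beta> r * ker4 e (y - x r))"

text \<open>The parts of the three expansions that are linear in the centre a, in the shape in which
  \<open>affine_cancellation\<close> takes them.\<close>

lemma linear_component_forms:
  "linear (\<lambda>a::real^2. - 2 * (a \<bullet> y) / q)"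
  "linear (\<lambda>a::real^2. 2 * s * (a \<bullet> y) / q' - (a $ i * t + a $ j * t') / q)"
  "linear (\<lambda>a::real^2. 2 * s * (a \<bullet> y) / q' - a $ j / q)"
  by (rule linearI; simp add: inner_add_left add_divide_distrib diff_divide_distrib algebra_simps)+

text \<open>A single \<open>ker2\<close> grows logarithmically. The moment conditions leave the
  errors of the expansions, with constant 19 + 2 * 100, and these do not depend on e.\<close>

lemma tps2_decay:
  assumes b: "\<beta> \<in> B_space n x" and A: "A \<ge> 1" "\<And>r. r \<in> {1..n} \<Longrightarrow> norm (x r) \<le> A" and y: "norm y \<ge> 8 * A"
  shows "\<bar>tps2 n x \<beta> e i j y\<bar> \<le> (\<Sum>r=1..n. \<bar>\<beta> r\<bar>) * (300 * A\<^sup>2) / (norm y)\<^sup>2"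
proof -
  let ?S = "\<Sum>r=1..n. \<bar>\<beta> r\<bar>"
  have S: "?S \<ge> 0" by (intro sum_nonneg) auto
  have 1: "\<bar>\<Sum>r=1..n. \<beta> r * ln (qreg e (y - x r))\<bar> \<le> ?S * (19 * A\<^sup>2 / (norm y)\<^sup>2)"
    by (rule affine_cancellation[OF b linear_component_forms(1)[of y "qreg e y"], of _ "ln (qreg e y)"])
       (use ln_expansion[OF A(2) A(1) y] in simp)
  have 2: "\<bar>\<Sum>r=1..n. \<beta> r * ((y - x r) $ i * (y - x r) $ j / qreg e (y - x r))\<bar> \<le> ?S * (100 * A\<^sup>2 / (norm y)\<^sup>2)"
    by (rule affine_cancellation[OF b
         linear_component_forms(2)[of "y $ i * y $ j" y "(qreg e y)\<^sup>2" i "y $ j" j "y $ i" "qreg e y"],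
         of _ "y $ i * y $ j / qreg e y"])
       (use quadratic_expansion[OF A(2) A(1) y] in \<open>simp add: mult.assoc\<close>)
  have b0: "(\<Sum>r=1..n. \<beta> r) = 0" using b by (simp add: B_space_def)
  have "tps2 n x \<beta> e i j y = (if i = j then \<Sum>r=1..n. \<beta> r * ln (qreg e (y - x r)) else 0)
     + 2 * (\<Sum>r=1..n. \<beta> r * ((y - x r) $ i * (y - x r) $ j / qreg e (y - x r)))"
    using b0 by (auto simp: tps2_def ker2_def distrib_left sum.distrib sum_distrib_left mult_ac)
  also have "\<bar>\<dots>\<bar> \<le> ?S * (19 * A\<^sup>2 / (norm y)\<^sup>2) + 2 * (?S * (100 * A\<^sup>2 / (norm y)\<^sup>2))"
    using 1 2 S by (auto intro!: order_trans[OF abs_triangle_ineq] add_mono simp del: times_divide_eq_right)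
  also have "\<dots> = ?S * (219 * A\<^sup>2) / (norm y)\<^sup>2" by (simp add: field_simps)
  also have "\<dots> \<le> ?S * (300 * A\<^sup>2) / (norm y)\<^sup>2" using S by (intro divide_right_mono mult_left_mono) auto
  finally show ?thesis .
qed

text \<open>A single \<open>ker3\<close> only decays like |y|^-1. Its first summand gains two orders
  by cancellation, its second has the order |y|^-3 by itself; A \<ge> 1 absorbs the resulting 32
  into 500 A^2.\<close>

lemma tps3_decay:
  assumes b: "\<beta> \<in> B_space n x" and A: "A \<ge> 1" "\<And>r. r \<in> {1..n} \<Longrightarrow> norm (x r) \<le> A" and y: "norm y \<ge> 8 * A"
    and e: "\<bar>e\<bar> \<le> 1"
  shows "\<bar>tps3 n x \<beta> e j y\<bar> \<le> (\<Sum>r=1..n. \<bar>\<beta> r\<bar>) * (500 * A\<^sup>2) / norm y ^ 3"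
proof -
  let ?S = "\<Sum>r=1..n. \<bar>\<beta> r\<bar>"
  have S: "?S \<ge> 0" by (intro sum_nonneg) auto
  have 1: "\<bar>\<Sum>r=1..n. \<beta> r * ((y - x r) $ j / qreg e (y - x r))\<bar> \<le> ?S * (100 * A\<^sup>2 / norm y ^ 3)"
    by (rule affine_cancellation[OF b
         linear_component_forms(3)[of "y $ j" y "(qreg e y)\<^sup>2" j "qreg e y"],
         of _ "y $ j / qreg e y"])
       (use linear_expansion(1)[OF A(2) A(1) y] in simp)
  have "\<bar>\<Sum>r=1..n. \<beta> r * ((y - x r) $ j / (qreg e (y - x r))\<^sup>2)\<bar> \<le> (\<Sum>r=1..n. \<bar>\<beta> r\<bar> * (8 / norm y ^ 3))"
    using linear_expansion(2)[OF A(2) A(1) y]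
    by (intro order_trans[OF sum_abs] sum_mono) (simp only: abs_mult mult_left_mono abs_ge_zero)
  then have 2: "\<bar>\<Sum>r=1..n. \<beta> r * ((y - x r) $ j / (qreg e (y - x r))\<^sup>2)\<bar> \<le> ?S * (8 / norm y ^ 3)"
    by (simp only: sum_distrib_right)
  have "e\<^sup>2 \<le> 1" using e by (simp add: abs_square_le_1)
  then have "\<bar>e\<^sup>2 * (\<Sum>r=1..n. \<beta> r * ((y - x r) $ j / (qreg e (y - x r))\<^sup>2))\<bar> \<le> 1 * (?S * (8 / norm y ^ 3))"
    unfolding abs_mult using 2 by (intro mult_mono) auto
  moreover have "tps3 n x \<beta> e j y = 4 * (\<Sum>r=1..n. \<beta> r * ((y - x r) $ j / qreg e (y - x r)))
     + 4 * (e\<^sup>2 * (\<Sum>r=1..n. \<beta> r * ((y - x r) $ j / (qreg e (y - x r))\<^sup>2)))"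
    by (simp add: tps3_def ker3_def distrib_left sum.distrib sum_distrib_left mult_ac)
  ultimately have "\<bar>tps3 n x \<beta> e j y\<bar> \<le> 4 * (?S * (100 * A\<^sup>2 / norm y ^ 3)) + 4 * (?S * (8 / norm y ^ 3))"
    using 1 by linarith
  also have "\<dots> = ?S * (400 * A\<^sup>2 + 32) / norm y ^ 3" by (simp add: algebra_simps add_divide_distrib)
  also have "\<dots> \<le> ?S * (500 * A\<^sup>2) / norm y ^ 3"
    using S one_le_power[OF A(1), of 2] by (intro divide_right_mono mult_left_mono) auto
  finally show ?thesis .
qed

section \<open>Thin-plate splines as limits of smooth splines\<close>

lemma borel_nth [measurable]: "(\<lambda>x::real^2. x $ i) \<in> borel_measurable borel"
  by (intro borel_measurable_continuous_onI continuous_on_component continuous_on_id)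

lemma qreg_borel [measurable]: "qreg e \<in> borel_measurable borel"
  by (rule smooth_borel[OF smooth_qreg])

lemma ker2_borel: "(\<lambda>y. ker2 e i j (y - a)) \<in> borel_measurable borel"
proof -
  have "(\<lambda>z. if i = j then ln (qreg e z) + 1 else 0) \<in> borel_measurable borel"
    by (cases "i = j") (auto intro!: borel_measurable_add borel_measurable_ln qreg_borel)
  then have "ker2 e i j \<in> borel_measurable borel"
    unfolding ker2_def[abs_def] by measurable
  then show ?thesis by measurable
qed

lemma tps2_borel: "tps2 n x \<beta> e i j \<in> borel_measurable borel"
  unfolding tps2_def[abs_def] by (intro borel_measurable_sum borel_measurable_times borel_measurable_const ker2_borel)

text \<open>\<open>qreg e z\<close> lies between |z|^2 and T^2 + 1, so its logarithm is controlled
  by that of |z| below 1 and by a constant above, uniformly in e.\<close>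

lemma ker2_near:
  assumes z: "z \<noteq> 0" "norm z \<le> T" and e: "\<bar>e\<bar> \<le> 1"
  shows "\<bar>ker2 e i j z\<bar> \<le> 2 * \<bar>ln (norm z)\<bar> + (ln (T\<^sup>2 + 1) + 3)"
proof -
  define q where "q = qreg e z"
  have q: "q > 0" using qreg_pos'[OF z(1)] by (simp add: q_def)
  have e2: "e\<^sup>2 \<le> 1" using e by (simp add: abs_square_le_1)
  have z2: "(norm z)\<^sup>2 \<le> T\<^sup>2" using z by (intro power_mono) auto
  have qle: "q \<le> T\<^sup>2 + 1" "q \<ge> (norm z)\<^sup>2" using z2 e2 by (auto simp: q_def qreg_def dot_square_norm)
  have T: "ln (T\<^sup>2 + 1) \<ge> 0" by simp
  have "\<bar>ln q\<bar> \<le> 2 * \<bar>ln (norm z)\<bar> + ln (T\<^sup>2 + 1)"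
  proof (cases "q \<ge> 1")
    case True
    then have "\<bar>ln q\<bar> \<le> ln (T\<^sup>2 + 1)" using qle by simp
    then show ?thesis by linarith
  next
    case False
    have "ln ((norm z)\<^sup>2) \<le> ln q" using z qle q by (intro ln_mono) auto
    then have "2 * ln (norm z) \<le> ln q" using z by (simp add: ln_realpow)
    moreover have "ln q < 0" using False q by simp
    ultimately show ?thesis using T by linarith
  qed
  moreover have "\<bar>2 * (z $ i * z $ j) / q\<bar> \<le> 2"
  proof -
    have "\<bar>z $ i * z $ j\<bar> \<le> norm z * norm z"
      unfolding abs_mult by (intro mult_mono component_le_norm_cart) auto
    then have "\<bar>z $ i * z $ j\<bar> \<le> q" using qle by (simp add: power2_eq_square)
    then show ?thesis using q by (simp add: abs_mult field_simps)
  qed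
  ultimately show ?thesis unfolding ker2_def q_def[symmetric] using T by (auto simp: abs_if split: if_splits)
qed

lemma points_bounded: "\<exists>A\<ge>1. \<forall>r\<in>{1..n}. norm ((x::nat \<Rightarrow> real^2) r) \<le> A"
proof (intro exI conjI ballI)
  show "1 + (\<Sum>r=1..n. norm (x r)) \<ge> 1" by (simp add: sum_nonneg)
  fix r assume "r \<in> {1..n}"
  then show "norm (x r) \<le> 1 + (\<Sum>r=1..n. norm (x r))"
    using member_le_sum[of r "{1..n}" "\<lambda>r. norm (x r)"] by simp
qed

text \<open>One square integrable majorant for all e in [-1, 1]: it serves both the membership in
  \<open>L2\<close> and the passage to e = 0. Far out it is the decay bound, near the centres a sum
  of logarithms. The centres are excluded because \<open>ker2 e i i\<close> at 0 is unbounded as e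
  tends to 0.\<close>

lemma tps2_dominated:
  assumes b: "\<beta> \<in> B_space n x"
  shows "\<exists>D\<in>L2. (\<forall>y. 0 \<le> D y) \<and>
    (\<forall>e i j y. \<bar>e\<bar> \<le> 1 \<longrightarrow> y \<notin> x ` {1..n} \<longrightarrow> \<bar>tps2 n x \<beta> e i j y\<bar> \<le> D y)"
proof -
  obtain A where A: "A \<ge> 1" "\<And>r. r \<in> {1..n} \<Longrightarrow> norm (x r) \<le> A" using points_bounded by blast
  define S where "S = (\<Sum>r=1..n. \<bar>\<beta> r\<bar>)"
  define \<rho> where "\<rho> = 8 * A"
  define M where "M = ln ((\<rho> + A)\<^sup>2 + 1) + 3"
  have M: "M \<ge> 0" unfolding M_def by (intro add_nonneg_nonneg ln_ge_zero) auto
  have S: "S \<ge> 0" unfolding S_def by (intro sum_nonneg) auto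
  define D where "D y = S * (300 * A\<^sup>2) * (if norm y \<ge> \<rho> then 1 / (norm y)\<^sup>2 else 0)
    + (\<Sum>r=1..n. \<bar>\<beta> r\<bar> * (2 * (indicator (cball 0 \<rho>) y * \<bar>ln (norm (y - x r))\<bar>) + M * indicator (cball 0 \<rho>) y))" for y
  have "D \<in> L2" unfolding D_def[abs_def]
    by (intro L2_add L2_cmult L2_sum L2_tail L2_log L2_indicator_cball) (use A in \<open>auto simp: \<rho>_def\<close>)
  moreover have far: "0 \<le> (\<Sum>r=1..n. \<bar>\<beta> r\<bar> * (2 * (indicator (cball 0 \<rho>) y * \<bar>ln (norm (y - x r))\<bar>) + M * indicator (cball 0 \<rho>) y))" for y
    using M by (intro sum_nonneg mult_nonneg_nonneg add_nonneg_nonneg) auto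
  moreover have near: "0 \<le> S * (300 * A\<^sup>2) * (if norm y \<ge> \<rho> then 1 / (norm y)\<^sup>2 else 0)" for y :: "real^2"
    using S by (intro mult_nonneg_nonneg) auto
  moreover have "\<bar>tps2 n x \<beta> e i j y\<bar> \<le> D y" if e: "\<bar>e\<bar> \<le> 1" and y: "y \<notin> x ` {1..n}" for e i j y
  proof (cases "norm y \<ge> \<rho>")
    case True
    then have "\<bar>tps2 n x \<beta> e i j y\<bar> \<le> S * (300 * A\<^sup>2) * (if norm y \<ge> \<rho> then 1 / (norm y)\<^sup>2 else 0)"
      using tps2_decay[OF b A] by (simp add: S_def \<rho>_def)
    then show ?thesis using far[of y] by (simp add: D_def del: mult_if_delta)
  next
    case False
    have "\<bar>\<beta> r * ker2 e i j (y - x r)\<bar> \<le> \<bar>\<beta> r\<bar> * (2 * (indicator (cball 0 \<rho>) y * \<bar>ln (norm (y - x r))\<bar>) + M * indicator (cball 0 \<rho>) y)"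
      if r: "r \<in> {1..n}" for r
    proof -
      have "norm (y - x r) \<le> \<rho> + A" using False A(2)[OF r] norm_triangle_ineq4[of y "x r"] by linarith
      moreover have "y - x r \<noteq> 0" using y r by auto
      ultimately have "\<bar>ker2 e i j (y - x r)\<bar> \<le> 2 * \<bar>ln (norm (y - x r))\<bar> + M"
        unfolding M_def by (intro ker2_near e)
      then show ?thesis using False by (simp add: abs_mult mult_left_mono)
    qed
    then have "\<bar>tps2 n x \<beta> e i j y\<bar> \<le> (\<Sum>r=1..n. \<bar>\<beta> r\<bar> * (2 * (indicator (cball 0 \<rho>) y * \<bar>ln (norm (y - x r))\<bar>) + M * indicator (cball 0 \<rho>) y))"
      unfolding tps2_def by (intro order_trans[OF sum_abs] sum_mono)
    then show ?thesis using near[of y] unfolding D_def by linarith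
  qed
  moreover have "0 \<le> D y" for y unfolding D_def using far near by (rule add_nonneg_nonneg[rotated])
  ultimately show ?thesis by blast
qed

lemma qreg_tendsto: "e \<longlonglongrightarrow> 0 \<Longrightarrow> (\<lambda>k. qreg (e k) z) \<longlonglongrightarrow> qreg 0 z"
  unfolding qreg_def by (intro tendsto_intros)

lemma tps2_tendsto:
  assumes e: "e \<longlonglongrightarrow> 0" and y: "y \<notin> x ` {1..n}"
  shows "(\<lambda>k. tps2 n x \<beta> (e k) i j y) \<longlonglongrightarrow> tps2 n x \<beta> 0 i j y"
  unfolding tps2_def
proof (intro tendsto_intros)
  fix r assume "r \<in> {1..n}"
  then have "y - x r \<noteq> 0" using y by auto
  then have "qreg 0 (y - x r) \<noteq> 0" using qreg_pos'[of "y - x r" 0] by simp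
  then show "(\<lambda>k. ker2 (e k) i j (y - x r)) \<longlonglongrightarrow> ker2 0 i j (y - x r)"
    unfolding ker2_def by (cases "i = j") (auto intro!: tendsto_intros qreg_tendsto e)
qed

lemma AE_not_points: "AE y in lebesgue. y \<notin> x ` {1..n::nat}"
proof -
  have "finite (x ` {1..n})" by simp
  then have "negligible (x ` {1..n})" by (rule negligible_finite)
  then show ?thesis using AE_not_in[of "x ` {1..n}" lebesgue] by (simp add: negligible_iff_null_sets)
qed

lemma tps2_L2:
  assumes b: "\<beta> \<in> B_space n x" and e: "\<bar>e\<bar> \<le> 1"
  shows "tps2 n x \<beta> e i j \<in> L2"
proof -
  obtain D where D: "D \<in> L2" "\<And>y. 0 \<le> D y" "\<And>e i j y. \<bar>e\<bar> \<le> 1 \<Longrightarrow> y \<notin> x ` {1..n} \<Longrightarrow> \<bar>tps2 n x \<beta> e i j y\<bar> \<le> D y"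
    using tps2_dominated[OF b] by blast
  show ?thesis
  proof (rule L2_bound[OF D(1)])
    show "AE y in lebesgue. \<bar>tps2 n x \<beta> e i j y\<bar> \<le> \<bar>D y\<bar>"
      using AE_not_points[of x n] by eventually_elim (use D(2,3) e in force)
  qed (use tps2_borel in \<open>auto intro: measurable_completion\<close>)
qed

definition eps :: "nat \<Rightarrow> real" where "eps k = inverse (real (Suc k))"

lemma eps_null_sequence: "eps k > 0" "eps k \<noteq> 0" "\<bar>eps k\<bar> \<le> 1" "eps \<longlonglongrightarrow> 0"
  using LIMSEQ_inverse_real_of_nat by (auto simp: eps_def[abs_def] field_simps)

text \<open>From ln s \<le> s - 1 at s = q and at s = 1 / q. It yields a polynomial majorant of
  \<open>ker0\<close>, uniform in e, and the continuity of \<open>K\<close> at 0.\<close>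

lemma abs_mult_ln_bound: "q > 0 \<Longrightarrow> \<bar>q * ln q\<bar> \<le> 1 + q\<^sup>2" for q :: real
proof -
  assume q: "q > 0"
  have 1: "q * ln q \<le> q * (q - 1)" using q ln_le_minus_one by (intro mult_left_mono) auto
  have "q * ln (1 / q) \<le> q * (1 / q - 1)" using q by (intro mult_left_mono ln_le_minus_one) auto
  moreover have "q * (1 / q - 1) = 1 - q" "q * ln (1 / q) = - (q * ln q)"
    using q by (auto simp: right_diff_distrib ln_div)
  ultimately have 2: "- (q * ln q) \<le> 1 - q" by simp
  have "q * q - q \<le> 1 + q\<^sup>2" "1 - q \<le> 1 + q\<^sup>2" using q mult_pos_pos[OF q q] unfolding power2_eq_square by linarith+
  then show ?thesis using 1 2 unfolding abs_le_iff right_diff_distrib by simp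
qed

definition tps0 :: "nat \<Rightarrow> (nat \<Rightarrow> real^2) \<Rightarrow> (nat \<Rightarrow> real) \<Rightarrow> real^2 \<Rightarrow> real \<Rightarrow> real \<Rightarrow> real^2 \<Rightarrow> real" where
  "tps0 n x \<beta> \<alpha>1 \<alpha>0 e y = (\<Sum>r=1..n. \<beta> r * ker0 e (y - x r)) + \<alpha>1 \<bullet> y + \<alpha>0"

lemma smooth_inner: "smooth (\<lambda>y. a \<bullet> y)"
  unfolding inner_vec_def by (auto intro!: smooth_sum smooth_mult smooth_nth smooth_const)

lemma partial_inner: "partial i (\<lambda>y. a \<bullet> y) y = a $ i"
proof -
  have "((\<lambda>y. a \<bullet> y) has_derivative (\<lambda>h. a \<bullet> h)) (at y)" by (auto intro!: derivative_eq_intros)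
  from partial_eq[OF this] show ?thesis by (simp add: inner_axis)
qed

lemma smooth_weighted_shifts:
  assumes "smooth k"
  shows "smooth (\<lambda>y. \<Sum>r=1..n. \<beta> r * k (y - x r))"
  by (rule smooth_sum, rule smooth_cmult, rule smooth_shift[OF assms])

lemma smooth_tps0: "e \<noteq> 0 \<Longrightarrow> smooth (tps0 n x \<beta> \<alpha>1 \<alpha>0 e)"
  unfolding tps0_def[abs_def]
  by (rule smooth_add, rule smooth_add, rule smooth_weighted_shifts[OF smooth_ker(1)])
     (auto intro: smooth_inner smooth_const)

lemma smooth_tps2: "e \<noteq> 0 \<Longrightarrow> smooth (tps2 n x \<beta> e i j)"
  unfolding tps2_def[abs_def] by (rule smooth_weighted_shifts[OF smooth_ker(3)])

lemma smooth_tps4: "e \<noteq> 0 \<Longrightarrow> smooth (tps4 n x \<beta> e)"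
  unfolding tps4_def[abs_def] by (rule smooth_weighted_shifts[OF smooth_ker(5)])

lemma partial_weighted_shifts:
  assumes "smooth k"
  shows "partial i (\<lambda>y. \<Sum>r=1..n. \<beta> r * k (y - x r)) y = (\<Sum>r=1..n. \<beta> r * partial i k (y - x r))"
proof -
  have "smooth (\<lambda>y. k (y - x r))" for r using assms by (rule smooth_shift)
  then show ?thesis
    using assms smooth_cmult smoothD(1) by (simp add: partial_sum partial_cmult partial_shift)
qed

lemma partial_tps0:
  assumes e: "e \<noteq> 0"
  shows "partial i (partial j (tps0 n x \<beta> \<alpha>1 \<alpha>0 e)) = tps2 n x \<beta> e i j"
proof -
  have s: "smooth (\<lambda>y. \<Sum>r=1..n. \<beta> r * k (y - x r))" if "smooth k" for k
    using that by (rule smooth_weighted_shifts)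
  have "partial j (tps0 n x \<beta> \<alpha>1 \<alpha>0 e) = (\<lambda>y. (\<Sum>r=1..n. \<beta> r * ker1 e j (y - x r)) + \<alpha>1 $ j)"
  proof
    fix y
    have "partial j (\<lambda>y. ((\<Sum>r=1..n. \<beta> r * ker0 e (y - x r)) + \<alpha>1 \<bullet> y) + \<alpha>0) y
      = partial j (\<lambda>y. \<Sum>r=1..n. \<beta> r * ker0 e (y - x r)) y + partial j (\<lambda>y. \<alpha>1 \<bullet> y) y + 0"
      using s[OF smooth_ker(1)[OF e]] smooth_inner[of \<alpha>1] smooth_const[of \<alpha>0]
      by (simp add: partial_add partial_const smoothD(1) smooth_add)
    also have "\<dots> = (\<Sum>r=1..n. \<beta> r * ker1 e j (y - x r)) + \<alpha>1 $ j"
      unfolding partial_weighted_shifts[OF smooth_ker(1)[OF e]] partial_inner partial_ker0[OF e] by simp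
    finally show "partial j (tps0 n x \<beta> \<alpha>1 \<alpha>0 e) y = (\<Sum>r=1..n. \<beta> r * ker1 e j (y - x r)) + \<alpha>1 $ j"
      unfolding tps0_def[abs_def] .
  qed
  moreover have "partial i (\<lambda>y. (\<Sum>r=1..n. \<beta> r * ker1 e j (y - x r)) + \<alpha>1 $ j) y = tps2 n x \<beta> e i j y" for y
  proof -
    have "partial i (\<lambda>y. (\<Sum>r=1..n. \<beta> r * ker1 e j (y - x r)) + \<alpha>1 $ j) y =
      partial i (\<lambda>y. \<Sum>r=1..n. \<beta> r * ker1 e j (y - x r)) y + 0"
      using s[OF smooth_ker(2)[OF e]] smooth_const[of "\<alpha>1 $ j"]
      by (simp add: partial_add partial_const smoothD(1))
    also have "\<dots> = tps2 n x \<beta> e i j y"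
      unfolding partial_weighted_shifts[OF smooth_ker(2)[OF e]] partial_ker1[OF e] tps2_def by simp
    finally show ?thesis .
  qed
  ultimately show ?thesis by auto
qed

lemma tps0_tendsto:
  assumes e: "e \<longlonglongrightarrow> 0" and y: "y \<notin> x ` {1..n}"
  shows "(\<lambda>k. tps0 n x \<beta> \<alpha>1 \<alpha>0 (e k) y) \<longlonglongrightarrow> tps0 n x \<beta> \<alpha>1 \<alpha>0 0 y"
  unfolding tps0_def
proof (intro tendsto_intros)
  fix r assume "r \<in> {1..n}"
  then have "y - x r \<noteq> 0" using y by auto
  then have "qreg 0 (y - x r) \<noteq> 0" using qreg_pos'[of "y - x r" 0] by simp
  then show "(\<lambda>k. ker0 (e k) (y - x r)) \<longlonglongrightarrow> ker0 0 (y - x r)"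
    unfolding ker0_def by (auto intro!: tendsto_intros qreg_tendsto e)
qed

lemma ker0_bound:
  assumes "\<bar>e\<bar> \<le> 1"
  shows "\<bar>ker0 e z\<bar> \<le> 1 + (z \<bullet> z + 1)\<^sup>2"
proof (cases "qreg e z > 0")
  case True
  have e2: "e\<^sup>2 \<le> 1" using assms by (simp add: abs_square_le_1)
  have "\<bar>ker0 e z\<bar> \<le> \<bar>qreg e z * ln (qreg e z)\<bar>" by (simp add: ker0_def)
  also have "\<dots> \<le> 1 + (qreg e z)\<^sup>2" using abs_mult_ln_bound[OF True] .
  also have "\<dots> \<le> 1 + (z \<bullet> z + 1)\<^sup>2" using True e2 by (intro add_left_mono power_mono) (auto simp: qreg_def)
  finally show ?thesis .
next
  case False
  then have "qreg e z = 0" by (simp add: qreg_def not_less) (smt (verit) inner_ge_zero zero_le_power2)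
  then show ?thesis by (simp add: ker0_def)
qed

lemma continuous_K: "continuous_on UNIV (\<lambda>z::real^2. K (norm z))"
proof -
  have "isCont K \<rho>" for \<rho>
  proof (cases "\<rho> = 0")
    case False then show ?thesis unfolding K_def[abs_def] by (intro continuous_intros) auto
  next
    case True
    have "(K \<longlongrightarrow> 0) (at 0)"
    proof (rule Lim_null_comparison)
      have "\<bar>K \<rho>\<bar> \<le> \<bar>\<rho>\<bar> * (1 + \<rho>\<^sup>2)" for \<rho>
      proof (cases "\<rho> = 0")
        case False
        \<comment> \<open>On the reals \<open>ln\<close> is even, so the bound covers negative
          arguments too.\<close>
        have lnabs: "ln \<bar>\<rho>\<bar> = ln \<rho>" by (simp add: abs_if ln_minus)
        have "\<bar>K \<rho>\<bar> = \<bar>\<rho>\<bar> * \<bar>\<bar>\<rho>\<bar> * ln \<bar>\<rho>\<bar>\<bar>" by (simp add: K_def abs_mult power2_eq_square lnabs)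
        also have "\<dots> \<le> \<bar>\<rho>\<bar> * (1 + \<bar>\<rho>\<bar>\<^sup>2)" using False by (intro mult_left_mono abs_mult_ln_bound) auto
        finally show ?thesis by simp
      qed (simp add: K_def)
      then show "\<forall>\<^sub>F \<rho> in at 0. norm (K \<rho>) \<le> \<bar>\<rho>\<bar> * (1 + \<rho>\<^sup>2)" by simp
      have "((\<lambda>\<rho>::real. \<bar>\<rho>\<bar> * (1 + \<rho>\<^sup>2)) \<longlongrightarrow> \<bar>0\<bar> * (1 + 0\<^sup>2)) (at 0)" by (intro tendsto_intros)
      then show "((\<lambda>\<rho>::real. \<bar>\<rho>\<bar> * (1 + \<rho>\<^sup>2)) \<longlongrightarrow> 0) (at 0)" by simp
    qed
    then show ?thesis using True by (simp add: isCont_def K_def)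
  qed
  then have "continuous_on UNIV K" by (simp add: continuous_on_eq_continuous_at)
  then show ?thesis by (rule continuous_on_compose2) (auto intro: continuous_intros)
qed

lemma continuous_tps: "continuous_on UNIV (tps0 n x \<beta> \<alpha>1 \<alpha>0 0)"
  unfolding tps0_def[abs_def] ker0_eq_K
  by (intro continuous_intros continuous_on_compose2[OF continuous_K]) auto

text \<open>For e > 0 the spline is smooth and the identity is integration by parts; both sides
  converge as e tends to 0.\<close>

lemma tps_has_L2_hessian:
  assumes b: "\<beta> \<in> B_space n x"
  shows "has_L2_hessian (tps0 n x \<beta> \<alpha>1 \<alpha>0 0) (\<lambda>y. \<chi> i j. tps2 n x \<beta> 0 i j y)"
  unfolding has_L2_hessian_def
proof (intro allI conjI ballI)
  fix i j
  show "(\<lambda>y. (\<chi> i j. tps2 n x \<beta> 0 i j y) $ i $ j) \<in> L2" using tps2_L2[OF b, of 0 i j] by simp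
  fix \<phi> assume p: "\<phi> \<in> test_functions"
  have pp: "partial i (partial j \<phi>) \<in> test_functions" using p by (intro test_partial)
  obtain D where D: "D \<in> L2" "\<And>y. 0 \<le> D y" "\<And>e i j y. \<bar>e\<bar> \<le> 1 \<Longrightarrow> y \<notin> x ` {1..n} \<Longrightarrow> \<bar>tps2 n x \<beta> e i j y\<bar> \<le> D y"
    using tps2_dominated[OF b] by blast
  \<comment> \<open>The indices of \<open>tps2\<close> come out reversed; the symmetry of
    \<open>ker2\<close> restores them at the end.\<close>
  have eq: "(LINT y|lebesgue. tps0 n x \<beta> \<alpha>1 \<alpha>0 (eps k) y * partial i (partial j \<phi>) y)
     = (LINT y|lebesgue. tps2 n x \<beta> (eps k) j i y * \<phi> y)" for k
  proof -
    have m: "(\<lambda>y. tps0 n x \<beta> \<alpha>1 \<alpha>0 (eps k) y * partial i (partial j \<phi>) y) \<in> borel_measurable borel"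
      by (intro smooth_borel smooth_mult smooth_tps0 eps_null_sequence test_functionsD(1)[OF pp])
    have m': "(\<lambda>y. tps2 n x \<beta> (eps k) j i y * \<phi> y) \<in> borel_measurable borel"
      by (intro smooth_borel smooth_mult smooth_tps2 eps_null_sequence test_functionsD(1)[OF p])
    show ?thesis
      using integration_by_parts_2[OF smooth_tps0[OF eps_null_sequence(2)] p, of n x \<beta> \<alpha>1 \<alpha>0 k i j]
      by (simp add: lebesgue_eq_lborel[OF m] lebesgue_eq_lborel[OF m'] partial_tps0[OF eps_null_sequence(2)])
  qed
  have "(\<lambda>k. LINT y|lebesgue. tps0 n x \<beta> \<alpha>1 \<alpha>0 (eps k) y * partial i (partial j \<phi>) y)
     \<longlonglongrightarrow> (LINT y|lebesgue. tps0 n x \<beta> \<alpha>1 \<alpha>0 0 y * partial i (partial j \<phi>) y)"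
  proof (rule integral_dominated_convergence)
    \<comment> \<open>A continuous majorant from \<open>ker0_bound\<close>; its growth does no harm
      against a test function.\<close>
    let ?g = "\<lambda>y. (\<Sum>r=1..n. \<bar>\<beta> r\<bar> * (1 + ((y - x r) \<bullet> (y - x r) + 1)\<^sup>2)) + (\<bar>\<alpha>1 \<bullet> y\<bar> + \<bar>\<alpha>0\<bar>)"
    have c: "continuous_on UNIV ?g" by (intro continuous_intros)
    have i: "integrable lborel (\<lambda>y. ?g y * partial i (partial j \<phi>) y)"
      by (rule cont_test_integrable[OF c pp])
    then have "(\<lambda>y. ?g y * partial i (partial j \<phi>) y) \<in> borel_measurable borel" by simp
    then have "integrable lebesgue (\<lambda>y. ?g y * partial i (partial j \<phi>) y)"
      using lebesgue_eq_lborel(2) i by blast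
    then show "integrable lebesgue (\<lambda>y. norm (?g y * partial i (partial j \<phi>) y))" by (rule integrable_norm)
    show "AE y in lebesgue. (\<lambda>k. tps0 n x \<beta> \<alpha>1 \<alpha>0 (eps k) y * partial i (partial j \<phi>) y)
        \<longlonglongrightarrow> tps0 n x \<beta> \<alpha>1 \<alpha>0 0 y * partial i (partial j \<phi>) y"
      using AE_not_points[of x n] by eventually_elim (intro tendsto_intros tps0_tendsto eps_null_sequence)
    have "\<bar>tps0 n x \<beta> \<alpha>1 \<alpha>0 (eps k) y\<bar> \<le> \<bar>?g y\<bar>" for k y
    proof -
      have "\<bar>\<Sum>r=1..n. \<beta> r * ker0 (eps k) (y - x r)\<bar> \<le> (\<Sum>r=1..n. \<bar>\<beta> r\<bar> * (1 + ((y - x r) \<bullet> (y - x r) + 1)\<^sup>2))"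
        by (intro order_trans[OF sum_abs] sum_mono) (simp only: abs_mult mult_left_mono abs_ge_zero ker0_bound eps_null_sequence)
      then show ?thesis unfolding tps0_def by linarith
    qed
    then show "AE y in lebesgue. norm (tps0 n x \<beta> \<alpha>1 \<alpha>0 (eps k) y * partial i (partial j \<phi>) y)
        \<le> norm (?g y * partial i (partial j \<phi>) y)" for k
      unfolding real_norm_def abs_mult by (intro AE_I2 mult_right_mono) auto
    show "(\<lambda>y. tps0 n x \<beta> \<alpha>1 \<alpha>0 0 y * partial i (partial j \<phi>) y) \<in> borel_measurable lebesgue"
      using continuous_tps smoothD(3)[OF test_functionsD(1)[OF pp]]
      by (intro measurable_completion[of _ lborel]) (auto intro!: borel_measurable_continuous_onI continuous_intros)
    show "(\<lambda>y. tps0 n x \<beta> \<alpha>1 \<alpha>0 (eps k) y * partial i (partial j \<phi>) y) \<in> borel_measurable lebesgue" for k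
      using smooth_borel[OF smooth_mult[OF smooth_tps0[OF eps_null_sequence(2)] test_functionsD(1)[OF pp]]]
      by (auto intro: measurable_completion)
  qed
  moreover have "(\<lambda>k. LINT y|lebesgue. tps2 n x \<beta> (eps k) j i y * \<phi> y)
     \<longlonglongrightarrow> (LINT y|lebesgue. tps2 n x \<beta> 0 j i y * \<phi> y)"
  proof (rule integral_dominated_convergence)
    show "integrable lebesgue (\<lambda>y. norm (D y * \<phi> y))"
      by (intro integrable_norm L2_mult_integrable D test_L2 p)
    show "AE y in lebesgue. (\<lambda>k. tps2 n x \<beta> (eps k) j i y * \<phi> y) \<longlonglongrightarrow> tps2 n x \<beta> 0 j i y * \<phi> y"
      using AE_not_points[of x n] by eventually_elim (intro tendsto_intros tps2_tendsto eps_null_sequence)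
    show "AE y in lebesgue. norm (tps2 n x \<beta> (eps k) j i y * \<phi> y) \<le> norm (D y * \<phi> y)" for k
      using AE_not_points[of x n]
      by eventually_elim (use D(2,3) eps_null_sequence(3) in \<open>auto simp: abs_mult intro!: mult_right_mono\<close>)
    show "(\<lambda>y. tps2 n x \<beta> (eps k) j i y * \<phi> y) \<in> borel_measurable lebesgue" for k
      by (intro borel_measurable_times L2_D(1) tps2_L2 b eps_null_sequence test_L2 p)
    show "(\<lambda>y. tps2 n x \<beta> 0 j i y * \<phi> y) \<in> borel_measurable lebesgue"
      by (intro borel_measurable_times L2_D(1) tps2_L2 b test_L2 p) simp
  qed
  ultimately have "(LINT y|lebesgue. tps0 n x \<beta> \<alpha>1 \<alpha>0 0 y * partial i (partial j \<phi>) y)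
    = (LINT y|lebesgue. tps2 n x \<beta> 0 j i y * \<phi> y)"
    unfolding eq by (rule LIMSEQ_unique)
  then show "(LINT y|lebesgue. tps0 n x \<beta> \<alpha>1 \<alpha>0 0 y * partial i (partial j \<phi>) y)
    = (LINT y|lebesgue. (\<chi> i j. tps2 n x \<beta> 0 i j y) $ i $ j * \<phi> y)"
    by (simp add: tps2_def ker2_commute[of 0 j i])
qed

text \<open>The strength of the point sources, equal to 8 \<pi>. What counts is that it is
  positive.\<close>

definition ker4_mass :: real where
  "ker4_mass = (LINT z|lborel. ker4 1 z)"

lemma integrable_ker4: "integrable lborel (ker4 1)"
proof (rule Bochner_Integration.integrable_bound)
  show "integrable lborel (\<lambda>z::real^2. 16 * tail3 z + 16 * indicator (cball 0 1) z)"
    using integrable_tail3 emeasure_bounded_finite[OF bounded_cball, of "0::real^2" 1]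
    by (intro Bochner_Integration.integrable_add Bochner_Integration.integrable_mult_right) (auto intro!: integrable_real_indicator)
  show "ker4 1 \<in> borel_measurable lborel" using smooth_borel smooth_ker(5)[of 1] by simp
  have "\<bar>ker4 1 z\<bar> \<le> 16 * tail3 z + 16 * indicator (cball 0 1) z" for z
  proof (cases "norm z \<ge> 1")
    case True
    have "norm z ^ 3 \<le> (norm z ^ 2) ^ 3" using True by (intro power_mono self_le_power) auto
    also have "\<dots> \<le> (qreg 1 z) ^ 3" by (intro power_mono) (auto simp: qreg_def dot_square_norm)
    finally have *: "norm z ^ 3 \<le> (qreg 1 z) ^ 3" .
    have z0: "0 < norm z ^ 3" using True by (intro zero_less_power) linarith
    have "16 / (qreg 1 z) ^ 3 \<le> 16 / norm z ^ 3" using * z0 by (intro divide_left_mono mult_pos_pos) linarith+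
    moreover have "0 \<le> 16 / (qreg 1 z) ^ 3" using qreg_pos[of 1 z] by simp
    ultimately have "\<bar>ker4 1 z\<bar> \<le> 16 * tail3 z" using True by (simp add: ker4_def tail3_def)
    then show ?thesis by (simp add: add_increasing2)
  next
    case False
    have "1 \<le> qreg 1 z" by (simp add: qreg_def)
    then have "1 \<le> (qreg 1 z) ^ 3" by simp
    then have "\<bar>ker4 1 z\<bar> \<le> 16" using frac_bound[of 16 16 1 "(qreg 1 z) ^ 3"] by (simp add: ker4_def)
    then show ?thesis using False by (simp add: tail3_def)
  qed
  then show "AE z in lborel. norm (ker4 1 z) \<le> norm (16 * tail3 z + 16 * indicator (cball 0 1) z)"
    by (intro AE_I2) (auto intro: order_trans[OF _ abs_ge_self])
qed

lemma ker4_mass_pos: "ker4_mass > 0"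
proof -
  have pos: "ker4 1 z > 0" for z using qreg_pos[of 1 z] by (simp add: ker4_def)
  then have nn: "AE z in lborel. 0 \<le> ker4 1 z" by (simp add: less_imp_le)
  then have "ker4_mass \<ge> 0" unfolding ker4_mass_def by (rule integral_nonneg_AE)
  moreover have "ker4_mass \<noteq> 0"
  proof
    assume "ker4_mass = 0"
    then have "AE z::real^2 in lborel. ker4 1 z = 0"
      using integral_nonneg_eq_0_iff_AE[OF integrable_ker4 nn] by (simp add: ker4_mass_def)
    then have "AE z::real^2 in lborel. False"
      by eventually_elim (use pos in \<open>simp add: less_imp_neq[THEN not_sym]\<close>)
    then have "ae_filter (lborel :: (real^2) measure) = bot" by (simp add: trivial_limit_def)
    then show False by (simp add: ae_filter_eq_bot_iff)
  qed
  ultimately show ?thesis by simp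
qed

lemma lborel_scaling:
  fixes f :: "real^2 \<Rightarrow> real"
  assumes f: "f \<in> borel_measurable borel" and c: "c > 0"
  shows "(LINT y|lborel. f y) = (LINT y|lborel. c\<^sup>2 * f (a + c *\<^sub>R y))"
proof -
  have "(LINT y|lborel. f y) = (LINT y|density (distr lborel borel (\<lambda>y. a + c *\<^sub>R y)) (\<lambda>_. \<bar>c\<bar> ^ DIM(real^2)). f y)"
    using lborel_affine[of c a] c by simp
  also have "\<dots> = (LINT y|distr lborel borel (\<lambda>y. a + c *\<^sub>R y). c\<^sup>2 *\<^sub>R f y)"
    using f c by (subst integral_density) (auto simp: power_abs)
  also have "\<dots> = (LINT y|lborel. c\<^sup>2 *\<^sub>R f (a + c *\<^sub>R y))"
    using f by (subst integral_distr) auto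
  finally show ?thesis by simp
qed

lemma ker4_scaling: "e > 0 \<Longrightarrow> e\<^sup>2 * ker4 e (e *\<^sub>R z) = ker4 1 z"
proof -
  assume e: "e > 0"
  have "qreg e (e *\<^sub>R z) = e\<^sup>2 * qreg 1 z" by (simp add: qreg_def power2_eq_square algebra_simps)
  then show ?thesis using e qreg_pos[of 1 z]
    by (simp add: ker4_def power_mult_distrib field_simps flip: power_mult power_add)
qed

text \<open>The substitution y = a + e z turns the kernel of width e into the fixed integrable
  function \<open>ker4 1\<close>, and h (a + e z) tends to h a boundedly.\<close>

lemma ker4_approximate_identity:
  fixes h :: "real^2 \<Rightarrow> real"
  assumes h: "continuous_on UNIV h" "\<And>y. \<bar>h y\<bar> \<le> M"
  shows "(\<lambda>k. LINT y|lborel. h y * ker4 (eps k) (y - a)) \<longlonglongrightarrow> ker4_mass * h a"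
proof -
  have hb: "h \<in> borel_measurable borel" using h(1) by (rule borel_measurable_continuous_onI)
  have k1: "ker4 1 \<in> borel_measurable borel" using smooth_borel smooth_ker(5)[of 1] by simp
  have "(LINT y|lborel. h y * ker4 (eps k) (y - a)) = (LINT y|lborel. h (a + eps k *\<^sub>R y) * ker4 1 y)" for k
  proof -
    have "(\<lambda>y. ker4 (eps k) (y - a)) \<in> borel_measurable borel"
      by (rule smooth_borel, rule smooth_shift, rule smooth_ker, rule eps_null_sequence)
    then have "(\<lambda>y. h y * ker4 (eps k) (y - a)) \<in> borel_measurable borel" using hb by measurable
    from lborel_scaling[OF this eps_null_sequence(1)[of k], of a]
    have "(LINT y|lborel. h y * ker4 (eps k) (y - a)) =
      (LINT y|lborel. (eps k)\<^sup>2 * (h (a + eps k *\<^sub>R y) * ker4 (eps k) (a + eps k *\<^sub>R y - a)))" .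
    also have "\<dots> = (LINT y|lborel. h (a + eps k *\<^sub>R y) * ker4 1 y)"
      by (rule Bochner_Integration.integral_cong) (use ker4_scaling[OF eps_null_sequence(1)] in \<open>simp_all add: mult_ac\<close>)
    finally show ?thesis .
  qed
  moreover have "(\<lambda>k. LINT y|lborel. h (a + eps k *\<^sub>R y) * ker4 1 y) \<longlonglongrightarrow> (LINT y|lborel. h a * ker4 1 y)"
  proof (rule integral_dominated_convergence)
    show "integrable lborel (\<lambda>y. norm (M * ker4 1 y))"
      using integrable_ker4 by (intro integrable_norm Bochner_Integration.integrable_mult_right)
    have "(\<lambda>k. h (a + eps k *\<^sub>R y)) \<longlonglongrightarrow> h a" for y
    proof (rule continuous_on_tendsto_compose[OF h(1)])
      have "(\<lambda>k. a + eps k *\<^sub>R y) \<longlonglongrightarrow> a + 0 *\<^sub>R y" by (intro tendsto_intros eps_null_sequence)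
      then show "(\<lambda>k. a + eps k *\<^sub>R y) \<longlonglongrightarrow> a" by simp
    qed auto
    then show "AE y in lborel. (\<lambda>k. h (a + eps k *\<^sub>R y) * ker4 1 y) \<longlonglongrightarrow> h a * ker4 1 y"
      by (intro AE_I2 tendsto_intros)
    have M: "\<bar>h y\<bar> \<le> \<bar>M\<bar>" for y using h(2)[of y] by linarith
    show "AE y in lborel. norm (h (a + eps k *\<^sub>R y) * ker4 1 y) \<le> norm (M * ker4 1 y)" for k
      unfolding real_norm_def abs_mult by (intro AE_I2 mult_right_mono M) auto
    show "(\<lambda>y. h (a + eps k *\<^sub>R y) * ker4 1 y) \<in> borel_measurable lborel" for k using hb k1 by measurable
    show "(\<lambda>y. h a * ker4 1 y) \<in> borel_measurable lborel" using k1 by measurable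
  qed
  ultimately show ?thesis using integrable_ker4 by (simp add: ker4_mass_def mult.commute)
qed

section \<open>Inverting the double divergence along rays\<close>

lemma integrable_lborel_lebesgue:
  fixes f :: "real^2 \<Rightarrow> real"
  assumes "integrable lborel f"
  shows "integrable lebesgue f"
proof -
  have "f \<in> borel_measurable borel" using borel_measurable_integrable[OF assms] by simp
  from lebesgue_eq_lborel(2)[OF this] assms show ?thesis by simp
qed

text \<open>The Euler operator, which differentiates along rays: t times the t-derivative of u (t y)
  is \<open>dil u (t *\<^sub>R y)\<close>.\<close>

definition dil :: "(real^2 \<Rightarrow> real) \<Rightarrow> real^2 \<Rightarrow> real" where
  "dil u y = (\<Sum>i\<in>UNIV. y $ i * partial i u y)"

lemma smooth_dil: "smooth u \<Longrightarrow> smooth (dil u)"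
  unfolding dil_def[abs_def] by (intro smooth_sum smooth_mult smooth_nth smoothD(2))

lemma dil_mult: "smooth u \<Longrightarrow> smooth v \<Longrightarrow> dil (\<lambda>y. u y * v y) y = u y * dil v y + dil u y * v y"
  by (simp add: dil_def partial_mult smoothD(1) distrib_left sum.distrib sum_distrib_left sum_distrib_right mult_ac)

lemma dil_add: "smooth u \<Longrightarrow> smooth v \<Longrightarrow> dil (\<lambda>y. u y + v y) y = dil u y + dil v y"
  by (simp add: dil_def partial_add smoothD(1) distrib_left sum.distrib)

lemma dil_open_cong:
  assumes "open S" "y \<in> S" "\<And>z. z \<in> S \<Longrightarrow> u z = v z"
  shows "dil u y = dil v y"
  unfolding dil_def using partial_open_cong[OF assms] by (intro sum.cong) auto

lemma dil_const: "dil (\<lambda>y. c) y = 0"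
  by (simp add: dil_def partial_const)

lemma divergence_radial:
  assumes "smooth P"
  shows "(\<Sum>i\<in>UNIV. partial i (\<lambda>y. y $ i * P y) y) = 2 * P y + dil P y"
proof -
  have "partial i (\<lambda>y. y $ i * P y) y = y $ i * partial i P y + P y" for i
    using smoothD(1)[OF smooth_nth] smoothD(1)[OF assms] by (simp add: partial_mult partial_nth)
  then show ?thesis by (simp add: dil_def sum.distrib)
qed

text \<open>One divergence produces the radial field with components y_i (3 \<kappa> + dil
  \<kappa>): 2 comes from the dimension and 1 from differentiating y_i. The other divergence is then
  \<open>divergence_radial\<close>.\<close>

lemma double_divergence_radial:
  assumes k: "smooth \<kappa>"
  shows "(\<Sum>i\<in>UNIV. \<Sum>j\<in>UNIV. partial i (partial j (\<lambda>y. y $ i * y $ j * \<kappa> y)) y)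
     = 2 * (3 * \<kappa> y + dil \<kappa> y) + dil (\<lambda>y. 3 * \<kappa> y + dil \<kappa> y) y"
proof -
  define P where "P y = 3 * \<kappa> y + dil \<kappa> y" for y
  have P: "smooth P" unfolding P_def[abs_def] by (intro smooth_add smooth_cmult smooth_dil k)
  have s: "smooth (\<lambda>y. y $ i * y $ j * \<kappa> y)" for i j by (intro smooth_mult smooth_nth k)
  have pj: "partial j (\<lambda>y. y $ i * y $ j * \<kappa> y) y =
     y $ i * (y $ j * partial j \<kappa> y) + (y $ i + (if i = j then y $ j else 0)) * \<kappa> y" for i j y
    using smoothD(1)[OF smooth_nth] smoothD(1)[OF k] smoothD(1)[OF smooth_mult[OF smooth_nth smooth_nth]]
    by (simp add: partial_mult partial_nth algebra_simps)
  have inner: "(\<lambda>y. \<Sum>j\<in>UNIV. partial j (\<lambda>y. y $ i * y $ j * \<kappa> y) y) = (\<lambda>y. y $ i * P y)" for i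
    unfolding pj P_def dil_def using exhaust_2[of i] by (auto simp: fun_eq_iff sum_2 algebra_simps)
  have "(\<Sum>j\<in>UNIV. partial i (partial j (\<lambda>y. y $ i * y $ j * \<kappa> y)) y) = partial i (\<lambda>y. y $ i * P y) y" for i
    unfolding inner[symmetric] by (rule partial_sum[symmetric]) (intro smoothD(1,2) s)
  then show ?thesis using divergence_radial[OF P] by (simp add: P_def[abs_def])
qed

text \<open>Applied to a ray integral, \<open>dil\<close> becomes a t-derivative under the integral
  and is integrated by parts. W is the weight after it has absorbed the factor t from
  \<open>partial_ray_integral\<close>.\<close>

lemma ray_dilation:
  assumes E: "smooth E" and W: "\<And>t. (W has_real_derivative W' t) (at t)" "continuous_on UNIV W'" and T: "T \<ge> 1"
    and w: "continuous_on UNIV w" "\<And>t. w t * t = W t"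
  shows "dil (\<lambda>y. integral {1..T} (\<lambda>t. w t * E (t *\<^sub>R y))) y =
    W T * E (T *\<^sub>R y) - W 1 * E y - integral {1..T} (\<lambda>t. W' t * E (t *\<^sub>R y))"
proof -
  have Wc: "continuous_on UNIV W" using W(1) DERIV_isCont continuous_at_imp_continuous_on by blast
  have Ec: "continuous_on {1..T} (\<lambda>t. E (t *\<^sub>R y))"
    by (intro continuous_on_compose2[OF smoothD(3)[OF E]] continuous_intros) auto
  have pc: "continuous_on {1..T} (\<lambda>t. partial i E (t *\<^sub>R y))" for i
    by (intro continuous_on_compose2[OF smoothD(3)[OF smoothD(2)[OF E]]] continuous_intros) auto
  have "dil (\<lambda>y. integral {1..T} (\<lambda>t. w t * E (t *\<^sub>R y))) y
     = (\<Sum>i\<in>UNIV. y $ i * integral {1..T} (\<lambda>t. W t * partial i E (t *\<^sub>R y)))"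
    by (simp add: dil_def partial_ray_integral[OF w(1) E] w(2))
  also have "\<dots> = (\<Sum>i\<in>UNIV. integral {1..T} (\<lambda>t. W t * (y $ i * partial i E (t *\<^sub>R y))))"
    by (simp add: mult.left_commute flip: integral_mult_right)
  also have "\<dots> = integral {1..T} (\<lambda>t. \<Sum>i\<in>UNIV. W t * (y $ i * partial i E (t *\<^sub>R y)))"
    by (rule integral_sum[symmetric])
       (auto intro!: integrable_continuous_real continuous_intros pc continuous_on_subset[OF Wc])
  also have "\<dots> = integral {1..T} (\<lambda>t. W t * (\<Sum>i\<in>UNIV. y $ i * partial i E (t *\<^sub>R y)))"
    by (simp add: sum_distrib_left)
  finally have 1: "dil (\<lambda>y. integral {1..T} (\<lambda>t. w t * E (t *\<^sub>R y))) y = \<dots>" .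
  have d: "((\<lambda>t. E (t *\<^sub>R y)) has_real_derivative (\<Sum>i\<in>UNIV. y $ i * partial i E (t *\<^sub>R y))) (at t)" for t
  proof -
    have "((\<lambda>t. t *\<^sub>R y) has_derivative (\<lambda>h. h *\<^sub>R y)) (at t)" by (auto intro!: derivative_eq_intros)
    from has_derivative_compose[OF this smooth_has_derivative[OF E]]
    show ?thesis unfolding has_field_derivative_def
      by (rule has_derivative_eq_rhs) (simp add: fun_eq_iff sum_distrib_left mult_ac)
  qed
  have "((\<lambda>t. W' t * E (t *\<^sub>R y) + W t * (\<Sum>i\<in>UNIV. y $ i * partial i E (t *\<^sub>R y)))
      has_integral (W T * E (T *\<^sub>R y) - W 1 * E (1 *\<^sub>R y))) {1..T}"
  proof (rule fundamental_theorem_of_calculus[OF T])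
    fix t
    have "((\<lambda>t. W t * E (t *\<^sub>R y)) has_real_derivative
        (W' t * E (t *\<^sub>R y) + W t * (\<Sum>i\<in>UNIV. y $ i * partial i E (t *\<^sub>R y)))) (at t)"
      using DERIV_mult[OF W(1) d, of t] by (simp add: mult.commute add.commute)
    then show "((\<lambda>t. W t * E (t *\<^sub>R y)) has_vector_derivative
        (W' t * E (t *\<^sub>R y) + W t * (\<Sum>i\<in>UNIV. y $ i * partial i E (t *\<^sub>R y)))) (at t within {1..T})"
      by (simp add: has_real_derivative_iff_has_vector_derivative[symmetric] has_field_derivative_at_within)
  qed
  then have "integral {1..T} (\<lambda>t. W' t * E (t *\<^sub>R y) + W t * (\<Sum>i\<in>UNIV. y $ i * partial i E (t *\<^sub>R y)))
     = W T * E (T *\<^sub>R y) - W 1 * E y" by (simp add: integral_unique)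
  moreover have "integral {1..T} (\<lambda>t. W' t * E (t *\<^sub>R y) + W t * (\<Sum>i\<in>UNIV. y $ i * partial i E (t *\<^sub>R y)))
     = integral {1..T} (\<lambda>t. W' t * E (t *\<^sub>R y)) + integral {1..T} (\<lambda>t. W t * (\<Sum>i\<in>UNIV. y $ i * partial i E (t *\<^sub>R y)))"
    by (intro Henstock_Kurzweil_Integration.integral_add integrable_continuous_real continuous_intros Ec pc
        continuous_on_subset[OF Wc] continuous_on_subset[OF W(2)]) auto
  ultimately show ?thesis using 1 by linarith
qed

text \<open>The integrand is at most t^2 c (t |y|)^(-7/2), that is t^(-3/2) times its value at t =
  1, and t^(-3/2) has integral 2 over [1, \<infinity>). Hence the bound does not depend on
  T.\<close>

lemma ray_integral_bound:
  assumes E: "smooth E" and c: "c \<ge> 0" and T: "T \<ge> 1"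
    and bd: "\<And>z. norm z \<ge> 1 \<Longrightarrow> \<bar>E z\<bar> \<le> c / (norm z ^ 3 * sqrt (norm z))"
    and w: "continuous_on UNIV w" "\<And>t. t \<ge> 1 \<Longrightarrow> \<bar>w t\<bar> \<le> t\<^sup>2" and y: "norm y \<ge> 1"
  shows "\<bar>integral {1..T} (\<lambda>t. w t * E (t *\<^sub>R y))\<bar> \<le> 2 * c / (norm y ^ 3 * sqrt (norm y))"
proof -
  define d where "d = c / (norm y ^ 3 * sqrt (norm y))"
  have d: "d \<ge> 0" using c by (simp add: d_def)
  have hi: "((\<lambda>t. d * (1 / (t * sqrt t))) has_integral d * ((- 2 / sqrt T) - (- 2 / sqrt 1))) {1..T}"
  proof (rule has_integral_mult_right, rule fundamental_theorem_of_calculus[OF T])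
    fix t :: real assume t: "t \<in> {1..T}"
    then have "((\<lambda>t. - 2 / sqrt t) has_real_derivative (1 / (t * sqrt t))) (at t)"
      by (auto intro!: derivative_eq_intros simp: field_simps)
    then show "((\<lambda>t. - 2 / sqrt t) has_vector_derivative (1 / (t * sqrt t))) (at t within {1..T})"
      by (simp add: has_real_derivative_iff_has_vector_derivative[symmetric] has_field_derivative_at_within)
  qed
  have "norm (integral {1..T} (\<lambda>t. w t * E (t *\<^sub>R y))) \<le> integral {1..T} (\<lambda>t. d * (1 / (t * sqrt t)))"
  proof (rule integral_norm_bound_integral)
    show "(\<lambda>t. w t * E (t *\<^sub>R y)) integrable_on {1..T}"
      by (intro integrable_continuous_real continuous_intros continuous_on_subset[OF w(1)]
          continuous_on_compose2[OF smoothD(3)[OF E]]) auto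
    show "(\<lambda>t. d * (1 / (t * sqrt t))) integrable_on {1..T}" using hi by blast
    fix t :: real assume t: "t \<in> {1..T}"
    have n: "norm (t *\<^sub>R y) = t * norm y" using t by simp
    have "1 * 1 \<le> t * norm y" using t y by (intro mult_mono) auto
    then have "\<bar>E (t *\<^sub>R y)\<bar> \<le> c / ((t * norm y) ^ 3 * sqrt (t * norm y))" using bd[of "t *\<^sub>R y", unfolded n] by simp
    then have "\<bar>w t\<bar> * \<bar>E (t *\<^sub>R y)\<bar> \<le> t\<^sup>2 * (c / ((t * norm y) ^ 3 * sqrt (t * norm y)))"
      using w(2)[of t] t by (intro mult_mono) auto
    also have "\<dots> = d * (1 / (t * sqrt t))"
      using t y by (simp add: d_def real_sqrt_mult power_mult_distrib power2_eq_square power3_eq_cube field_simps)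
    finally show "norm (w t * E (t *\<^sub>R y)) \<le> d * (1 / (t * sqrt t))" by (simp add: abs_mult)
  qed
  also have "\<dots> = d * (2 - 2 / sqrt T)" using integral_unique[OF hi] by simp
  also have "\<dots> \<le> d * 2" using d T by (intro mult_left_mono) auto
  finally show ?thesis by (simp add: d_def mult.commute)
qed

lemma L2_tail_three_halves: "(\<lambda>y::real^2. if norm y \<ge> 1 then 1 / (norm y * sqrt (norm y)) else 0) \<in> L2"
proof (rule L2_borelI)
  show "(\<lambda>y::real^2. if norm y \<ge> 1 then 1 / (norm y * sqrt (norm y)) else 0) \<in> borel_measurable borel" by measurable
  have "(\<lambda>y::real^2. (if norm y \<ge> 1 then 1 / (norm y * sqrt (norm y)) else 0)\<^sup>2) = tail3"
    by (auto simp: fun_eq_iff tail3_def power_divide power_mult_distrib power3_eq_cube power2_eq_square)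
  then show "integrable lborel (\<lambda>y::real^2. (if norm y \<ge> 1 then 1 / (norm y * sqrt (norm y)) else 0)\<^sup>2)"
    using integrable_tail3 by simp
qed

lemma hessian_pairing_double_divergence:
  assumes gc: "continuous_on UNIV g" and gH: "has_L2_hessian g H"
    and p: "\<And>i j. \<psi> i j \<in> test_functions"
  shows "(LINT y|lebesgue. g y * (\<Sum>i\<in>UNIV. \<Sum>j\<in>UNIV. partial i (partial j (\<psi> i j)) y))
    = (\<Sum>i\<in>UNIV. \<Sum>j\<in>UNIV. LINT y|lebesgue. H y $ i $ j * \<psi> i j y)"
proof -
  have int: "integrable lebesgue (\<lambda>y. g y * partial i (partial j (\<psi> i j)) y)" for i j
  proof -
    show ?thesis by (intro integrable_lborel_lebesgue cont_test_integrable gc test_partial p)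
  qed
  have "(LINT y|lebesgue. g y * (\<Sum>i\<in>UNIV. \<Sum>j\<in>UNIV. partial i (partial j (\<psi> i j)) y))
    = (\<Sum>i\<in>UNIV. \<Sum>j\<in>UNIV. LINT y|lebesgue. g y * partial i (partial j (\<psi> i j)) y)"
    using int by (simp add: sum_distrib_left Bochner_Integration.integral_sum Bochner_Integration.integrable_sum)
  also have "\<dots> = (\<Sum>i\<in>UNIV. \<Sum>j\<in>UNIV. LINT y|lebesgue. H y $ i $ j * \<psi> i j y)"
    using gH p by (intro sum.cong refl) (auto simp: has_L2_hessian_def)
  finally show ?thesis .
qed

text \<open>A source that is small at infinity is the double divergence of a small tensor field, up to an
  error near the origin: writing \<open>D\<close> for \<open>dil\<close>, the double divergence of \<open>y\<^sub>i y\<^sub>j k\<close> is \<open>(D + 2) (D + 3) k\<close>,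
  and this operator is inverted by integrating along rays.\<close>

lemma far_source_pairing_small:
  assumes gc: "continuous_on UNIV g" and gH: "has_L2_hessian g H"
  shows "\<exists>\<Gamma>. \<forall>E T c. smooth E \<longrightarrow> T \<ge> 1 \<longrightarrow> c \<ge> 0 \<longrightarrow> (\<forall>z. norm z < 2 \<longrightarrow> E z = 0) \<longrightarrow> (\<forall>z. norm z \<ge> T \<longrightarrow> E z = 0)
    \<longrightarrow> (\<forall>z. norm z \<ge> 1 \<longrightarrow> \<bar>E z\<bar> \<le> c / (norm z ^ 3 * sqrt (norm z)))
    \<longrightarrow> \<bar>LINT y|lebesgue. g y * E y\<bar> \<le> c * \<Gamma>"
proof -
  \<comment> \<open>\<zeta> cuts out the unit disc, where T y may still lie in the support of E, so
    that the boundary terms of \<open>ray_dilation\<close> need not vanish.\<close>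
  define \<zeta> where "\<zeta> y = 1 - cutoff y" for y
  have z: "smooth \<zeta>" unfolding \<zeta>_def[abs_def] by (intro smooth_diff smooth_const smooth_cutoff)
  have z0: "\<zeta> y = 0" if "norm y \<le> 1" for y using cutoff_eq_1[OF that] by (simp add: \<zeta>_def)
  have z1: "\<zeta> y = 1" if "norm y \<ge> 2" for y using cutoff_eq_0[OF that] by (simp add: \<zeta>_def)
  have zb: "0 \<le> \<zeta> y" "\<zeta> y \<le> 1" for y using cutoff_bounds[of y] by (auto simp: \<zeta>_def)
  have o1: "open {y::real^2. norm y < 1}" and o2: "open {y::real^2. norm y > 2}"
    by (auto intro!: open_Collect_less continuous_intros)
  have dz0: "dil \<zeta> y = 0" if "norm y < 1" for y
    using dil_open_cong[OF o1, of y \<zeta> "\<lambda>_. 0"] that z0 by (simp add: dil_const)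
  have dz2: "dil \<zeta> y = 0" if "norm y > 2" for y
    using dil_open_cong[OF o2, of y \<zeta> "\<lambda>_. 1"] that z1 by (simp add: dil_const)
  have ddz0: "dil (dil \<zeta>) y = 0" if "norm y < 1" for y
    using dil_open_cong[OF o1, of y "dil \<zeta>" "\<lambda>_. 0"] that dz0 by (simp add: dil_const)
  have ddz2: "dil (dil \<zeta>) y = 0" if "norm y > 2" for y
    using dil_open_cong[OF o2, of y "dil \<zeta>" "\<lambda>_. 0"] that dz2 by (simp add: dil_const)
  obtain M1 where M1: "M1 \<ge> 0" "\<And>y. \<bar>dil \<zeta> y\<bar> \<le> M1"
    using compact_support_bounded[OF smoothD(3)[OF smooth_dil[OF z]] dz2] by blast
  obtain M2 where M2: "M2 \<ge> 0" "\<And>y. \<bar>dil (dil \<zeta>) y\<bar> \<le> M2"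
    using compact_support_bounded[OF smoothD(3)[OF smooth_dil[OF smooth_dil[OF z]]] ddz2] by blast
  define W where "W y = (if norm y \<ge> 1 then 1 / (norm y * sqrt (norm y)) else 0)" for y :: "real^2"
  have W: "W \<in> L2" unfolding W_def[abs_def] by (rule L2_tail_three_halves)
  have W0: "W y \<ge> 0" for y by (simp add: W_def)
  have HL: "(\<lambda>y. H y $ i $ j) \<in> L2" for i j using gH by (simp add: has_L2_hessian_def)
  define MB where "MB = 4 * M1 + 2 * (M2 + M1)"
  have MB: "MB \<ge> 0" using M1 M2 by (simp add: MB_def)
  have intg: "integrable lebesgue (\<lambda>y. \<bar>g y\<bar> * indicator (cball 0 2) y)"
  proof -
    have "integrable lborel (\<lambda>y. indicator (cball 0 2) y *\<^sub>R \<bar>g y\<bar>)"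
      using gc by (intro borel_integrable_compact compact_cball continuous_intros) (auto intro: continuous_on_subset)
    from integrable_lborel_lebesgue[OF this] show ?thesis by (simp add: mult.commute)
  qed
  \<comment> \<open>\<Gamma> depends on g and H alone. Its first part bounds the pairing of H with
    the field, 2 being the constant of \<open>ray_integral_bound\<close>; the second pays for the
    error near the origin.\<close>
  define \<Gamma> where "\<Gamma> = 2 * (\<Sum>i\<in>UNIV. \<Sum>j\<in>UNIV. LINT y|lebesgue. \<bar>H y $ i $ j\<bar> * W y)
     + MB * (LINT y|lebesgue. \<bar>g y\<bar> * indicator (cball 0 2) y)"
  have "\<bar>LINT y|lebesgue. g y * E y\<bar> \<le> c * \<Gamma>"
    if E: "smooth E" and T: "T \<ge> 1" and c: "c \<ge> 0" and En: "\<And>z. norm z < 2 \<Longrightarrow> E z = 0"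
      and Ef: "\<And>z. norm z \<ge> T \<Longrightarrow> E z = 0"
      and bd: "\<And>z. norm z \<ge> 1 \<Longrightarrow> \<bar>E z\<bar> \<le> c / (norm z ^ 3 * sqrt (norm z))" for E T c
  proof -
    \<comment> \<open>Partial fractions: 1 / ((D + 2) (D + 3)) = 1 / (D + 2) - 1 / (D + 3), and (D +
      a) u = E is solved by minus the integral of t^(a - 1) E (t y) over t \<ge> 1. So k solves the
      whole equation, and m = (D + 3) k.\<close>
    define k where "k y = integral {1..T} (\<lambda>t. (t\<^sup>2 - t) * E (t *\<^sub>R y))" for y
    define m where "m y = integral {1..T} (\<lambda>t. (- t) * E (t *\<^sub>R y))" for y
    have wc: "continuous_on UNIV (\<lambda>t::real. t\<^sup>2 - t)" "continuous_on UNIV (\<lambda>t::real. - t)" by (auto intro!: continuous_intros)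
    have k: "smooth k" unfolding k_def[abs_def] by (intro smooth_ray_integral wc E)
    have m: "smooth m" unfolding m_def[abs_def] by (intro smooth_ray_integral wc E)
    have ET: "E (T *\<^sub>R y) = 0" if "norm y \<ge> 1" for y
      using Ef[of "T *\<^sub>R y"] T that mult_left_mono[of 1 "norm y" T] by simp
    have Ei: "(\<lambda>t. w t * E (t *\<^sub>R y)) integrable_on {1..T}" if "continuous_on UNIV w" for w y
      by (intro integrable_continuous_real continuous_intros continuous_on_subset[OF that]
          continuous_on_compose2[OF smoothD(3)[OF E]]) auto
    have dk: "3 * k y + dil k y = m y" if y: "norm y \<ge> 1" for y
    proof -
      have "dil k y = (T ^ 3 - T\<^sup>2) * E (T *\<^sub>R y) - (1 ^ 3 - 1\<^sup>2) * E y - integral {1..T} (\<lambda>t. (3 * t\<^sup>2 - 2 * t) * E (t *\<^sub>R y))"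
        unfolding k_def[abs_def]
        by (rule ray_dilation[OF E _ _ T wc(1)])
           (auto intro!: derivative_eq_intros continuous_intros simp: power2_eq_square power3_eq_cube algebra_simps)
      then have "3 * k y + dil k y = 3 * integral {1..T} (\<lambda>t. (t\<^sup>2 - t) * E (t *\<^sub>R y)) - integral {1..T} (\<lambda>t. (3 * t\<^sup>2 - 2 * t) * E (t *\<^sub>R y))"
        by (simp add: ET[OF y] k_def)
      also have "\<dots> = integral {1..T} (\<lambda>t. 3 * ((t\<^sup>2 - t) * E (t *\<^sub>R y)) - (3 * t\<^sup>2 - 2 * t) * E (t *\<^sub>R y))"
        by (subst Henstock_Kurzweil_Integration.integral_diff)
           (auto intro!: Ei integrable_on_cmult_left continuous_intros)
      also have "\<dots> = m y" unfolding m_def by (rule Henstock_Kurzweil_Integration.integral_cong) (simp add: algebra_simps)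
      finally show ?thesis .
    qed
    have dm: "2 * m y + dil m y = E y" if y: "norm y \<ge> 1" for y
    proof -
      have "dil m y = (- (T\<^sup>2)) * E (T *\<^sub>R y) - (- (1\<^sup>2)) * E y - integral {1..T} (\<lambda>t. (- 2 * t) * E (t *\<^sub>R y))"
        unfolding m_def[abs_def]
        by (rule ray_dilation[OF E _ _ T wc(2)])
           (auto intro!: derivative_eq_intros continuous_intros simp: power2_eq_square)
      moreover have "integral {1..T} (\<lambda>t. (- 2 * t) * E (t *\<^sub>R y)) = 2 * m y"
        unfolding m_def by (simp add: mult.assoc flip: integral_mult_right)
      ultimately show ?thesis by (simp add: ET[OF y])
    qed
    have kb: "\<bar>k y\<bar> \<le> 2 * c / (norm y ^ 3 * sqrt (norm y))" and mb: "\<bar>m y\<bar> \<le> 2 * c / (norm y ^ 3 * sqrt (norm y))"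
      if y: "norm y \<ge> 1" for y
      unfolding k_def m_def
      by (rule ray_integral_bound[OF E c T bd _ _ y]; force intro!: continuous_intros simp: power2_eq_square)+
    have kf: "k y = 0" if "norm y \<ge> T" for y
    proof -
      have "E (t *\<^sub>R y) = 0" if t: "t \<in> {1..T}" for t
      proof (rule Ef)
        have "1 * T \<le> t * norm y" using t \<open>norm y \<ge> T\<close> T by (intro mult_mono) auto
        then show "T \<le> norm (t *\<^sub>R y)" using t by simp
      qed
      then have "k y = integral {1..T} (\<lambda>t. 0)" unfolding k_def by (intro Henstock_Kurzweil_Integration.integral_cong) auto
      then show ?thesis by simp
    qed
    define \<kappa> where "\<kappa> y = \<zeta> y * k y" for y
    have kap: "smooth \<kappa>" unfolding \<kappa>_def[abs_def] by (intro smooth_mult z k)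
    define \<psi> where "\<psi> i j y = y $ i * y $ j * \<kappa> y" for i j and y :: "real^2"
    have psi: "\<psi> i j \<in> test_functions" for i j
      unfolding \<psi>_def[abs_def] by (rule test_functionsI[of _ T], intro smooth_mult smooth_nth kap) (simp add: \<kappa>_def kf)
    \<comment> \<open>The terms in which \<open>dil\<close> falls on \<zeta>, after
      \<open>dil k\<close> has been replaced by m - 3 k; they live on 1 \<le> |y| \<le> 2.\<close>
    define B where "B y = 2 * (m y * dil \<zeta> y) + k y * (dil (dil \<zeta>) y - dil \<zeta> y)" for y
    have P: "(\<lambda>y. 3 * \<kappa> y + dil \<kappa> y) = (\<lambda>y. \<zeta> y * m y + dil \<zeta> y * k y)"
    proof
      fix y
      have "3 * \<kappa> y + dil \<kappa> y = \<zeta> y * (3 * k y + dil k y) + dil \<zeta> y * k y"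
        unfolding \<kappa>_def[abs_def] by (simp add: dil_mult[OF z k] algebra_simps)
      also have "\<dots> = \<zeta> y * m y + dil \<zeta> y * k y" using dk[of y] z0[of y] by (cases "norm y \<ge> 1") auto
      finally show "3 * \<kappa> y + dil \<kappa> y = \<zeta> y * m y + dil \<zeta> y * k y" .
    qed
    have dd: "(\<Sum>i\<in>UNIV. \<Sum>j\<in>UNIV. partial i (partial j (\<psi> i j)) y) = E y + B y" for y
    proof -
      have "(\<Sum>i\<in>UNIV. \<Sum>j\<in>UNIV. partial i (partial j (\<psi> i j)) y) =
         2 * (\<zeta> y * m y + dil \<zeta> y * k y) + dil (\<lambda>y. \<zeta> y * m y + dil \<zeta> y * k y) y"
        unfolding \<psi>_def[abs_def] double_divergence_radial[OF kap] by (simp only: P fun_cong[OF P])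
      also have "dil (\<lambda>y. \<zeta> y * m y + dil \<zeta> y * k y) y = \<zeta> y * dil m y + dil \<zeta> y * m y + (dil \<zeta> y * dil k y + dil (dil \<zeta>) y * k y)"
        using smooth_mult[OF z m] smooth_mult[OF smooth_dil[OF z] k]
        by (simp add: dil_add dil_mult z m k smooth_dil)
      finally have *: "(\<Sum>i\<in>UNIV. \<Sum>j\<in>UNIV. partial i (partial j (\<psi> i j)) y) =
        \<zeta> y * (2 * m y + dil m y) + dil \<zeta> y * (2 * k y + dil k y) + dil \<zeta> y * m y + dil (dil \<zeta>) y * k y"
        by (simp add: algebra_simps)
      show ?thesis
      proof (cases "norm y \<ge> 1")
        case True
        have dk': "dil k y = m y - 3 * k y" using dk[OF True] by linarith
        \<comment> \<open>E vanishes for |y| < 2 and \<zeta> is 1 from there on, so \<zeta> E =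
          E.\<close>
        have "\<zeta> y = 1 \<or> E y = 0" using En[of y] z1[of y] by (cases "norm y < 2") auto
        then show ?thesis unfolding * dm[OF True] B_def dk' by (auto simp: algebra_simps)
      next
        case False
        then show ?thesis unfolding * B_def using z0[of y] dz0[of y] ddz0[of y] En[of y] by simp
      qed
    qed
    have Bs: "smooth B" unfolding B_def[abs_def]
      by (intro smooth_add smooth_cmult smooth_mult smooth_diff smooth_dil m k z)
    have B0: "B y = 0" if "norm y > 2" for y using dz2[OF that] ddz2[OF that] by (simp add: B_def)
    have Bb: "\<bar>B y\<bar> \<le> c * MB * indicator (cball 0 2) y" for y
    proof -
      consider "norm y < 1" | "norm y > 2" | "norm y \<ge> 1" "norm y \<le> 2" by linarith
      then show ?thesis
      proof cases
        case 1 then show ?thesis using dz0[of y] ddz0[of y] c MB by (simp add: B_def)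
      next
        case 2 then show ?thesis using B0[of y] by simp
      next
        case 3
        have "1 * 1 \<le> norm y ^ 3 * sqrt (norm y)" using 3 by (intro mult_mono) auto
        then have "2 * c / (norm y ^ 3 * sqrt (norm y)) \<le> 2 * c / 1" using c by (intro divide_left_mono) auto
        then have km: "\<bar>k y\<bar> \<le> 2 * c" "\<bar>m y\<bar> \<le> 2 * c" using kb[OF 3(1)] mb[OF 3(1)] by auto
        have "\<bar>m y * dil \<zeta> y\<bar> \<le> 2 * c * M1" unfolding abs_mult using km M1 c by (intro mult_mono) auto
        moreover have "\<bar>k y * (dil (dil \<zeta>) y - dil \<zeta> y)\<bar> \<le> 2 * c * (M2 + M1)"
          unfolding abs_mult using km M1 M2 c
          by (intro mult_mono) (auto intro: order_trans[OF abs_triangle_ineq4] add_mono)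
        ultimately have "\<bar>B y\<bar> \<le> 2 * (2 * c * M1) + 2 * c * (M2 + M1)" unfolding B_def by linarith
        then show ?thesis using 3 by (simp add: MB_def algebra_simps)
      qed
    qed
    \<comment> \<open>|y|^2 times the |y|^(-7/2) of k leaves the square integrable weight W.\<close>
    have pb: "\<bar>\<psi> i j y\<bar> \<le> 2 * c * W y" for i j y
    proof (cases "norm y \<ge> 1")
      case True
      have yij: "\<bar>y $ i\<bar> * \<bar>y $ j\<bar> \<le> norm y * norm y" by (intro mult_mono component_le_norm_cart) auto
      have "\<bar>\<zeta> y\<bar> * \<bar>k y\<bar> \<le> 1 * (2 * c / (norm y ^ 3 * sqrt (norm y)))"
        using zb[of y] kb[OF True] by (intro mult_mono) auto
      then have "\<bar>\<psi> i j y\<bar> \<le> norm y * norm y * (1 * (2 * c / (norm y ^ 3 * sqrt (norm y))))"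
        unfolding \<psi>_def \<kappa>_def abs_mult by (rule mult_mono[OF yij]) auto
      also have "\<dots> = 2 * c * W y" using True by (simp add: W_def power3_eq_cube field_simps)
      finally show ?thesis .
    next
      case False
      then show ?thesis using z0[of y] by (simp add: \<psi>_def \<kappa>_def W_def)
    qed
    have Et: "E \<in> test_functions" using E Ef by (intro test_functionsI[of _ T]) auto
    have Bt: "B \<in> test_functions" using Bs B0 by (intro test_functionsI[of _ 2]) auto
    have ig: "integrable lebesgue (\<lambda>y. g y * \<phi> y)" if "\<phi> \<in> test_functions" for \<phi>
      by (intro integrable_lborel_lebesgue cont_test_integrable gc that)
    have "(LINT y|lebesgue. g y * (E y + B y)) = (\<Sum>i\<in>UNIV. \<Sum>j\<in>UNIV. LINT y|lebesgue. H y $ i $ j * \<psi> i j y)"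
      using hessian_pairing_double_divergence[OF gc gH, of \<psi>, OF psi] unfolding dd .
    then have "(LINT y|lebesgue. g y * E y) = (\<Sum>i\<in>UNIV. \<Sum>j\<in>UNIV. LINT y|lebesgue. H y $ i $ j * \<psi> i j y) - (LINT y|lebesgue. g y * B y)"
      using ig[OF Et] ig[OF Bt] by (simp add: distrib_left)
    moreover have "\<bar>LINT y|lebesgue. H y $ i $ j * \<psi> i j y\<bar> \<le> 2 * c * (LINT y|lebesgue. \<bar>H y $ i $ j\<bar> * W y)" for i j
    proof -
      have iHW: "integrable lebesgue (\<lambda>y. \<bar>H y $ i $ j\<bar> * W y)"
        using integrable_norm[OF L2_mult_integrable[OF HL[of i j] W]] W0 by (simp add: abs_mult)
      have "\<bar>LINT y|lebesgue. H y $ i $ j * \<psi> i j y\<bar> \<le> (LINT y|lebesgue. 2 * c * (\<bar>H y $ i $ j\<bar> * W y))"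
      proof (rule integral_abs_bound_integral)
        show "integrable lebesgue (\<lambda>y. H y $ i $ j * \<psi> i j y)" by (intro L2_mult_integrable HL test_L2 psi)
        show "integrable lebesgue (\<lambda>y. 2 * c * (\<bar>H y $ i $ j\<bar> * W y))" using iHW by simp
        show "\<bar>H y $ i $ j * \<psi> i j y\<bar> \<le> 2 * c * (\<bar>H y $ i $ j\<bar> * W y)" for y
          using mult_left_mono[OF pb[of i j y], of "\<bar>H y $ i $ j\<bar>"] by (simp add: abs_mult mult_ac)
      qed
      then show ?thesis by simp
    qed
    moreover have "\<bar>LINT y|lebesgue. g y * B y\<bar> \<le> c * MB * (LINT y|lebesgue. \<bar>g y\<bar> * indicator (cball 0 2) y)"
    proof -
      have "\<bar>LINT y|lebesgue. g y * B y\<bar> \<le> (LINT y|lebesgue. c * MB * (\<bar>g y\<bar> * indicator (cball 0 2) y))"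
      proof (rule integral_abs_bound_integral[OF ig[OF Bt]])
        show "integrable lebesgue (\<lambda>y. c * MB * (\<bar>g y\<bar> * indicator (cball 0 2) y))" using intg by simp
        show "\<bar>g y * B y\<bar> \<le> c * MB * (\<bar>g y\<bar> * indicator (cball 0 2) y)" for y
          using mult_left_mono[OF Bb[of y], of "\<bar>g y\<bar>"] by (simp add: abs_mult mult_ac)
      qed
      then show ?thesis by simp
    qed
    ultimately have "\<bar>LINT y|lebesgue. g y * E y\<bar> \<le>
      (\<Sum>i\<in>UNIV. \<Sum>j\<in>UNIV. 2 * c * (LINT y|lebesgue. \<bar>H y $ i $ j\<bar> * W y)) + c * MB * (LINT y|lebesgue. \<bar>g y\<bar> * indicator (cball 0 2) y)"
      by (auto intro!: order_trans[OF abs_triangle_ineq4] add_mono order_trans[OF sum_abs] sum_mono)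
    also have "\<dots> = c * \<Gamma>" by (simp add: \<Gamma>_def sum_distrib_left algebra_simps)
    finally show ?thesis .
  qed
  then show ?thesis by blast
qed

section \<open>Pairing a Hessian with a thin-plate spline\<close>

text \<open>The \<open>+ 0\<close> brings it into the form that \<open>smooth_affine_arg\<close> and
  \<open>partial_affine_arg\<close> expect.\<close>

definition cut :: "real \<Rightarrow> real^2 \<Rightarrow> real" where
  "cut R y = cutoff ((1 / R) *\<^sub>R y + 0)"

lemma smooth_cut: "smooth (cut R)"
  unfolding cut_def[abs_def] by (rule smooth_affine_arg[OF smooth_cutoff])

lemma cut_eq_1: "R > 0 \<Longrightarrow> norm y \<le> R \<Longrightarrow> cut R y = 1"
  by (simp add: cut_def cutoff_eq_1)

lemma cut_eq_0: "R > 0 \<Longrightarrow> norm y \<ge> 2 * R \<Longrightarrow> cut R y = 0"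
  unfolding cut_def by (rule cutoff_eq_0) (simp add: field_simps)

lemma cut_bounds: "0 \<le> cut R y" "cut R y \<le> 1"
  by (auto simp: cut_def cutoff_bounds)

lemma partial_cut: "partial i (cut R) = (\<lambda>y. 1 / R * partial i cutoff ((1 / R) *\<^sub>R y + 0))"
  unfolding cut_def[abs_def] using partial_affine_arg(2)[OF smoothD(1)[OF smooth_cutoff]] by blast

lemma partial2_cut: "partial i (partial j (cut R)) y = 1 / R * (1 / R * partial i (partial j cutoff) ((1 / R) *\<^sub>R y + 0))"
proof -
  have s: "smooth (partial j cutoff)" by (rule smoothD(2)[OF smooth_cutoff])
  show ?thesis unfolding partial_cut
    by (subst partial_cmult, rule smoothD(1), rule smooth_affine_arg[OF s])
       (simp only: partial_affine_arg(2)[OF smoothD(1)[OF s]])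
qed

lemma cutoff_test: "cutoff \<in> test_functions"
  by (rule test_functionsI[of _ 2]) (auto simp: smooth_cutoff cutoff_eq_0)

text \<open>One M serves all R, as each derivative of the rescaled cut-off contributes a factor 1 /
  R.\<close>

lemma cut_derivative_bounds:
  "\<exists>M\<ge>0. \<forall>R>0. \<forall>y i j. \<bar>partial j (cut R) y\<bar> \<le> M / R \<and> \<bar>partial i (partial j (cut R)) y\<bar> \<le> M / R\<^sup>2"
proof -
  have "\<exists>M\<ge>0. \<forall>y. \<bar>partial j cutoff y\<bar> \<le> M" for j
    using test_bounded[OF test_partial[OF cutoff_test]] by metis
  then obtain M1 where M1: "\<And>j. M1 j \<ge> 0" "\<And>j y. \<bar>partial j cutoff y\<bar> \<le> M1 j" by metis
  have "\<exists>M\<ge>0. \<forall>y. \<bar>partial i (partial j cutoff) y\<bar> \<le> M" for i j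
    using test_bounded[OF test_partial[OF test_partial[OF cutoff_test]]] by metis
  then obtain M2 where M2: "\<And>i j. M2 i j \<ge> 0" "\<And>i j y. \<bar>partial i (partial j cutoff) y\<bar> \<le> M2 i j" by metis
  define M where "M = (\<Sum>j\<in>UNIV. M1 j) + (\<Sum>i\<in>UNIV. \<Sum>j\<in>UNIV. M2 i j)"
  have s1: "0 \<le> (\<Sum>j\<in>UNIV. M1 j)" and s2: "0 \<le> (\<Sum>i\<in>UNIV. \<Sum>j\<in>UNIV. M2 i j)"
    by (intro sum_nonneg M1 M2)+
  have m1: "M1 j \<le> M" for j
    using member_le_sum[of j UNIV M1] M1(1) s2 by (simp add: M_def)
  have m2: "M2 i j \<le> M" for i j
  proof -
    have "M2 i j \<le> (\<Sum>j\<in>UNIV. M2 i j)" using member_le_sum[of j UNIV "M2 i"] M2(1) by simp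
    also have "\<dots> \<le> (\<Sum>i\<in>UNIV. \<Sum>j\<in>UNIV. M2 i j)"
      using member_le_sum[of i UNIV "\<lambda>i. \<Sum>j\<in>UNIV. M2 i j"] M2(1) by (simp add: sum_nonneg)
    finally show ?thesis using s1 by (simp add: M_def)
  qed
  have "\<bar>partial j (cut R) y\<bar> \<le> M / R" "\<bar>partial i (partial j (cut R)) y\<bar> \<le> M / R\<^sup>2" if R: "R > 0" for R y i j
  proof -
    have "\<bar>partial j (cut R) y\<bar> = \<bar>partial j cutoff ((1 / R) *\<^sub>R y + 0)\<bar> / R" using R by (simp add: partial_cut abs_mult)
    also have "\<dots> \<le> M / R" using R order_trans[OF M1(2) m1] by (intro divide_right_mono) auto
    finally show "\<bar>partial j (cut R) y\<bar> \<le> M / R" .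
    have "\<bar>partial i (partial j (cut R)) y\<bar> = \<bar>partial i (partial j cutoff) ((1 / R) *\<^sub>R y + 0)\<bar> / R\<^sup>2"
      using R by (simp add: partial2_cut abs_mult power2_eq_square)
    also have "\<dots> \<le> M / R\<^sup>2" using R order_trans[OF M2(2) m2] by (intro divide_right_mono) auto
    finally show "\<bar>partial i (partial j (cut R)) y\<bar> \<le> M / R\<^sup>2" .
  qed
  moreover have "M \<ge> 0" using s1 s2 by (simp add: M_def)
  ultimately show ?thesis by blast
qed

lemma partial_cut_near: "R > 0 \<Longrightarrow> norm y < R \<Longrightarrow> partial j (cut R) y = 0"
  and partial2_cut_near: "R > 0 \<Longrightarrow> norm y < R \<Longrightarrow> partial i (partial j (cut R)) y = 0"
proof -
  have o: "open {y::real^2. norm y < R}" by (auto intro!: open_Collect_less continuous_intros)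
  have 1: "partial j (cut R) y = 0" if "R > 0" "norm y < R" for y
    using partial_open_cong[OF o, of y "cut R" "\<lambda>_. 1" j] that cut_eq_1[of R] by (simp add: partial_const)
  show "R > 0 \<Longrightarrow> norm y < R \<Longrightarrow> partial j (cut R) y = 0" using 1 .
  show "R > 0 \<Longrightarrow> norm y < R \<Longrightarrow> partial i (partial j (cut R)) y = 0"
    using partial_open_cong[OF o, of y "partial j (cut R)" "\<lambda>_. 0" i] 1 by (simp add: partial_const)
qed

lemma partial_tps2: "e \<noteq> 0 \<Longrightarrow> (\<Sum>i\<in>UNIV. partial i (tps2 n x \<beta> e i j) y) = tps3 n x \<beta> e j y"
proof -
  assume e: "e \<noteq> 0"
  have "(\<Sum>i\<in>UNIV. partial i (tps2 n x \<beta> e i j) y) = (\<Sum>i\<in>UNIV. \<Sum>r=1..n. \<beta> r * partial i (ker2 e i j) (y - x r))"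
    unfolding tps2_def[abs_def] partial_weighted_shifts[OF smooth_ker(3)[OF e]] ..
  also have "\<dots> = (\<Sum>r=1..n. \<beta> r * (\<Sum>i\<in>UNIV. partial i (ker2 e i j) (y - x r)))"
    by (subst sum.swap) (simp add: sum_distrib_left)
  finally show ?thesis by (simp only: partial_ker2[OF e] tps3_def)
qed

lemma partial_tps3: "e \<noteq> 0 \<Longrightarrow> (\<Sum>j\<in>UNIV. partial j (tps3 n x \<beta> e j) y) = tps4 n x \<beta> e y"
proof -
  assume e: "e \<noteq> 0"
  have "(\<Sum>j\<in>UNIV. partial j (tps3 n x \<beta> e j) y) = (\<Sum>j\<in>UNIV. \<Sum>r=1..n. \<beta> r * partial j (ker3 e j) (y - x r))"
    unfolding tps3_def[abs_def] partial_weighted_shifts[OF smooth_ker(4)[OF e]] ..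
  also have "\<dots> = (\<Sum>r=1..n. \<beta> r * (\<Sum>j\<in>UNIV. partial j (ker3 e j) (y - x r)))"
    by (subst sum.swap) (simp add: sum_distrib_left)
  finally show ?thesis by (simp only: partial_ker3[OF e] tps4_def)
qed

lemma tps2_commute: "tps2 n x \<beta> e i j = tps2 n x \<beta> e j i"
  unfolding tps2_def[abs_def] ker2_commute[of e i j] ..

text \<open>The product rule: by the symmetry of \<open>tps2\<close> both mixed sums contract to
  \<open>tps3\<close>, hence the 2, and the full contraction is \<open>tps4\<close>.\<close>

lemma cut_double_divergence:
  assumes e: "e \<noteq> 0"
  shows "(\<Sum>i\<in>UNIV. \<Sum>j\<in>UNIV. partial i (partial j (\<lambda>y. cut R y * tps2 n x \<beta> e i j y)) y) =
    cut R y * tps4 n x \<beta> e y + 2 * (\<Sum>j\<in>UNIV. partial j (cut R) y * tps3 n x \<beta> e j y)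
      + (\<Sum>i\<in>UNIV. \<Sum>j\<in>UNIV. partial i (partial j (cut R)) y * tps2 n x \<beta> e i j y)"
proof -
  let ?F = "tps2 n x \<beta> e"
  have sF: "smooth (?F i j)" for i j by (rule smooth_tps2[OF e])
  have 1: "(\<Sum>j\<in>UNIV. partial j (?F i j) y) = tps3 n x \<beta> e i y" for i y
    using partial_tps2[OF e, of n x \<beta> i y] tps2_commute[of n x \<beta> e] by simp
  have "(\<Sum>i\<in>UNIV. \<Sum>j\<in>UNIV. partial i (partial j (?F i j)) y) = (\<Sum>i\<in>UNIV. partial i (\<lambda>y. \<Sum>j\<in>UNIV. partial j (?F i j) y) y)"
    by (intro sum.cong refl partial_sum[symmetric] smoothD(1) smoothD(2) sF)
  then have 2: "(\<Sum>i\<in>UNIV. \<Sum>j\<in>UNIV. partial i (partial j (?F i j)) y) = tps4 n x \<beta> e y"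
    unfolding 1 using partial_tps3[OF e] by simp
  have "(\<Sum>i\<in>UNIV. \<Sum>j\<in>UNIV. partial i (partial j (\<lambda>y. cut R y * ?F i j y)) y) =
    cut R y * (\<Sum>i\<in>UNIV. \<Sum>j\<in>UNIV. partial i (partial j (?F i j)) y)
    + (\<Sum>i\<in>UNIV. partial i (cut R) y * (\<Sum>j\<in>UNIV. partial j (?F i j) y))
    + (\<Sum>j\<in>UNIV. partial j (cut R) y * (\<Sum>i\<in>UNIV. partial i (?F i j) y))
    + (\<Sum>i\<in>UNIV. \<Sum>j\<in>UNIV. partial i (partial j (cut R)) y * ?F i j y)"
    by (simp add: partial2_mult[OF smooth_cut sF] sum_2 algebra_simps)
  then show ?thesis unfolding 1 2 partial_tps2[OF e] by simp
qed

text \<open>Away from the centres \<open>qreg\<close> is at least 1, so only the factor e^4 of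
  \<open>ker4\<close> remains.\<close>

lemma tps4_far:
  assumes A: "A \<ge> 1" "\<And>r. r \<in> {1..n} \<Longrightarrow> norm (x r) \<le> A" and y: "norm y \<ge> 8 * A"
  shows "\<bar>tps4 n x \<beta> e y\<bar> \<le> (\<Sum>r=1..n. \<bar>\<beta> r\<bar>) * (16 * e ^ 4)"
proof -
  have "\<bar>\<beta> r * ker4 e (y - x r)\<bar> \<le> \<bar>\<beta> r\<bar> * (16 * e ^ 4)" if r: "r \<in> {1..n}" for r
  proof -
    have "norm (y - x r) \<ge> 1" using norm_triangle_ineq2[of y "x r"] A(1) A(2)[OF r] y by linarith
    then have "1 \<le> qreg e (y - x r)" by (simp add: qreg_def dot_square_norm one_le_power add_increasing2)
    then have "1 \<le> (qreg e (y - x r)) ^ 3" by simp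
    then have "\<bar>ker4 e (y - x r)\<bar> \<le> 16 * e ^ 4 / 1" unfolding ker4_def by (intro frac_bound) auto
    then show ?thesis unfolding abs_mult by (intro mult_left_mono) auto
  qed
  then show ?thesis unfolding tps4_def sum_distrib_right by (intro order_trans[OF sum_abs] sum_mono)
qed

text \<open>For t \<le> 2 R one has t^(7/2) \<le> 16 R^(7/2), where 16 = 2^3 * 2. It trades a
  constant bound on a disc for decay in t and retains the factor R^(-1/2).\<close>

lemma sqrt_power_bound:
  assumes "R > 0" "0 < t" "t \<le> 2 * R"
  shows "1 / R ^ 4 \<le> 16 / (sqrt R * (t ^ 3 * sqrt t))"
proof -
  have "t ^ 3 \<le> (2 * R) ^ 3" using assms by (intro power_mono) auto
  moreover have "sqrt t \<le> sqrt (4 * R)" using assms by simp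
  then have "sqrt t \<le> 2 * sqrt R" using assms by (simp add: real_sqrt_mult)
  ultimately have "t ^ 3 * sqrt t \<le> (2 * R) ^ 3 * (2 * sqrt R)" using assms by (intro mult_mono) auto
  then have "sqrt R * (t ^ 3 * sqrt t) \<le> sqrt R * ((2 * R) ^ 3 * (2 * sqrt R))" using assms by (intro mult_left_mono) auto
  also have "\<dots> = 16 * R ^ 3 * (sqrt R * sqrt R)" by (simp add: power_mult_distrib)
  also have "\<dots> = 16 * R ^ 4" using assms by (simp add: power4_eq_xxxx power3_eq_cube)
  finally have "sqrt R * (t ^ 3 * sqrt t) \<le> 16 * R ^ 4" .
  moreover have "sqrt R * (t ^ 3 * sqrt t) > 0" using assms by simp
  ultimately show ?thesis using assms by (simp add: field_simps)
qed

text \<open>The double divergence of the cut-off Hessian is split into \<open>tps4\<close> under a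
  cut-off that stays fixed, which concentrates at the centres, and a remainder \<open>E\<close>
  supported in \<rho> \<le> |y| \<le> 2 R, which \<open>far_source_pairing_small\<close> makes
  negligible.\<close>

theorem tps_pairing:
  assumes gc: "continuous_on UNIV g" and gH: "has_L2_hessian g H" and b: "\<beta> \<in> B_space n x"
  shows "(\<Sum>i\<in>UNIV. \<Sum>j\<in>UNIV. LINT y|lebesgue. H y $ i $ j * tps2 n x \<beta> 0 i j y) = ker4_mass * (\<Sum>r=1..n. \<beta> r * g (x r))"
proof -
  obtain A where A: "A \<ge> 1" "\<And>r. r \<in> {1..n} \<Longrightarrow> norm (x r) \<le> A" using points_bounded by blast
  define S where "S = (\<Sum>r=1..n. \<bar>\<beta> r\<bar>)"
  have S: "S \<ge> 0" unfolding S_def by (intro sum_nonneg) auto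
  \<comment> \<open>8 A is the distance from which the expansions hold. It also exceeds 2, the
    radius within which a far source has to vanish.\<close>
  define \<rho> where "\<rho> = 8 * A"
  have rho: "\<rho> \<ge> 8" "\<rho> > 0" using A by (auto simp: \<rho>_def)
  \<comment> \<open>Tying R to the smoothing scale makes e^4 and R^-4 proportional, so that all
    three parts of \<open>E\<close> have the same order.\<close>
  define R where "R k = \<rho> / eps k" for k
  have R: "R k \<ge> \<rho>" "R k > 0" for k using eps_null_sequence(1,3)[of k] rho by (auto simp: R_def field_simps)
  have eR: "eps k = \<rho> / R k" for k using eps_null_sequence(1)[of k] rho by (simp add: R_def)
  let ?F = "\<lambda>k. tps2 n x \<beta> (eps k)" and ?T3 = "\<lambda>k. tps3 n x \<beta> (eps k)" and ?T4 = "\<lambda>k. tps4 n x \<beta> (eps k)"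
  define \<psi> where "\<psi> k i j y = cut (R k) y * ?F k i j y" for k i j y
  have psi: "\<psi> k i j \<in> test_functions" for k i j
    unfolding \<psi>_def[abs_def]
  proof (rule test_functionsI[of _ "2 * R k"])
    show "smooth (\<lambda>y. cut (R k) y * ?F k i j y)" by (intro smooth_mult smooth_cut smooth_tps2 eps_null_sequence)
    show "cut (R k) y * ?F k i j y = 0" if "norm y > 2 * R k" for y
      using cut_eq_0[OF R(2), of k y] that by simp
  qed
  define E where "E k y = (\<Sum>i\<in>UNIV. \<Sum>j\<in>UNIV. partial i (partial j (\<psi> k i j)) y) - cut \<rho> y * ?T4 k y" for k y
  have Eeq: "E k y = (cut (R k) y - cut \<rho> y) * ?T4 k y + 2 * (\<Sum>j\<in>UNIV. partial j (cut (R k)) y * ?T3 k j y)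
      + (\<Sum>i\<in>UNIV. \<Sum>j\<in>UNIV. partial i (partial j (cut (R k))) y * ?F k i j y)" for k y
    unfolding E_def \<psi>_def[abs_def] cut_double_divergence[OF eps_null_sequence(2)] by (simp add: left_diff_distrib)
  have Es: "smooth (E k)" for k
    unfolding E_def[abs_def]
    by (intro smooth_diff smooth_sum smoothD(2) test_functionsD(1)[OF psi] smooth_mult smooth_cut smooth_tps4 eps_null_sequence)
  have Enear: "E k y = 0" if "norm y < \<rho>" for k y
  proof -
    have "norm y < R k" using that R(1)[of k] by linarith
    then show ?thesis unfolding Eeq
      using that cut_eq_1[OF R(2), of y k] cut_eq_1[OF rho(2), of y] partial_cut_near[OF R(2)] partial2_cut_near[OF R(2)] by simp
  qed
  have Efar: "E k y = 0" if y: "norm y > 2 * R k" for k y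
  proof -
    have "cut (R k) z = 0" if "norm z > 2 * R k" for z using cut_eq_0[OF R(2), of k z] that by simp
    then have "partial j (cut (R k)) z = 0" if "norm z > 2 * R k" for z j
      using partial_vanishes that by metis
    then have "\<psi> k i j z = 0" if "norm z > 2 * R k" for z i j
      using cut_eq_0[OF R(2), of k z] that by (simp add: \<psi>_def)
    then have "partial j (\<psi> k i j) z = 0" if "norm z > 2 * R k" for z i j
      using partial_vanishes[of "2 * R k" "\<psi> k i j"] that by blast
    then have "partial i (partial j (\<psi> k i j)) y = 0" for i j
      using partial_vanishes[of "2 * R k" "partial j (\<psi> k i j)"] y by blast
    moreover have "cut \<rho> y = 0" using cut_eq_0[OF rho(2), of y] y R(1)[of k] by simp
    ultimately show ?thesis by (simp add: E_def)
  qed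
  obtain M where M: "M \<ge> 0" "\<And>R y j. R > 0 \<Longrightarrow> \<bar>partial j (cut R) y\<bar> \<le> M / R"
    "\<And>R y i j. R > 0 \<Longrightarrow> \<bar>partial i (partial j (cut R)) y\<bar> \<le> M / R\<^sup>2" using cut_derivative_bounds by metis
  \<comment> \<open>One summand for each part of \<open>E\<close>; the inner 2 and the 4 count the
    indices j and the pairs (i, j).\<close>
  define C where "C = S * (16 * \<rho> ^ 4) + 2 * (2 * (M * (S * (500 * A\<^sup>2)))) + 4 * (M * (S * (300 * A\<^sup>2)))"
  have C: "C \<ge> 0" using S M rho by (auto simp: C_def intro!: add_nonneg_nonneg mult_nonneg_nonneg)
  have Eb: "\<bar>E k y\<bar> \<le> C / R k ^ 4" for k y
  proof (cases "norm y < \<rho>")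
    case True then show ?thesis using Enear[OF True] C R(2)[of k] by simp
  next
    case False
    then have y: "norm y \<ge> 8 * A" by (simp add: \<rho>_def)
    have "\<bar>cut (R k) y - cut \<rho> y\<bar> \<le> 1" using cut_bounds[of "R k" y] cut_bounds[of \<rho> y] by (auto simp: abs_if)
    then have "\<bar>(cut (R k) y - cut \<rho> y) * ?T4 k y\<bar> \<le> 1 * (S * (16 * (eps k) ^ 4))"
      unfolding abs_mult S_def using tps4_far[OF A y] by (intro mult_mono) auto
    also have "\<dots> = S * (16 * \<rho> ^ 4) / R k ^ 4" by (simp add: eR power_divide)
    finally have t4: "\<bar>(cut (R k) y - cut \<rho> y) * ?T4 k y\<bar> \<le> S * (16 * \<rho> ^ 4) / R k ^ 4" .
    have t3: "\<bar>partial j (cut (R k)) y * ?T3 k j y\<bar> \<le> M * (S * (500 * A\<^sup>2)) / R k ^ 4" for j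
    proof (cases "norm y < R k")
      case True then show ?thesis using partial_cut_near[OF R(2) True] M S R(2)[of k] by simp
    next
      case False
      have "\<bar>?T3 k j y\<bar> \<le> S * (500 * A\<^sup>2) / norm y ^ 3" using tps3_decay[OF b A y eps_null_sequence(3)] by (simp add: S_def)
      also have "\<dots> \<le> S * (500 * A\<^sup>2) / R k ^ 3"
        using False R(2)[of k] S by (intro divide_left_mono power_mono mult_pos_pos zero_less_power) auto
      finally have "\<bar>partial j (cut (R k)) y * ?T3 k j y\<bar> \<le> M / R k * (S * (500 * A\<^sup>2) / R k ^ 3)"
        unfolding abs_mult using M(1) M(2)[OF R(2)] R(2)[of k] by (intro mult_mono) auto
      also have "\<dots> = M * (S * (500 * A\<^sup>2)) / R k ^ 4" by (simp add: power4_eq_xxxx power3_eq_cube)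
      finally show ?thesis .
    qed
    have t2: "\<bar>partial i (partial j (cut (R k))) y * ?F k i j y\<bar> \<le> M * (S * (300 * A\<^sup>2)) / R k ^ 4" for i j
    proof (cases "norm y < R k")
      case True then show ?thesis using partial2_cut_near[OF R(2) True] M S R(2)[of k] by simp
    next
      case False
      have "\<bar>?F k i j y\<bar> \<le> S * (300 * A\<^sup>2) / (norm y)\<^sup>2" using tps2_decay[OF b A y] by (simp add: S_def)
      also have "\<dots> \<le> S * (300 * A\<^sup>2) / (R k)\<^sup>2"
        using False R(2)[of k] S by (intro divide_left_mono power_mono mult_pos_pos zero_less_power) auto
      finally have "\<bar>partial i (partial j (cut (R k))) y * ?F k i j y\<bar> \<le> M / (R k)\<^sup>2 * (S * (300 * A\<^sup>2) / (R k)\<^sup>2)"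
        unfolding abs_mult using M(1) M(3)[OF R(2)] R(2)[of k] by (intro mult_mono) auto
      also have "\<dots> = M * (S * (300 * A\<^sup>2)) / R k ^ 4" by (simp add: power4_eq_xxxx power2_eq_square)
      finally show ?thesis .
    qed
    have "\<bar>\<Sum>j\<in>UNIV. partial j (cut (R k)) y * ?T3 k j y\<bar> \<le> (\<Sum>j\<in>(UNIV::2 set). M * (S * (500 * A\<^sup>2)) / R k ^ 4)"
      by (intro order_trans[OF sum_abs] sum_mono t3)
    then have t3': "\<bar>\<Sum>j\<in>UNIV. partial j (cut (R k)) y * ?T3 k j y\<bar> \<le> 2 * (M * (S * (500 * A\<^sup>2)) / R k ^ 4)" by simp
    have "\<bar>\<Sum>i\<in>UNIV. \<Sum>j\<in>UNIV. partial i (partial j (cut (R k))) y * ?F k i j y\<bar>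
      \<le> (\<Sum>i\<in>(UNIV::2 set). \<Sum>j\<in>(UNIV::2 set). M * (S * (300 * A\<^sup>2)) / R k ^ 4)"
      by (intro order_trans[OF sum_abs] sum_mono order_trans[OF sum_abs] t2)
    then have t2': "\<bar>\<Sum>i\<in>UNIV. \<Sum>j\<in>UNIV. partial i (partial j (cut (R k))) y * ?F k i j y\<bar>
      \<le> 4 * (M * (S * (300 * A\<^sup>2)) / R k ^ 4)" by simp
    have "\<bar>E k y\<bar> \<le> S * (16 * \<rho> ^ 4) / R k ^ 4 + 2 * (2 * (M * (S * (500 * A\<^sup>2)) / R k ^ 4)) + 4 * (M * (S * (300 * A\<^sup>2)) / R k ^ 4)"
      unfolding Eeq using t4 t3' t2' by linarith
    also have "\<dots> = C / R k ^ 4" by (simp add: C_def add_divide_distrib)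
    finally show ?thesis .
  qed
  \<comment> \<open>Smallness within radius 2 R is exchanged for decay; the factor 16 C / sqrt R
    still tends to 0.\<close>
  have Eb2: "\<bar>E k y\<bar> \<le> (16 * C / sqrt (R k)) / (norm y ^ 3 * sqrt (norm y))" if y: "norm y \<ge> 1" for k y
  proof (cases "norm y \<le> 2 * R k")
    case True
    have "C * (1 / R k ^ 4) \<le> C * (16 / (sqrt (R k) * (norm y ^ 3 * sqrt (norm y))))"
      using y True C R(2) by (intro mult_left_mono sqrt_power_bound) auto
    with Eb[of k y] show ?thesis by (simp add: mult.commute)
  next
    case False
    then show ?thesis using Efar[of k y] C R(2)[of k] by simp
  qed
  from far_source_pairing_small[OF gc gH] obtain \<Gamma> where \<Gamma>:
    "\<forall>E T c. smooth E \<longrightarrow> T \<ge> 1 \<longrightarrow> c \<ge> 0 \<longrightarrow> (\<forall>z. norm z < 2 \<longrightarrow> E z = 0) \<longrightarrow> (\<forall>z. norm z \<ge> T \<longrightarrow> E z = 0)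
    \<longrightarrow> (\<forall>z. norm z \<ge> 1 \<longrightarrow> \<bar>E z\<bar> \<le> c / (norm z ^ 3 * sqrt (norm z)))
    \<longrightarrow> \<bar>LINT y|lebesgue. g y * E y\<bar> \<le> c * \<Gamma>" by (rule exE)
  \<comment> \<open>T is 2 R + 1 because \<open>Efar\<close> speaks of |y| > 2 R only, while a far
    source has to vanish from T on, T included.\<close>
  have bnd: "\<bar>LINT y|lebesgue. g y * E k y\<bar> \<le> 16 * C / sqrt (R k) * \<Gamma>" for k
  proof (rule \<Gamma>[rule_format, OF Es, of "2 * R k + 1"])
    show "2 * R k + 1 \<ge> 1" "16 * C / sqrt (R k) \<ge> 0" using R[of k] C by auto
    show "E k z = 0" if "norm z < 2" for z using Enear[of z k] that rho by simp
    show "E k z = 0" if "norm z \<ge> 2 * R k + 1" for z using Efar[of k z] that by simp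
  qed (rule Eb2)
  have "(\<lambda>k. sqrt (eps k)) \<longlonglongrightarrow> sqrt 0" by (intro tendsto_real_sqrt eps_null_sequence)
  then have "(\<lambda>k. 16 * C / sqrt \<rho> * sqrt (eps k) * \<Gamma>) \<longlonglongrightarrow> 16 * C / sqrt \<rho> * sqrt 0 * \<Gamma>"
    by (intro tendsto_mult tendsto_const)
  moreover have "16 * C / sqrt (R k) * \<Gamma> = 16 * C / sqrt \<rho> * sqrt (eps k) * \<Gamma>" for k
    using eps_null_sequence(1)[of k] rho by (simp add: R_def real_sqrt_divide)
  ultimately have "(\<lambda>k. 16 * C / sqrt (R k) * \<Gamma>) \<longlonglongrightarrow> 0" by simp
  then have lim_E: "(\<lambda>k. LINT y|lebesgue. g y * E k y) \<longlonglongrightarrow> 0"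
    by (rule Lim_null_comparison[rotated]) (intro always_eventually allI, unfold real_norm_def, rule bnd)
  \<comment> \<open>The fixed cut-off makes g bounded, as \<open>ker4_approximate_identity\<close>
    requires, and is 1 at the centres.\<close>
  have lim_delta: "(\<lambda>k. LINT y|lebesgue. (g y * cut \<rho> y) * ?T4 k y) \<longlonglongrightarrow> ker4_mass * (\<Sum>r=1..n. \<beta> r * g (x r))"
  proof -
    have hc: "continuous_on UNIV (\<lambda>y. g y * cut \<rho> y)" by (intro continuous_intros gc smoothD(3) smooth_cut)
    obtain Mg where Mg: "\<And>y. \<bar>g y * cut \<rho> y\<bar> \<le> Mg"
      using compact_support_bounded[OF hc, of "2 * \<rho>"] cut_eq_0[OF rho(2)] by (metis less_imp_le mult_zero_right)
    have cutt: "cut \<rho> \<in> test_functions"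
      by (rule test_functionsI[of _ "2 * \<rho>"]) (auto simp: smooth_cut cut_eq_0 rho)
    have sk: "smooth (\<lambda>y. ker4 (eps k) (y - x r))" for k r by (rule smooth_shift[OF smooth_ker(5)[OF eps_null_sequence(2)]])
    have int: "integrable lborel (\<lambda>y. (g y * cut \<rho> y) * ker4 (eps k) (y - x r))" for k r
    proof -
      have "integrable lborel (\<lambda>y. g y * (cut \<rho> y * ker4 (eps k) (y - x r)))"
        by (intro cont_test_integrable gc test_mult' cutt sk)
      then show ?thesis by (simp add: mult.assoc)
    qed
    have eq: "(LINT y|lebesgue. (g y * cut \<rho> y) * ?T4 k y) = (\<Sum>r=1..n. \<beta> r * (LINT y|lborel. (g y * cut \<rho> y) * ker4 (eps k) (y - x r)))" for k
    proof -
      have eq1: "(\<lambda>y. (g y * cut \<rho> y) * ?T4 k y) = (\<lambda>y. \<Sum>r=1..n. \<beta> r * ((g y * cut \<rho> y) * ker4 (eps k) (y - x r)))"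
        by (simp add: tps4_def sum_distrib_left mult_ac fun_eq_iff)
      have "(\<lambda>y. (g y * cut \<rho> y) * ?T4 k y) \<in> borel_measurable borel"
        by (intro borel_measurable_times borel_measurable_continuous_onI gc smooth_borel smooth_cut smooth_tps4 eps_null_sequence)
      then show ?thesis using int by (simp add: lebesgue_eq_lborel(1)) (simp add: eq1 int)
    qed
    have "(\<lambda>k. \<Sum>r=1..n. \<beta> r * (LINT y|lborel. (g y * cut \<rho> y) * ker4 (eps k) (y - x r)))
       \<longlonglongrightarrow> (\<Sum>r=1..n. \<beta> r * (ker4_mass * (g (x r) * cut \<rho> (x r))))"
      by (intro tendsto_intros ker4_approximate_identity[OF hc Mg])
    moreover have "cut \<rho> (x r) = 1" if "r \<in> {1..n}" for r using A(2)[OF that] A(1) rho by (intro cut_eq_1) (auto simp: \<rho>_def)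
    ultimately show ?thesis unfolding eq by (simp add: sum_distrib_left mult_ac)
  qed
  have intE: "integrable lebesgue (\<lambda>y. g y * E k y)" for k
  proof -
    have "E k \<in> test_functions" using Es Efar by (rule test_functionsI)
    then show ?thesis by (intro integrable_lborel_lebesgue cont_test_integrable gc)
  qed
  have intd: "integrable lebesgue (\<lambda>y. (g y * cut \<rho> y) * ?T4 k y)" for k
  proof -
    have "(\<lambda>y. cut \<rho> y * ?T4 k y) \<in> test_functions"
      by (rule test_functionsI[of _ "2 * \<rho>"]) (auto intro!: smooth_mult smooth_cut smooth_tps4 eps_null_sequence simp: cut_eq_0 rho)
    from integrable_lborel_lebesgue[OF cont_test_integrable[OF gc this]] show ?thesis by (simp add: mult.assoc)
  qed
  have "(\<Sum>i\<in>UNIV. \<Sum>j\<in>UNIV. LINT y|lebesgue. H y $ i $ j * \<psi> k i j y) =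
    (LINT y|lebesgue. (g y * cut \<rho> y) * ?T4 k y) + (LINT y|lebesgue. g y * E k y)" for k
  proof -
    have "g y * (\<Sum>i\<in>UNIV. \<Sum>j\<in>UNIV. partial i (partial j (\<psi> k i j)) y) = (g y * cut \<rho> y) * ?T4 k y + g y * E k y" for y
      by (simp add: E_def algebra_simps)
    then show ?thesis using hessian_pairing_double_divergence[OF gc gH, of "\<psi> k", OF psi] intE[of k] intd[of k] by simp
  qed
  then have lim1: "(\<lambda>k. \<Sum>i\<in>UNIV. \<Sum>j\<in>UNIV. LINT y|lebesgue. H y $ i $ j * \<psi> k i j y)
     \<longlonglongrightarrow> ker4_mass * (\<Sum>r=1..n. \<beta> r * g (x r))"
    using tendsto_add[OF lim_delta lim_E] by simp
  obtain D where D: "D \<in> L2" "\<And>y. 0 \<le> D y" "\<And>e i j y. \<bar>e\<bar> \<le> 1 \<Longrightarrow> y \<notin> x ` {1..n} \<Longrightarrow> \<bar>tps2 n x \<beta> e i j y\<bar> \<le> D y"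
    using tps2_dominated[OF b] by blast
  have HL: "(\<lambda>y. H y $ i $ j) \<in> L2" for i j using gH by (simp add: has_L2_hessian_def)
  have "(\<lambda>k. LINT y|lebesgue. H y $ i $ j * \<psi> k i j y) \<longlonglongrightarrow> (LINT y|lebesgue. H y $ i $ j * tps2 n x \<beta> 0 i j y)" for i j
  proof (rule integral_dominated_convergence)
    show "integrable lebesgue (\<lambda>y. norm (H y $ i $ j * D y))" by (intro integrable_norm L2_mult_integrable HL D)
    show "(\<lambda>y. H y $ i $ j * \<psi> k i j y) \<in> borel_measurable lebesgue" for k
      by (intro borel_measurable_times L2_D(1) HL test_L2 psi)
    show "(\<lambda>y. H y $ i $ j * tps2 n x \<beta> 0 i j y) \<in> borel_measurable lebesgue"
      by (intro borel_measurable_times L2_D(1) HL tps2_L2 b) simp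
    show "AE y in lebesgue. (\<lambda>k. H y $ i $ j * \<psi> k i j y) \<longlonglongrightarrow> H y $ i $ j * tps2 n x \<beta> 0 i j y"
      using AE_not_points[of x n]
    proof eventually_elim
      case (elim y)
      \<comment> \<open>For fixed y the cut-off is eventually 1, because \<open>R k\<close> tends to
        infinity.\<close>
      have "(\<lambda>k. norm y * eps k) \<longlonglongrightarrow> norm y * 0" by (intro tendsto_intros eps_null_sequence)
      then have "\<forall>\<^sub>F k in sequentially. norm y * eps k < \<rho>" using rho by (intro order_tendstoD) auto
      then have ev: "\<forall>\<^sub>F k in sequentially. H y $ i $ j * ?F k i j y = H y $ i $ j * \<psi> k i j y"
      proof eventually_elim
        case (elim k)
        then have "norm y \<le> R k" using eps_null_sequence(1)[of k] by (simp add: R_def field_simps)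
        then show ?case using cut_eq_1[OF R(2)] by (simp add: \<psi>_def)
      qed
      have "(\<lambda>k. H y $ i $ j * ?F k i j y) \<longlonglongrightarrow> H y $ i $ j * tps2 n x \<beta> 0 i j y"
        by (intro tendsto_intros tps2_tendsto eps_null_sequence elim)
      then show ?case using ev by (rule Lim_transform_eventually)
    qed
    show "AE y in lebesgue. norm (H y $ i $ j * \<psi> k i j y) \<le> norm (H y $ i $ j * D y)" for k
      using AE_not_points[of x n]
    proof eventually_elim
      case (elim y)
      have "\<bar>cut (R k) y\<bar> * \<bar>?F k i j y\<bar> \<le> 1 * D y"
        using cut_bounds[of "R k" y] D(3)[OF eps_null_sequence(3) elim] by (intro mult_mono) auto
      then show ?case using D(2)[of y] unfolding real_norm_def abs_mult \<psi>_def by (intro mult_left_mono) auto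
    qed
  qed
  then have "(\<lambda>k. \<Sum>i\<in>UNIV. \<Sum>j\<in>UNIV. LINT y|lebesgue. H y $ i $ j * \<psi> k i j y)
    \<longlonglongrightarrow> (\<Sum>i\<in>UNIV. \<Sum>j\<in>UNIV. LINT y|lebesgue. H y $ i $ j * tps2 n x \<beta> 0 i j y)"
    by (intro tendsto_sum)
  then show ?thesis using lim1 by (rule LIMSEQ_unique)
qed

section \<open>The Hessian inner product and interpolation\<close>

lemma Sob_hessian: "g \<in> Sob \<Longrightarrow> has_L2_hessian g (hessian g)"
  using someI_ex[of "has_L2_hessian g"] by (simp add: Sob_def hessian_def)

lemma Sob_continuous: "g \<in> Sob \<Longrightarrow> continuous_on UNIV g"
  by (simp add: Sob_def)

text \<open>The fundamental lemma, applied to the difference. It makes the choice inside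
  \<open>hessian\<close> harmless: integrals may be computed with any representative.\<close>

lemma has_L2_hessian_unique:
  assumes "has_L2_hessian g H" "has_L2_hessian g H'"
  shows "AE y in lebesgue. H y $ i $ j = H' y $ i $ j"
proof -
  have L: "(\<lambda>y. H y $ i $ j) \<in> L2" "(\<lambda>y. H' y $ i $ j) \<in> L2" using assms by (auto simp: has_L2_hessian_def)
  have "AE y in lebesgue. H y $ i $ j - H' y $ i $ j = 0"
  proof (rule AE_0_if_test_integrals_0)
    show "(\<lambda>y. H y $ i $ j - H' y $ i $ j) \<in> L2" by (rule L2_diff[OF L])
    fix \<phi> :: "real^2 \<Rightarrow> real" assume p: "\<phi> \<in> test_functions"
    have "(LINT y|lebesgue. H y $ i $ j * \<phi> y) = (LINT y|lebesgue. H' y $ i $ j * \<phi> y)"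
      using assms p by (simp add: has_L2_hessian_def)
    then show "(LINT y|lebesgue. (H y $ i $ j - H' y $ i $ j) * \<phi> y) = 0"
      using L2_mult_integrable[OF L(1) test_L2[OF p]] L2_mult_integrable[OF L(2) test_L2[OF p]]
      by (simp add: left_diff_distrib)
  qed
  then show ?thesis by eventually_elim simp
qed

lemma has_L2_hessian_add_scaled:
  assumes g: "continuous_on UNIV g" "has_L2_hessian g H" and h: "continuous_on UNIV h" "has_L2_hessian h H'"
  shows "has_L2_hessian (\<lambda>y. g y + c * h y) (\<lambda>y. H y + c *\<^sub>R H' y)"
  unfolding has_L2_hessian_def
proof (intro allI conjI ballI)
  fix i j
  have L: "(\<lambda>y. H y $ i $ j) \<in> L2" "(\<lambda>y. H' y $ i $ j) \<in> L2" using g h by (auto simp: has_L2_hessian_def)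
  show "(\<lambda>y. (H y + c *\<^sub>R H' y) $ i $ j) \<in> L2" using L2_add[OF L(1) L2_cmult[OF L(2)]] by simp
  fix \<phi> assume p: "\<phi> \<in> test_functions"
  have pp: "partial i (partial j \<phi>) \<in> test_functions" using p by (intro test_partial)
  have "(LINT y|lebesgue. (g y + c * h y) * partial i (partial j \<phi>) y) =
    (LINT y|lebesgue. g y * partial i (partial j \<phi>) y) + c * (LINT y|lebesgue. h y * partial i (partial j \<phi>) y)"
    using integrable_lborel_lebesgue[OF cont_test_integrable[OF g(1) pp]]
      integrable_lborel_lebesgue[OF cont_test_integrable[OF h(1) pp]]
    by (simp add: distrib_right mult.assoc)
  also have "\<dots> = (LINT y|lebesgue. H y $ i $ j * \<phi> y) + c * (LINT y|lebesgue. H' y $ i $ j * \<phi> y)"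
    using g h p by (simp add: has_L2_hessian_def)
  also have "\<dots> = (LINT y|lebesgue. (H y + c *\<^sub>R H' y) $ i $ j * \<phi> y)"
    using L2_mult_integrable[OF L(1) test_L2[OF p]] L2_mult_integrable[OF L(2) test_L2[OF p]]
    by (simp add: distrib_right mult.assoc)
  finally show "(LINT y|lebesgue. (g y + c * h y) * partial i (partial j \<phi>) y) =
    (LINT y|lebesgue. (H y + c *\<^sub>R H' y) $ i $ j * \<phi> y)" .
qed

lemma Sob_add_scaled: "g \<in> Sob \<Longrightarrow> h \<in> Sob \<Longrightarrow> (\<lambda>y. g y + c * h y) \<in> Sob"
  using has_L2_hessian_add_scaled[of g "hessian g" h "hessian h" c] Sob_hessian
  by (auto simp: Sob_def intro!: continuous_intros)

lemma Sob_zero: "(\<lambda>y. 0) \<in> Sob"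
  by (auto simp: Sob_def has_L2_hessian_def L2_zero intro!: exI[of _ "\<lambda>y. 0"])

lemma Sob_sum: "(\<And>r. r \<in> A \<Longrightarrow> g r \<in> Sob) \<Longrightarrow> (\<lambda>y. \<Sum>r\<in>A. w r * g r y) \<in> Sob"
proof (induction A rule: infinite_finite_induct)
  case (insert a A)
  then have "(\<lambda>y. (\<Sum>r\<in>A. w r * g r y) + w a * g a y) \<in> Sob" by (intro Sob_add_scaled) auto
  with insert show ?case by (simp add: add.commute)
qed (auto simp: Sob_zero)

text \<open>Supplies the localized members of \<open>Sob\<close> that separate points. The
  derivatives are ordered as \<open>integration_by_parts_2\<close> delivers them.\<close>

lemma test_Sob: "\<phi> \<in> test_functions \<Longrightarrow> \<phi> \<in> Sob"
proof -
  assume p: "\<phi> \<in> test_functions"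
  note s = test_functionsD(1)[OF p]
  have "has_L2_hessian \<phi> (\<lambda>y. \<chi> i j. partial j (partial i \<phi>) y)"
    unfolding has_L2_hessian_def
  proof (intro allI conjI ballI)
    fix i j
    have pp: "partial j (partial i \<phi>) \<in> test_functions" using p by (intro test_partial)
    show "(\<lambda>y. (\<chi> i j. partial j (partial i \<phi>) y) $ i $ j) \<in> L2" using test_L2[OF pp] by simp
    fix u assume u: "u \<in> test_functions"
    note su = test_functionsD(1)[OF u]
    have "(\<lambda>y. \<phi> y * partial i (partial j u) y) \<in> borel_measurable borel"
      "(\<lambda>y. partial j (partial i \<phi>) y * u y) \<in> borel_measurable borel"
      by (intro smooth_borel smooth_mult smoothD(2) s su)+
    then show "(LINT y|lebesgue. \<phi> y * partial i (partial j u) y) = (LINT y|lebesgue. (\<chi> i j. partial j (partial i \<phi>) y) $ i $ j * u y)"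
      using integration_by_parts_2[OF s u, of i j] by (simp add: lebesgue_eq_lborel(1))
  qed
  then show "\<phi> \<in> Sob" using smoothD(3)[OF s] by (auto simp: Sob_def)
qed

text \<open>The semi-inner product on \<open>Sob\<close> whose quadratic form is
  \<open>penalty\<close>.\<close>

definition hpair :: "(real^2 \<Rightarrow> real) \<Rightarrow> (real^2 \<Rightarrow> real) \<Rightarrow> real" where
  "hpair g h = (\<Sum>i\<in>UNIV. \<Sum>j\<in>UNIV. LINT y|lebesgue. hessian g y $ i $ j * hessian h y $ i $ j)"

lemma hessian_L2: "g \<in> Sob \<Longrightarrow> (\<lambda>y. hessian g y $ i $ j) \<in> L2"
  using Sob_hessian by (simp add: has_L2_hessian_def)

text \<open>Two representatives agree almost everywhere, hence so do the products. The entries of h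
  come first, to match \<open>tps_pairing\<close>.\<close>

lemma hpair_eq:
  assumes g: "g \<in> Sob" "has_L2_hessian g G" and h: "h \<in> Sob" "has_L2_hessian h H"
  shows "hpair g h = (\<Sum>i\<in>UNIV. \<Sum>j\<in>UNIV. LINT y|lebesgue. H y $ i $ j * G y $ i $ j)"
  unfolding hpair_def
proof (intro sum.cong refl integral_cong_AE)
  fix i j
  have L: "(\<lambda>y. H y $ i $ j) \<in> L2" "(\<lambda>y. G y $ i $ j) \<in> L2" using g h by (auto simp: has_L2_hessian_def)
  show "(\<lambda>y. hessian g y $ i $ j * hessian h y $ i $ j) \<in> borel_measurable lebesgue"
    by (intro borel_measurable_times L2_D(1) hessian_L2 g h)
  show "(\<lambda>y. H y $ i $ j * G y $ i $ j) \<in> borel_measurable lebesgue"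
    by (intro borel_measurable_times L2_D(1) L)
  show "AE y in lebesgue. hessian g y $ i $ j * hessian h y $ i $ j = H y $ i $ j * G y $ i $ j"
    using has_L2_hessian_unique[OF Sob_hessian[OF g(1)] g(2), of i j]
      has_L2_hessian_unique[OF Sob_hessian[OF h(1)] h(2), of i j]
    by eventually_elim simp
qed

lemma hpair_commute: "hpair g h = hpair h g"
  by (simp add: hpair_def mult.commute)

lemma hpair_add_scaled:
  assumes g: "g \<in> Sob" and h: "h \<in> Sob" and u: "u \<in> Sob"
  shows "hpair u (\<lambda>y. g y + c * h y) = hpair u g + c * hpair u h"
proof -
  have i: "integrable lebesgue (\<lambda>y. hessian v y $ i $ j * hessian u y $ i $ j)" if "v \<in> Sob" for v i j
    by (intro L2_mult_integrable hessian_L2 that u)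
  have "hpair u (\<lambda>y. g y + c * h y) =
    (\<Sum>i\<in>UNIV. \<Sum>j\<in>UNIV. LINT y|lebesgue. (hessian g y + c *\<^sub>R hessian h y) $ i $ j * hessian u y $ i $ j)"
    by (rule hpair_eq[OF u Sob_hessian[OF u] Sob_add_scaled[OF g h]])
       (intro has_L2_hessian_add_scaled Sob_hessian Sob_continuous g h)
  also have "\<dots> = hpair u g + c * hpair u h"
    using i[OF g] i[OF h]
    by (simp add: hpair_def distrib_right mult.assoc sum.distrib sum_distrib_left) (simp add: mult.commute)
  finally show ?thesis .
qed

lemma hpair_zero: "u \<in> Sob \<Longrightarrow> hpair u (\<lambda>y. 0) = 0"
  using hpair_add_scaled[of "\<lambda>y. 0" "\<lambda>y. 0" u "-1"] by (simp add: Sob_zero)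

lemma hpair_sum:
  assumes "\<And>r. r \<in> A \<Longrightarrow> g r \<in> Sob" and u: "u \<in> Sob"
  shows "hpair u (\<lambda>y. \<Sum>r\<in>A. w r * g r y) = (\<Sum>r\<in>A. w r * hpair u (g r))"
  using assms(1)
proof (induction A rule: infinite_finite_induct)
  case (insert a A)
  have "hpair u (\<lambda>y. (\<Sum>r\<in>A. w r * g r y) + w a * g a y) = hpair u (\<lambda>y. \<Sum>r\<in>A. w r * g r y) + w a * hpair u (g a)"
    using insert.prems by (intro hpair_add_scaled Sob_sum u) auto
  with insert show ?case by (simp add: add.commute)
qed (auto simp: hpair_zero u)

lemma penalty_eq: "g \<in> Sob \<Longrightarrow> penalty g = hpair g g"
proof -
  assume g: "g \<in> Sob"
  have "(norm (hessian g y))\<^sup>2 = (\<Sum>i\<in>UNIV. \<Sum>j\<in>UNIV. hessian g y $ i $ j * hessian g y $ i $ j)" for y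
    by (simp add: power2_norm_eq_inner inner_vec_def)
  moreover have "integrable lebesgue (\<lambda>y. hessian g y $ i $ j * hessian g y $ i $ j)" for i j
    by (intro L2_mult_integrable hessian_L2 g)
  ultimately show ?thesis
    by (simp add: penalty_def hpair_def Bochner_Integration.integral_sum Bochner_Integration.integrable_sum)
qed

lemma penalty_nonneg: "penalty g \<ge> 0"
  unfolding penalty_def by (rule integral_nonneg_AE) simp

lemma penalty_add:
  assumes "g \<in> Sob" "h \<in> Sob"
  shows "penalty (\<lambda>y. g y + h y) = penalty g + 2 * hpair g h + penalty h"
proof -
  have s: "(\<lambda>y. g y + 1 * h y) \<in> Sob" by (rule Sob_add_scaled[OF assms])
  have "penalty (\<lambda>y. g y + 1 * h y) = hpair (\<lambda>y. g y + 1 * h y) g + 1 * hpair (\<lambda>y. g y + 1 * h y) h"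
    using hpair_add_scaled[OF assms s, of 1] penalty_eq[OF s] by simp
  also have "\<dots> = hpair g g + hpair g h + (hpair h g + hpair h h)"
    using hpair_add_scaled[OF assms assms(1), of 1] hpair_add_scaled[OF assms assms(2), of 1]
    by (simp add: hpair_commute[of "\<lambda>y. g y + h y"])
  finally show ?thesis using assms by (simp add: penalty_eq hpair_commute[of h g])
qed

lemma penalty_zero_hessian:
  assumes g: "g \<in> Sob" "penalty g = 0"
  shows "has_L2_hessian g (\<lambda>y. 0)"
proof -
  have i: "integrable lebesgue (\<lambda>y. (hessian g y $ i $ j)\<^sup>2)" for i j by (intro L2_D(2) hessian_L2 g)
  let ?I = "\<lambda>i j. LINT y|lebesgue. (hessian g y $ i $ j)\<^sup>2"
  have nn: "?I i j \<ge> 0" for i j by simp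
  have "(\<Sum>i\<in>UNIV. \<Sum>j\<in>UNIV. ?I i j) = 0"
    using g by (simp add: penalty_eq hpair_def power2_eq_square)
  then have I: "?I i j = 0" for i j
    using nn by (simp add: sum_nonneg_eq_0_iff sum_nonneg)
  have ae: "AE y in lebesgue. hessian g y $ i $ j = 0" for i j
  proof -
    have "AE y in lebesgue. (hessian g y $ i $ j)\<^sup>2 = 0"
      using integral_nonneg_eq_0_iff_AE[OF i[of i j]] I[of i j] by simp
    then show ?thesis by eventually_elim simp
  qed
  show ?thesis unfolding has_L2_hessian_def
  proof (intro allI conjI ballI)
    fix i j and \<phi> :: "real^2 \<Rightarrow> real" assume p: "\<phi> \<in> test_functions"
    have "(LINT y|lebesgue. hessian g y $ i $ j * \<phi> y) = (LINT y|lebesgue. (0 :: real^2^2) $ i $ j * \<phi> y)"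
    proof (rule integral_cong_AE)
      show "(\<lambda>y. hessian g y $ i $ j * \<phi> y) \<in> borel_measurable lebesgue"
        by (intro borel_measurable_times L2_D(1) hessian_L2 g test_L2 p)
      show "AE y in lebesgue. hessian g y $ i $ j * \<phi> y = (0 :: real^2^2) $ i $ j * \<phi> y"
        using ae[of i j] by eventually_elim simp
    qed simp
    then show "(LINT y|lebesgue. g y * partial i (partial j \<phi>) y) = (LINT y|lebesgue. (0 :: real^2^2) $ i $ j * \<phi> y)"
      using Sob_hessian[OF g(1)] p by (simp add: has_L2_hessian_def)
  qed (simp add: L2_zero)
qed

text \<open>The left side of \<open>tps_pairing\<close> is 0, and the positive mass can be divided
  out.\<close>

lemma zero_hessian_functional:
  assumes "continuous_on UNIV g" "has_L2_hessian g (\<lambda>y. 0)" "\<beta> \<in> B_space n x"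
  shows "(\<Sum>r=1..n. \<beta> r * g (x r)) = 0"
  using tps_pairing[OF assms] ker4_mass_pos by simp

text \<open>Additivity and homogeneity of g - g 0 are linear relations between values of g whose
  coefficients lie in a suitable \<open>B_space\<close>. Some of the points may coincide, which
  \<open>tps_pairing\<close> permits.\<close>

lemma zero_hessian_affine:
  assumes g: "continuous_on UNIV g" "has_L2_hessian g (\<lambda>y. 0)"
  shows "\<exists>\<alpha>1 \<alpha>0. \<forall>y. g y = \<alpha>1 \<bullet> y + \<alpha>0"
proof -
  have add: "g (u + v) - g u - g v + g 0 = 0" for u v
  proof -
    \<comment> \<open>The weights 1, -1, -1, 1 at u + v, u, v, 0 satisfy both moment
      conditions.\<close>
    define x where "x r = (if r = 1 then u + v else if r = 2 then u else if r = 3 then v else 0)" for r :: nat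
    define \<beta> where "\<beta> r = (if r = 1 \<or> r = 4 then 1 else -1 :: real)" for r :: nat
    have I: "{1..4::nat} = {1, 2, 3, 4}" by auto
    have "\<beta> \<in> B_space 4 x" unfolding B_space_def I x_def \<beta>_def by simp
    from zero_hessian_functional[OF g this] show ?thesis unfolding I x_def \<beta>_def by simp
  qed
  have scale: "g (t *\<^sub>R u) - t * g u - (1 - t) * g 0 = 0" for t u
  proof -
    \<comment> \<open>Likewise the weights 1, - t, - (1 - t) at t u, u, 0.\<close>
    define x where "x r = (if r = 1 then t *\<^sub>R u else if r = 2 then u else 0)" for r :: nat
    define \<beta> where "\<beta> r = (if r = 1 then 1 else if r = 2 then - t else - (1 - t) :: real)" for r :: nat
    have I: "{1..3::nat} = {1, 2, 3}" by auto
    have "\<beta> \<in> B_space 3 x" unfolding B_space_def I x_def \<beta>_def by simp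
    from zero_hessian_functional[OF g this] show ?thesis unfolding I x_def \<beta>_def by (simp add: algebra_simps)
  qed
  have lin: "linear (\<lambda>y. g y - g 0)"
  proof (rule linearI)
    show "g (u + v) - g 0 = (g u - g 0) + (g v - g 0)" for u v using add[of u v] by linarith
    show "g (t *\<^sub>R u) - g 0 = t *\<^sub>R (g u - g 0)" for t u using scale[of t u] by (simp add: algebra_simps)
  qed
  define \<alpha>1 where "\<alpha>1 = (\<chi> i. g (axis i 1) - g 0)"
  have "g y = \<alpha>1 \<bullet> y + g 0" for y
  proof -
    have "g y - g 0 = (\<lambda>y. g y - g 0) (\<Sum>i\<in>UNIV. (y $ i) *\<^sub>R axis i 1)"
      using basis_expansion[of y] by (simp add: scalar_mult_eq_scaleR)
    also have "\<dots> = (\<Sum>i\<in>UNIV. y $ i * (g (axis i 1) - g 0))"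
      using linear_sum[OF lin, of "\<lambda>i. (y $ i) *\<^sub>R axis i 1" UNIV] linear_scale[OF lin] by simp
    finally show ?thesis by (simp add: \<alpha>1_def inner_vec_def mult.commute)
  qed
  then show ?thesis by blast
qed

section \<open>The space of thin-plate splines\<close>

lemma tps_iff: "thin_plate_spline n x g \<longleftrightarrow> (\<exists>\<beta>\<in>B_space n x. \<exists>\<alpha>1 \<alpha>0. g = tps0 n x \<beta> \<alpha>1 \<alpha>0 0)"
  by (simp add: thin_plate_spline_def tps0_def fun_eq_iff ker0_eq_K)

lemma tps_Sob: "\<beta> \<in> B_space n x \<Longrightarrow> tps0 n x \<beta> \<alpha>1 \<alpha>0 0 \<in> Sob"
  using tps_has_L2_hessian[of \<beta> n x \<alpha>1 \<alpha>0] continuous_tps unfolding Sob_def by blast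

lemma thin_plate_spline_Sob: "thin_plate_spline n x g \<Longrightarrow> g \<in> Sob"
  by (auto simp: tps_iff tps_Sob)

text \<open>The reproducing property: pairing with a spline sees h only through its values at the
  points.\<close>

lemma hpair_tps:
  assumes "\<beta> \<in> B_space n x" "h \<in> Sob"
  shows "hpair (tps0 n x \<beta> \<alpha>1 \<alpha>0 0) h = ker4_mass * (\<Sum>r=1..n. \<beta> r * h (x r))"
  using hpair_eq[OF tps_Sob[OF assms(1)] tps_has_L2_hessian[OF assms(1)] assms(2) Sob_hessian[OF assms(2)], of \<alpha>1 \<alpha>0]
    tps_pairing[OF Sob_continuous[OF assms(2)] Sob_hessian[OF assms(2)] assms(1)]
  by simp

lemma B_space_add_scaled: "\<beta> \<in> B_space n x \<Longrightarrow> \<gamma> \<in> B_space n x \<Longrightarrow> (\<lambda>r. \<beta> r + c * \<gamma> r) \<in> B_space n x"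
  by (simp add: B_space_def sum.distrib scaleR_add_left flip: sum_distrib_left scaleR_scaleR scaleR_sum_right)

lemma thin_plate_spline_add_scaled:
  assumes "thin_plate_spline n x g" "thin_plate_spline n x h"
  shows "thin_plate_spline n x (\<lambda>y. g y + c * h y)"
proof -
  obtain \<beta> \<alpha>1 \<alpha>0 where g: "\<beta> \<in> B_space n x" "g = tps0 n x \<beta> \<alpha>1 \<alpha>0 0" using assms(1) by (auto simp: tps_iff)
  obtain \<gamma> \<delta>1 \<delta>0 where h: "\<gamma> \<in> B_space n x" "h = tps0 n x \<gamma> \<delta>1 \<delta>0 0" using assms(2) by (auto simp: tps_iff)
  have "(\<lambda>y. g y + c * h y) = tps0 n x (\<lambda>r. \<beta> r + c * \<gamma> r) (\<alpha>1 + c *\<^sub>R \<delta>1) (\<alpha>0 + c * \<delta>0) 0"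
    by (simp add: g h tps0_def fun_eq_iff distrib_left distrib_right sum.distrib sum_distrib_left inner_add_left mult_ac)
  then show ?thesis using B_space_add_scaled[OF g(1) h(1)] by (auto simp: tps_iff)
qed

lemma thin_plate_spline_affine: "thin_plate_spline n x (\<lambda>y. \<alpha>1 \<bullet> y + \<alpha>0)"
  unfolding thin_plate_spline_def
  by (rule bexI[of _ "\<lambda>_. 0"]) (auto simp: B_space_def)

lemma thin_plate_spline_sum:
  "(\<And>r. r \<in> A \<Longrightarrow> thin_plate_spline n x (g r)) \<Longrightarrow> thin_plate_spline n x (\<lambda>y. \<Sum>r\<in>A. w r * g r y)"
proof (induction A rule: infinite_finite_induct)
  case (insert a A)
  then have "thin_plate_spline n x (\<lambda>y. (\<Sum>r\<in>A. w r * g r y) + w a * g a y)"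
    by (intro thin_plate_spline_add_scaled) auto
  with insert show ?case by (simp add: add.commute)
qed (use thin_plate_spline_affine[of n x 0 0] in auto)

text \<open>A rescaled cut-off around a; the factor 2 / d takes points at distance d to norm 2,
  where \<open>cutoff\<close> vanishes.\<close>

lemma Sob_separates:
  assumes "finite P"
  shows "\<exists>h\<in>Sob. h a = 1 \<and> (\<forall>p\<in>P. p \<noteq> a \<longrightarrow> h p = 0)"
proof -
  obtain d where d: "d > 0" "\<And>p. p \<in> P \<Longrightarrow> p \<noteq> a \<Longrightarrow> d \<le> dist a p"
    using finite_set_avoid[OF assms, of a] by blast
  define h where "h y = cutoff ((2 / d) *\<^sub>R y + (- (2 / d) *\<^sub>R a))" for y
  have h: "h y = cutoff ((2 / d) *\<^sub>R (y - a))" for y by (simp add: h_def algebra_simps)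
  have far: "h y = 0" if "norm (y - a) \<ge> d" for y
  proof -
    have "2 / d * d \<le> 2 / d * norm (y - a)" using d(1) that by (intro mult_left_mono) auto
    then show ?thesis unfolding h using d(1) by (intro cutoff_eq_0) (simp only: norm_scaleR, simp)
  qed
  have "h \<in> test_functions"
  proof (rule test_functionsI[of _ "norm a + d"])
    show "smooth h" unfolding h_def[abs_def] by (rule smooth_affine_arg[OF smooth_cutoff])
    show "h y = 0" if "norm y > norm a + d" for y
      by (rule far) (use that norm_triangle_ineq2[of y a] in linarith)
  qed
  moreover have "h a = 1" by (simp add: h cutoff_eq_1)
  moreover have "h p = 0" if "p \<in> P" "p \<noteq> a" for p
    using d(2)[OF that] by (intro far) (simp add: dist_norm norm_minus_commute)
  ultimately show ?thesis using test_Sob by blast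
qed

text \<open>The Fredholm alternative for finite systems, possibly singular, by induction on the set
  of columns.\<close>

lemma linear_system_alternative:
  fixes A :: "'i \<Rightarrow> 'j \<Rightarrow> real"
  assumes "finite I" "finite J"
  shows "(\<exists>c. \<forall>i\<in>I. (\<Sum>j\<in>J. c j * A i j) = z i) \<or>
    (\<exists>w. (\<forall>j\<in>J. (\<Sum>i\<in>I. w i * A i j) = 0) \<and> (\<Sum>i\<in>I. w i * z i) \<noteq> 0)"
  using assms(2)
proof (induction J arbitrary: z rule: finite_induct)
  case empty
  show ?case
  proof (cases "\<forall>i\<in>I. z i = 0")
    case False
    then have "(\<Sum>i\<in>I. z i * z i) \<noteq> 0" using assms(1) by (subst sum_nonneg_eq_0_iff) auto
    then show ?thesis by auto
  qed auto
next
  case (insert a J)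
  show ?case
  proof (cases "\<exists>c. \<forall>i\<in>I. (\<Sum>j\<in>J. c j * A i j) = z i")
    case True
    then obtain c where c: "\<And>i. i \<in> I \<Longrightarrow> (\<Sum>j\<in>J. c j * A i j) = z i" by blast
    have "(\<Sum>j\<in>J. (if j = a then 0 else c j) * A i j) = (\<Sum>j\<in>J. c j * A i j)" for i
      using insert.hyps by (intro sum.cong) auto
    then show ?thesis using c insert.hyps by (intro disjI1 exI[of _ "\<lambda>j. if j = a then 0 else c j"]) simp
  next
    case False
    then obtain w where w: "\<And>j. j \<in> J \<Longrightarrow> (\<Sum>i\<in>I. w i * A i j) = 0" "(\<Sum>i\<in>I. w i * z i) \<noteq> 0"
      using insert.IH[of z] by blast
    define wa where "wa = (\<Sum>i\<in>I. w i * A i a)"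
    define wz where "wz = (\<Sum>i\<in>I. w i * z i)"
    show ?thesis
    proof (cases "wa = 0")
      case True
      then show ?thesis using w by (intro disjI2 exI[of _ w]) (auto simp: wa_def)
    next
      case wa0: False
      \<comment> \<open>Subtracting this multiple of the new column makes the right side orthogonal
        to w. If the old columns produce the rest, \<open>wz / wa\<close> is the new
        coefficient.\<close>
      define z' where "z' i = z i - wz / wa * A i a" for i
      from insert.IH[of z'] show ?thesis
      proof
        assume "\<exists>c. \<forall>i\<in>I. (\<Sum>j\<in>J. c j * A i j) = z' i"
        then obtain c where c: "\<And>i. i \<in> I \<Longrightarrow> (\<Sum>j\<in>J. c j * A i j) = z' i" by blast
        have "(\<Sum>j\<in>J. (if j = a then wz / wa else c j) * A i j) = (\<Sum>j\<in>J. c j * A i j)" for i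
          using insert.hyps by (intro sum.cong) auto
        then show ?thesis using c insert.hyps
          by (intro disjI1 exI[of _ "\<lambda>j. if j = a then wz / wa else c j"]) (simp add: z'_def)
      next
        assume "\<exists>w. (\<forall>j\<in>J. (\<Sum>i\<in>I. w i * A i j) = 0) \<and> (\<Sum>i\<in>I. w i * z' i) \<noteq> 0"
        then obtain v where v: "\<And>j. j \<in> J \<Longrightarrow> (\<Sum>i\<in>I. v i * A i j) = 0" "(\<Sum>i\<in>I. v i * z' i) \<noteq> 0" by blast
        define va where "va = (\<Sum>i\<in>I. v i * A i a)"
        \<comment> \<open>The multiple of w makes v annihilate the new column too. The old columns
          stay annihilated, and u pairs with z as v does with z'.\<close>
        define u where "u i = v i - va / wa * w i" for i
        have lin: "(\<Sum>i\<in>I. u i * t i) = (\<Sum>i\<in>I. v i * t i) - va / wa * (\<Sum>i\<in>I. w i * t i)" for t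
          by (simp add: u_def left_diff_distrib sum_subtractf sum_distrib_left mult.assoc)
        have "(\<Sum>i\<in>I. v i * z' i) = (\<Sum>i\<in>I. v i * z i) - wz / wa * va"
          by (simp add: z'_def right_diff_distrib sum_subtractf sum_distrib_left va_def mult_ac)
        then have "(\<Sum>i\<in>I. u i * z i) \<noteq> 0" using v(2) by (simp add: lin wz_def[symmetric] mult.commute)
        moreover have "(\<Sum>i\<in>I. u i * A i j) = 0" if "j \<in> insert a J" for j
          using that v(1) w(1) wa0 by (auto simp: lin va_def[symmetric] wa_def[symmetric])
        ultimately show ?thesis by blast
      qed
    qed
  qed
qed

definition affine_basis :: "nat \<Rightarrow> real^2 \<Rightarrow> real" where
  "affine_basis k y = (if k = 0 then 1 else if k = 1 then y $ 1 else y $ 2)"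

lemma affine_basis_sum: "(\<Sum>k\<in>{0..2::nat}. a k * affine_basis k y) = vector [a 1, a 2] \<bullet> y + a 0"
proof -
  have "{0..2::nat} = {0, 1, 2}" by auto
  then show ?thesis by (simp add: affine_basis_def inner_vec_def sum_2)
qed

lemma B_space_affine_basis:
  "\<beta> \<in> B_space n x \<longleftrightarrow> (\<forall>k\<in>{0..2}. (\<Sum>r=1..n. \<beta> r * affine_basis k (x r)) = 0)"
proof -
  have "{0..2::nat} = {0, 1, 2}" by auto
  then show ?thesis by (auto simp: affine_basis_def B_space_def vec_eq_iff forall_2)
qed

text \<open>The bordered symmetric system of kernel values and affine functions is singular for
  collinear points, so it is solved by the alternative. A vector orthogonal to all columns is itself
  a spline vanishing at the points; its penalty is then 0, which forces \<beta> = 0 and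
  orthogonality to the data.\<close>

theorem tps_interpolation:
  assumes inj: "inj_on x {1..n}"
  shows "\<exists>s. thin_plate_spline n x s \<and> (\<forall>r\<in>{1..n}. s (x r) = z r)"
proof -
  define I where "I = ({1..n} <+> {0..2::nat})"
  have finI: "finite I" by (simp add: I_def)
  \<comment> \<open>Rows \<open>Inl r\<close> are the interpolation conditions and rows
    \<open>Inr k\<close> the moment conditions of \<open>B_space\<close>; columns belong to the
    kernel and the affine coefficients.\<close>
  define A :: "nat + nat \<Rightarrow> nat + nat \<Rightarrow> real" where
    "A p q = (case p of Inl r \<Rightarrow> (case q of Inl s \<Rightarrow> K (norm (x r - x s)) | Inr k \<Rightarrow> affine_basis k (x r))
       | Inr k \<Rightarrow> (case q of Inl s \<Rightarrow> affine_basis k (x s) | Inr l \<Rightarrow> 0))" for p q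
  define \<zeta> :: "nat + nat \<Rightarrow> real" where "\<zeta> p = (case p of Inl r \<Rightarrow> z r | Inr k \<Rightarrow> 0)" for p
  have sumI: "(\<Sum>p\<in>I. F p) = (\<Sum>r=1..n. F (Inl r)) + (\<Sum>k\<in>{0..2}. F (Inr k))" for F :: "nat + nat \<Rightarrow> real"
    unfolding I_def by (subst sum.Plus) auto
  have sol: "\<exists>c. \<forall>p\<in>I. (\<Sum>q\<in>I. c q * A p q) = \<zeta> p"
  proof (rule ccontr)
    assume "\<not> ?thesis"
    then obtain w where w: "\<And>q. q \<in> I \<Longrightarrow> (\<Sum>p\<in>I. w p * A p q) = 0" "(\<Sum>p\<in>I. w p * \<zeta> p) \<noteq> 0"
      using linear_system_alternative[OF finI finI, of A \<zeta>] by blast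
    define \<beta> where "\<beta> r = w (Inl r)" for r
    define a where "a k = w (Inr k)" for k
    define s where "s = tps0 n x \<beta> (vector [a 1, a 2]) (a 0) 0"
    have b: "\<beta> \<in> B_space n x"
      unfolding B_space_affine_basis
    proof
      fix k :: nat assume "k \<in> {0..2}"
      then have "Inr k \<in> I" by (auto simp: I_def)
      from w(1)[OF this] show "(\<Sum>r=1..n. \<beta> r * affine_basis k (x r)) = 0"
        unfolding sumI by (simp add: A_def \<beta>_def)
    qed
    have s0: "s (x r) = 0" if "r \<in> {1..n}" for r
    proof -
      have "Inl r \<in> I" using that by (auto simp: I_def)
      from w(1)[OF this] have "(\<Sum>t=1..n. \<beta> t * K (norm (x t - x r))) + (\<Sum>k\<in>{0..2}. a k * affine_basis k (x r)) = 0"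
        unfolding sumI by (simp add: A_def \<beta>_def a_def)
      then show ?thesis by (simp add: s_def tps0_def ker0_eq_K affine_basis_sum norm_minus_commute)
    qed
    have sS: "s \<in> Sob" unfolding s_def by (rule tps_Sob[OF b])
    \<comment> \<open>The penalty of s pairs its coefficients with its own values at the points,
      which are 0.\<close>
    have "penalty s = ker4_mass * (\<Sum>r=1..n. \<beta> r * s (x r))"
      using hpair_tps[OF b sS, of "vector [a 1, a 2]" "a 0"] penalty_eq[OF sS] by (simp add: s_def)
    also have "\<dots> = 0" using s0 by simp
    finally have H0: "has_L2_hessian s (\<lambda>y. 0)" by (rule penalty_zero_hessian[OF sS])
    \<comment> \<open>Since s has zero Hessian, the sum of \<open>\<beta> t * h (x t)\<close>
      vanishes for every h in \<open>Sob\<close>; an h separating \<open>x r\<close> isolates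
      \<open>\<beta> r\<close>. Here the points have to be distinct.\<close>
    have "\<beta> r = 0" if r: "r \<in> {1..n}" for r
    proof -
      obtain h where h: "h \<in> Sob" "h (x r) = 1" "\<And>p. p \<in> x ` {1..n} \<Longrightarrow> p \<noteq> x r \<Longrightarrow> h p = 0"
        using Sob_separates[of "x ` {1..n}" "x r"] by auto
      have "hpair s h = 0"
        using hpair_eq[OF sS H0 h(1) Sob_hessian[OF h(1)]] by simp
      then have "(\<Sum>t=1..n. \<beta> t * h (x t)) = 0"
        using hpair_tps[OF b h(1), of "vector [a 1, a 2]" "a 0"] ker4_mass_pos by (simp add: s_def)
      moreover have "(\<Sum>t=1..n. \<beta> t * h (x t)) = (\<Sum>t=1..n. if t = r then \<beta> t else 0)"
      proof (intro sum.cong refl)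
        fix t assume t: "t \<in> {1..n}"
        show "\<beta> t * h (x t) = (if t = r then \<beta> t else 0)"
          using h(2) h(3)[of "x t"] inj_onD[OF inj _ t r] t by auto
      qed
      ultimately show ?thesis using r by simp
    qed
    \<comment> \<open>The affine block of w is not forced to vanish, but \<zeta> is 0 there.\<close>
    then have "(\<Sum>p\<in>I. w p * \<zeta> p) = 0" unfolding sumI by (simp add: \<zeta>_def \<beta>_def)
    with w(2) show False by simp
  qed
  then obtain c where c: "\<And>p. p \<in> I \<Longrightarrow> (\<Sum>q\<in>I. c q * A p q) = \<zeta> p" by blast
  define \<beta> where "\<beta> r = c (Inl r)" for r
  define a where "a k = c (Inr k)" for k
  define s where "s = tps0 n x \<beta> (vector [a 1, a 2]) (a 0) 0"
  have "\<beta> \<in> B_space n x"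
    unfolding B_space_affine_basis
  proof
    fix k :: nat assume "k \<in> {0..2}"
    then have "Inr k \<in> I" by (auto simp: I_def)
    from c[OF this] show "(\<Sum>r=1..n. \<beta> r * affine_basis k (x r)) = 0"
      unfolding sumI by (simp add: A_def \<beta>_def \<zeta>_def)
  qed
  moreover have "s (x r) = z r" if "r \<in> {1..n}" for r
  proof -
    have "Inl r \<in> I" using that by (auto simp: I_def)
    from c[OF this] have "(\<Sum>t=1..n. \<beta> t * K (norm (x r - x t))) + (\<Sum>k\<in>{0..2}. a k * affine_basis k (x r)) = z r"
      unfolding sumI by (simp add: A_def \<beta>_def a_def \<zeta>_def)
    then show ?thesis by (simp add: s_def tps0_def ker0_eq_K affine_basis_sum)
  qed
  ultimately show ?thesis unfolding tps_iff s_def by blast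
qed

section \<open>Minimizers\<close>

theorem proposition1:
  fixes lam :: real and Nr N Nb :: nat
    and x :: "nat \<Rightarrow> real^2" and f :: "nat \<Rightarrow> real"
    and b :: "nat \<Rightarrow> real \<Rightarrow> real" and \<phi> :: "nat \<Rightarrow> nat \<Rightarrow> real"
  assumes "lam \<ge> 0" and "Nr \<ge> 1" and "N \<ge> 1"
    and "inj_on x {1..Nr}"
    and "\<And>\<nu>. \<nu> \<in> {1..Nb} \<Longrightarrow> b \<nu> \<in> L2 \<and> L2_norm (b \<nu>) = 1"
  shows "(\<exists>g. is_estimate lam Nr N Nb x f b \<phi> g
              \<and> (\<forall>\<nu>\<in>{1..Nb}. thin_plate_spline Nr x (g \<nu>)))
       \<and> (lam > 0 \<longrightarrow>
            (\<forall>g. is_estimate lam Nr N Nb x f b \<phi> g \<longrightarrow>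
                 (\<forall>\<nu>\<in>{1..Nb}. thin_plate_spline Nr x (g \<nu>))))"
proof -
  define w0 where "w0 = 1 / (real Nr * real N)"
  have w0: "w0 > 0" using assms by (simp add: w0_def)
  \<comment> \<open>Cardinal splines: in this basis the coefficients of a combination are its values
    at the points.\<close>
  have "\<forall>r. \<exists>e. thin_plate_spline Nr x e \<and> (\<forall>s\<in>{1..Nr}. e (x s) = (if s = r then 1 else 0))"
    using tps_interpolation[OF assms(4)] by (intro allI)
  then obtain e where e: "\<And>r. thin_plate_spline Nr x (e r)"
    "\<And>r s. s \<in> {1..Nr} \<Longrightarrow> e r (x s) = (if s = r then 1 else 0)" by metis
  have eS: "e r \<in> Sob" for r by (rule thin_plate_spline_Sob[OF e(1)])
  define P where "P r s = hpair (e r) (e s)" for r s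
  have P_commute: "P r s = P s r" for r s unfolding P_def by (rule hpair_commute)
  \<comment> \<open>The weights \<beta> of \<open>e r\<close> are read off by pairing it with the
    \<open>e s\<close>. So \<open>e r\<close> pairs with an arbitrary h as with the spline
    interpolant of h.\<close>
  have rep: "hpair (e r) h = (\<Sum>s=1..Nr. h (x s) * P r s)" if h: "h \<in> Sob" for r h
  proof -
    obtain \<beta> \<alpha>1 \<alpha>0 where \<beta>: "\<beta> \<in> B_space Nr x" "e r = tps0 Nr x \<beta> \<alpha>1 \<alpha>0 0" using e(1)[of r] by (auto simp: tps_iff)
    have "P r s = ker4_mass * \<beta> s" if s: "s \<in> {1..Nr}" for s
    proof -
      have "P r s = ker4_mass * (\<Sum>t=1..Nr. \<beta> t * e s (x t))"
        unfolding P_def using hpair_tps[OF \<beta>(1) eS, of \<alpha>1 \<alpha>0 s] \<beta>(2) by simp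
      also have "(\<Sum>t=1..Nr. \<beta> t * e s (x t)) = (\<Sum>t=1..Nr. if t = s then \<beta> t else 0)"
        by (intro sum.cong refl) (simp add: e(2))
      finally show ?thesis using s by simp
    qed
    then have "(\<Sum>s=1..Nr. h (x s) * P r s) = (\<Sum>s=1..Nr. ker4_mass * (\<beta> s * h (x s)))"
      by (intro sum.cong refl) (simp add: mult_ac)
    then show ?thesis using hpair_tps[OF \<beta>(1) h, of \<alpha>1 \<alpha>0] \<beta>(2) by (simp add: sum_distrib_left)
  qed
  \<comment> \<open>Families of splines with one unknown \<open>c (\<nu>, r)\<close> for each
    component and each point.\<close>
  define comb where "comb c \<nu> y = (\<Sum>r=1..Nr. c (\<nu>, r) * e r y)" for c :: "nat \<times> nat \<Rightarrow> real" and \<nu> y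
  have comb_tps: "thin_plate_spline Nr x (comb c \<nu>)" for c \<nu>
    unfolding comb_def[abs_def] by (intro thin_plate_spline_sum e)
  have comb_Sob: "comb c \<nu> \<in> Sob" for c \<nu> by (rule thin_plate_spline_Sob[OF comb_tps])
  have comb_at: "comb c \<nu> (x s) = c (\<nu>, s)" if "s \<in> {1..Nr}" for c \<nu> s
  proof -
    have "comb c \<nu> (x s) = (\<Sum>r=1..Nr. if r = s then c (\<nu>, r) else 0)"
      unfolding comb_def using that by (intro sum.cong refl) (simp add: e(2))
    then show ?thesis using that by simp
  qed
  have comb_hpair: "hpair (comb c \<nu>) h = (\<Sum>s=1..Nr. h (x s) * (\<Sum>r=1..Nr. c (\<nu>, r) * P r s))" if h: "h \<in> Sob" for c \<nu> h
  proof -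
    have "hpair (comb c \<nu>) h = (\<Sum>r=1..Nr. c (\<nu>, r) * hpair (e r) h)"
      unfolding hpair_commute[of _ h] comb_def[abs_def] by (rule hpair_sum[OF eS h])
    also have "\<dots> = (\<Sum>r=1..Nr. \<Sum>s=1..Nr. h (x s) * (c (\<nu>, r) * P r s))"
      unfolding rep[OF h] by (simp add: sum_distrib_left mult_ac)
    also have "\<dots> = (\<Sum>s=1..Nr. h (x s) * (\<Sum>r=1..Nr. c (\<nu>, r) * P r s))"
      by (subst sum.swap) (simp add: sum_distrib_left)
    finally show ?thesis .
  qed
  define I where "I = {1..Nb} \<times> {1..Nr}"
  have finI: "finite I" by (simp add: I_def)
  have sumI: "(\<Sum>p\<in>I. F p) = (\<Sum>\<nu>=1..Nb. \<Sum>r=1..Nr. F (\<nu>, r))" for F :: "nat \<times> nat \<Rightarrow> real"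
    by (simp add: I_def sum.cartesian_product)
  \<comment> \<open>Matrix of the normal equations: the data couple the components at one point, the
    penalty couples the points within one component.\<close>
  define A where "A p q = w0 * (if snd p = snd q then \<Sum>n=1..N. b (fst p) (f n) * b (fst q) (f n) else 0)
      + lam * (if fst p = fst q then P (snd p) (snd q) else 0)" for p q :: "nat \<times> nat"
  define l where "l p = w0 * (\<Sum>n=1..N. \<phi> (snd p) n * b (fst p) (f n))" for p :: "nat \<times> nat"
  have A_commute: "A p q = A q p" for p q by (auto simp: A_def P_commute mult.commute)
  have contract: "(\<Sum>p\<in>I. w p * A p (\<mu>, s)) =
      w0 * (\<Sum>n=1..N. (\<Sum>\<nu>=1..Nb. w (\<nu>, s) * b \<nu> (f n)) * b \<mu> (f n)) + lam * (\<Sum>r=1..Nr. w (\<mu>, r) * P r s)"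
    if m: "\<mu> \<in> {1..Nb}" and s: "s \<in> {1..Nr}" for w \<mu> s
  proof -
    have "(\<Sum>r=1..Nr. w (\<nu>, r) * A (\<nu>, r) (\<mu>, s)) = w (\<nu>, s) * (w0 * (\<Sum>n=1..N. b \<nu> (f n) * b \<mu> (f n)))
        + (if \<nu> = \<mu> then (\<Sum>r=1..Nr. w (\<nu>, r) * (lam * P r s)) else 0)" for \<nu>
    proof -
      have "w (\<nu>, r) * A (\<nu>, r) (\<mu>, s) = (if r = s then w (\<nu>, r) * (w0 * (\<Sum>n=1..N. b \<nu> (f n) * b \<mu> (f n))) else 0)
        + (if \<nu> = \<mu> then w (\<nu>, r) * (lam * P r s) else 0)" for r
        by (simp add: A_def distrib_left)
      then show ?thesis using s by (simp add: sum.distrib)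
    qed
    then have "(\<Sum>p\<in>I. w p * A p (\<mu>, s)) =
      (\<Sum>\<nu>=1..Nb. w (\<nu>, s) * (w0 * (\<Sum>n=1..N. b \<nu> (f n) * b \<mu> (f n)))) + (\<Sum>r=1..Nr. w (\<mu>, r) * (lam * P r s))"
      unfolding sumI using m by (simp add: sum.distrib)
    also have "(\<Sum>\<nu>=1..Nb. w (\<nu>, s) * (w0 * (\<Sum>n=1..N. b \<nu> (f n) * b \<mu> (f n)))) =
       w0 * (\<Sum>n=1..N. (\<Sum>\<nu>=1..Nb. w (\<nu>, s) * b \<nu> (f n)) * b \<mu> (f n))"
      unfolding sum_distrib_left sum_distrib_right by (subst sum.swap) (simp add: mult_ac)
    finally show ?thesis by (simp add: sum_distrib_left mult_ac)
  qed
  \<comment> \<open>A can be singular, for instance when two of the functions b agree at all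
    \<open>f n\<close> and lam = 0. A kernel vector w has zero energy, a sum of two nonnegative
    parts, so its fitted values \<open>fw\<close> vanish; and w pairs with l through these values
    only.\<close>
  have "\<exists>c. \<forall>p\<in>I. (\<Sum>q\<in>I. c q * A p q) = l p"
  proof (rule ccontr)
    assume "\<not> ?thesis"
    then obtain w where w: "\<And>q. q \<in> I \<Longrightarrow> (\<Sum>p\<in>I. w p * A p q) = 0" "(\<Sum>p\<in>I. w p * l p) \<noteq> 0"
      using linear_system_alternative[OF finI finI, of A l] by blast
    define fw where "fw s n = (\<Sum>\<nu>=1..Nb. w (\<nu>, s) * b \<nu> (f n))" for s n
    have pen: "penalty (comb w \<mu>) = (\<Sum>s=1..Nr. w (\<mu>, s) * (\<Sum>r=1..Nr. w (\<mu>, r) * P r s))" for \<mu>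
      unfolding penalty_eq[OF comb_Sob] comb_hpair[OF comb_Sob] by (intro sum.cong refl) (simp add: comb_at)
    \<comment> \<open>The quadratic form of A at w is the weighted sum of squared fitted values plus
      the penalties.\<close>
    have "0 = (\<Sum>q\<in>I. w q * (\<Sum>p\<in>I. w p * A p q))" using w(1) by simp
    also have "\<dots> = (\<Sum>\<mu>=1..Nb. \<Sum>s=1..Nr. w (\<mu>, s) * (w0 * (\<Sum>n=1..N. fw s n * b \<mu> (f n))) + w (\<mu>, s) * (lam * (\<Sum>r=1..Nr. w (\<mu>, r) * P r s)))"
      by (subst sumI, intro sum.cong refl) (simp only: contract fw_def distrib_left)
    also have "\<dots> = w0 * (\<Sum>\<mu>=1..Nb. \<Sum>s=1..Nr. \<Sum>n=1..N. fw s n * (w (\<mu>, s) * b \<mu> (f n))) + lam * (\<Sum>\<mu>=1..Nb. penalty (comb w \<mu>))"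
      by (simp add: sum.distrib pen sum_distrib_left mult_ac)
    also have "(\<Sum>\<mu>=1..Nb. \<Sum>s=1..Nr. \<Sum>n=1..N. fw s n * (w (\<mu>, s) * b \<mu> (f n))) = (\<Sum>s=1..Nr. \<Sum>n=1..N. (fw s n)\<^sup>2)"
    proof -
      have "(\<Sum>\<mu>=1..Nb. \<Sum>s=1..Nr. \<Sum>n=1..N. fw s n * (w (\<mu>, s) * b \<mu> (f n)))
        = (\<Sum>s=1..Nr. \<Sum>\<mu>=1..Nb. \<Sum>n=1..N. fw s n * (w (\<mu>, s) * b \<mu> (f n)))" by (rule sum.swap)
      also have "\<dots> = (\<Sum>s=1..Nr. \<Sum>n=1..N. \<Sum>\<mu>=1..Nb. fw s n * (w (\<mu>, s) * b \<mu> (f n)))"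
        by (intro sum.cong refl sum.swap)
      finally show ?thesis by (simp add: power2_eq_square fw_def sum_distrib_left)
    qed
    finally have z: "w0 * (\<Sum>s=1..Nr. \<Sum>n=1..N. (fw s n)\<^sup>2) + lam * (\<Sum>\<mu>=1..Nb. penalty (comb w \<mu>)) = 0" by simp
    have "0 \<le> lam * (\<Sum>\<mu>=1..Nb. penalty (comb w \<mu>))"
      using assms(1) by (intro mult_nonneg_nonneg sum_nonneg penalty_nonneg)
    moreover have n1: "0 \<le> (\<Sum>s=1..Nr. \<Sum>n=1..N. (fw s n)\<^sup>2)" by (intro sum_nonneg) auto
    then have "0 \<le> w0 * (\<Sum>s=1..Nr. \<Sum>n=1..N. (fw s n)\<^sup>2)" using w0 by simp
    ultimately have "w0 * (\<Sum>s=1..Nr. \<Sum>n=1..N. (fw s n)\<^sup>2) = 0" using z by linarith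
    then have "(\<Sum>s=1..Nr. \<Sum>n=1..N. (fw s n)\<^sup>2) = 0" using w0 by simp
    then have fw0: "fw s n = 0" if "s \<in> {1..Nr}" "n \<in> {1..N}" for s n
      using that by (simp add: sum_nonneg_eq_0_iff sum_nonneg)
    have "(\<Sum>p\<in>I. w p * l p) = (\<Sum>\<nu>=1..Nb. \<Sum>r=1..Nr. \<Sum>n=1..N. w0 * \<phi> r n * (w (\<nu>, r) * b \<nu> (f n)))"
      unfolding sumI by (simp add: l_def sum_distrib_left mult_ac)
    also have "\<dots> = (\<Sum>r=1..Nr. \<Sum>\<nu>=1..Nb. \<Sum>n=1..N. w0 * \<phi> r n * (w (\<nu>, r) * b \<nu> (f n)))" by (rule sum.swap)
    also have "\<dots> = (\<Sum>r=1..Nr. \<Sum>n=1..N. \<Sum>\<nu>=1..Nb. w0 * \<phi> r n * (w (\<nu>, r) * b \<nu> (f n)))"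
      by (intro sum.cong refl sum.swap)
    also have "\<dots> = (\<Sum>r=1..Nr. \<Sum>n=1..N. w0 * \<phi> r n * fw r n)" by (simp add: fw_def sum_distrib_left)
    also have "\<dots> = 0" using fw0 by simp
    finally show False using w(2) by simp
  qed
  then obtain c where c: "\<And>p. p \<in> I \<Longrightarrow> (\<Sum>q\<in>I. c q * A p q) = l p" by blast
  define g where "g = comb c"
  have gS: "g \<nu> \<in> Sob" for \<nu> unfolding g_def by (rule comb_Sob)
  define fit where "fit u r n = (\<Sum>\<nu>=1..Nb. u \<nu> (x r) * b \<nu> (f n))" for u :: "nat \<Rightarrow> real^2 \<Rightarrow> real" and r n
  have cost_eq: "cost lam Nr N Nb x f b \<phi> u = w0 * (\<Sum>r=1..Nr. \<Sum>n=1..N. (\<phi> r n - fit u r n)\<^sup>2) + lam * (\<Sum>\<nu>=1..Nb. penalty (u \<nu>))" for u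
    by (simp add: cost_def w0_def fit_def)
  \<comment> \<open>The equation for (\<mu>, s), read as a balance between residuals and
    penalty.\<close>
  have normal: "w0 * (\<Sum>n=1..N. (\<phi> s n - fit g s n) * b \<mu> (f n)) = lam * (\<Sum>r=1..Nr. c (\<mu>, r) * P r s)"
    if m: "\<mu> \<in> {1..Nb}" and s: "s \<in> {1..Nr}" for \<mu> s
  proof -
    have "(\<mu>, s) \<in> I" using m s by (simp add: I_def)
    from c[OF this] have "(\<Sum>q\<in>I. c q * A q (\<mu>, s)) = l (\<mu>, s)" by (simp add: A_commute)
    moreover have "fit g s n = (\<Sum>\<nu>=1..Nb. c (\<nu>, s) * b \<nu> (f n))" for n using s by (simp add: fit_def g_def comb_at)
    ultimately have "w0 * (\<Sum>n=1..N. fit g s n * b \<mu> (f n)) + lam * (\<Sum>r=1..Nr. c (\<mu>, r) * P r s) = w0 * (\<Sum>n=1..N. \<phi> s n * b \<mu> (f n))"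
      using contract[OF m s, of c] by (simp add: l_def)
    then show ?thesis by (simp add: left_diff_distrib sum_subtractf right_diff_distrib)
  qed
  \<comment> \<open>An exact expansion of the cost around g for all competitors in
    \<open>Sob\<close>, splines or not. By \<open>comb_hpair\<close> the cross term of the penalty
    sees the direction h only at the points, so the normal equations cancel it against the cross
    term of the data.\<close>
  have expand: "cost lam Nr N Nb x f b \<phi> u = cost lam Nr N Nb x f b \<phi> g
      + (w0 * (\<Sum>r=1..Nr. \<Sum>n=1..N. (fit h r n)\<^sup>2) + lam * (\<Sum>\<nu>=1..Nb. penalty (h \<nu>)))"
    if u: "\<forall>\<nu>\<in>{1..Nb}. u \<nu> \<in> Sob" and h: "h = (\<lambda>\<nu> y. u \<nu> y + (-1) * g \<nu> y)" for u h
  proof -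
    have hS: "h \<nu> \<in> Sob" if "\<nu> \<in> {1..Nb}" for \<nu> unfolding h using u that gS by (intro Sob_add_scaled) auto
    have ug: "u \<nu> = (\<lambda>y. g \<nu> y + h \<nu> y)" for \<nu> by (simp add: h)
    have fit: "fit u r n = fit g r n + fit h r n" for r n by (simp add: fit_def ug distrib_right sum.distrib)
    have pen: "(\<Sum>\<nu>=1..Nb. penalty (u \<nu>)) = (\<Sum>\<nu>=1..Nb. penalty (g \<nu>)) + 2 * (\<Sum>\<nu>=1..Nb. hpair (g \<nu>) (h \<nu>)) + (\<Sum>\<nu>=1..Nb. penalty (h \<nu>))"
      unfolding ug using penalty_add[OF gS hS] by (simp add: sum.distrib sum_distrib_left)
    have "lam * (\<Sum>\<nu>=1..Nb. hpair (g \<nu>) (h \<nu>)) = (\<Sum>\<nu>=1..Nb. \<Sum>s=1..Nr. h \<nu> (x s) * (lam * (\<Sum>r=1..Nr. c (\<nu>, r) * P r s)))"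
      unfolding g_def by (simp add: comb_hpair hS sum_distrib_left mult_ac)
    also have "\<dots> = (\<Sum>\<nu>=1..Nb. \<Sum>s=1..Nr. h \<nu> (x s) * (w0 * (\<Sum>n=1..N. (\<phi> s n - fit g s n) * b \<nu> (f n))))"
      by (intro sum.cong refl) (simp only: normal)
    also have "\<dots> = (\<Sum>\<nu>=1..Nb. \<Sum>s=1..Nr. \<Sum>n=1..N. w0 * ((\<phi> s n - fit g s n) * (h \<nu> (x s) * b \<nu> (f n))))"
      by (simp add: sum_distrib_left mult_ac)
    also have "\<dots> = (\<Sum>s=1..Nr. \<Sum>\<nu>=1..Nb. \<Sum>n=1..N. w0 * ((\<phi> s n - fit g s n) * (h \<nu> (x s) * b \<nu> (f n))))" by (rule sum.swap)
    also have "\<dots> = (\<Sum>s=1..Nr. \<Sum>n=1..N. \<Sum>\<nu>=1..Nb. w0 * ((\<phi> s n - fit g s n) * (h \<nu> (x s) * b \<nu> (f n))))"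
      by (intro sum.cong refl sum.swap)
    also have "\<dots> = w0 * (\<Sum>s=1..Nr. \<Sum>n=1..N. (\<phi> s n - fit g s n) * fit h s n)"
      by (simp add: fit_def[of h] sum_distrib_left)
    finally have cross: "lam * (\<Sum>\<nu>=1..Nb. hpair (g \<nu>) (h \<nu>)) = w0 * (\<Sum>s=1..Nr. \<Sum>n=1..N. (\<phi> s n - fit g s n) * fit h s n)" .
    have "(\<phi> r n - fit u r n)\<^sup>2 = (\<phi> r n - fit g r n)\<^sup>2 - 2 * ((\<phi> r n - fit g r n) * fit h r n) + (fit h r n)\<^sup>2" for r n
      unfolding fit by (simp add: power2_eq_square algebra_simps)
    then have "(\<Sum>r=1..Nr. \<Sum>n=1..N. (\<phi> r n - fit u r n)\<^sup>2) = (\<Sum>r=1..Nr. \<Sum>n=1..N. (\<phi> r n - fit g r n)\<^sup>2)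
      - 2 * (\<Sum>r=1..Nr. \<Sum>n=1..N. (\<phi> r n - fit g r n) * fit h r n) + (\<Sum>r=1..Nr. \<Sum>n=1..N. (fit h r n)\<^sup>2)"
      by (simp add: sum.distrib sum_subtractf sum_distrib_left)
    then show ?thesis unfolding cost_eq pen using cross by algebra
  qed
  have excess: "0 \<le> w0 * (\<Sum>r=1..Nr. \<Sum>n=1..N. (fit h r n)\<^sup>2)" "0 \<le> lam * (\<Sum>\<nu>=1..Nb. penalty (h \<nu>))" for h
    using w0 assms(1) by (auto intro!: mult_nonneg_nonneg sum_nonneg penalty_nonneg)
  have min: "cost lam Nr N Nb x f b \<phi> g \<le> cost lam Nr N Nb x f b \<phi> u" if "\<forall>\<nu>\<in>{1..Nb}. u \<nu> \<in> Sob" for u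
    unfolding expand[OF that refl]
    using add_nonneg_nonneg[OF excess(1,2), of "\<lambda>\<nu> y. u \<nu> y + (-1) * g \<nu> y" "\<lambda>\<nu> y. u \<nu> y + (-1) * g \<nu> y"]
    by linarith
  have est: "is_estimate lam Nr N Nb x f b \<phi> g"
    unfolding is_estimate_def is_arg_min_def using gS min by (auto simp: not_less)
  have "thin_plate_spline Nr x (u \<nu>)"
    if lam: "lam > 0" and u: "is_estimate lam Nr N Nb x f b \<phi> u" and n: "\<nu> \<in> {1..Nb}" for u \<nu>
  proof -
    have uS: "\<forall>\<nu>\<in>{1..Nb}. u \<nu> \<in> Sob" using u by (simp add: is_estimate_def is_arg_min_def)
    define h where "h = (\<lambda>\<nu> y. u \<nu> y + (-1) * g \<nu> y)"
    have "\<not> cost lam Nr N Nb x f b \<phi> g < cost lam Nr N Nb x f b \<phi> u"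
      using u gS unfolding is_estimate_def is_arg_min_def by blast
    then have "lam * (\<Sum>\<nu>=1..Nb. penalty (h \<nu>)) = 0" using expand[OF uS h_def] excess[of h] by linarith
    then have "(\<Sum>\<nu>=1..Nb. penalty (h \<nu>)) = 0" using lam by simp
    then have p0: "penalty (h \<nu>) = 0" using n by (simp add: sum_nonneg_eq_0_iff penalty_nonneg)
    have hS: "h \<nu> \<in> Sob" unfolding h_def using uS n gS by (intro Sob_add_scaled) auto
    obtain \<alpha>1 \<alpha>0 where aff: "\<And>y. h \<nu> y = \<alpha>1 \<bullet> y + \<alpha>0"
      using zero_hessian_affine[OF Sob_continuous[OF hS] penalty_zero_hessian[OF hS p0]] by blast
    \<comment> \<open>An affine function is a spline with zero weights, so adding it to
      \<open>g \<nu>\<close> stays within the splines.\<close>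
    have "u \<nu> = (\<lambda>y. g \<nu> y + 1 * (\<alpha>1 \<bullet> y + \<alpha>0))"
    proof
      fix y show "u \<nu> y = g \<nu> y + 1 * (\<alpha>1 \<bullet> y + \<alpha>0)" using aff[of y] by (simp add: h_def)
    qed
    then show ?thesis
      using thin_plate_spline_add_scaled[OF comb_tps[of c \<nu>] thin_plate_spline_affine, of 1 \<alpha>1 \<alpha>0] by (simp add: g_def)
  qed
  with est comb_tps show ?thesis unfolding g_def by blast
qed

end
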